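(* Let $k$ be an algebraically closed field of characteristic $p\geq 3$. Fix scalars $\mu,a\in k$ not both zero. Then $|\mathbb{M}_{1;1}|_{L_{(\mu,a^p)}}$ is equal to the affine line in $|\mathbb{M}_{1;1}|$ through the point $(\mu,a^p)$.
   Context: "Super" means $\mathbb{Z}_2$-graded. $\mathbb{M}_{1;1}=\mathbb{G}_{a(1)}\times\mathbb{G}_a^-$ is the finite $k$-supergroup scheme whose group algebra is the Hopf superalgebra $k\mathbb{M}_{1;1}=k[s,t]/\langle s^p,t^2\rangle$, with $s$ even, $t$ odd, $st=ts$, and $s,t$ primitive. Cohomology and support varieties: for $A=k\mathbb{M}_{1;1}$-supermodules $V,W$, $\mathrm{Hom}_A(V,W)$ is the $\mathbb{Z}_2$-graded space of (even and odd) supermodule homomorphisms, $\phi(av)=(-1)^{\overline a\,\overline\phi}a\phi(v)$, and $\mathrm{Ext}_A^n$ denotes its derived functors on the abelian category of $A$-supermodules with even homomorphisms. $\mathrm{H}^n(\mathbb{M}_{1;1},k)=\mathrm{Ext}_A^n(k,k)$, and $H(\mathbb{M}_{1;1},k)=\bigoplus_n\mathrm{H}^n(\mathbb{M}_{1;1},k)_{\overline n}$, a finitely generated commutative algebra. $|\mathbb{M}_{1;1}|$ denotes its maximal ideal spectrum (an affine variety), and for a finite-dimensional supermodule $M$, $|\mathbb{M}_{1;1}|_M\subseteq|\mathbb{M}_{1;1}|$ is the closed subvariety defined by the kernel $I_M$ of $H(\mathbb{M}_{1;1},k)\to\mathrm{Ext}_A^\bullet(M,M)$, $z\mapsto 1_M\cup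 z$. Coordinates: $\mathrm{H}^\bullet(\mathbb{M}_{1;1},k)\cong k[x_1,y]\otimes\Lambda(\lambda_1)$ with $y\in \mathrm{H}^1_{\overline 1}$ (dual to $t$), $\lambda_1\in \mathrm{H}^1_{\overline 0}$ and $x_1\in \mathrm{H}^2_{\overline 0}$, where $x_1$ is the class inflated from the factor $k[s]/\langle s^p\rangle$ normalized so that its inflation to $\mathbb{P}_1=k[u,v]/\langle u^p+v^2\rangle$ ($u$ even, $v$ odd) along $u\mapsto s$, $v\mapsto t$ equals the square of the inflation of $y$. The variety $|\mathbb{M}_{1;1}|$ is identified with $k^2=\{(\mu,a)\}$, the point $(\mu,a)$ corresponding to the algebra homomorphism $H(\mathbb{M}_{1;1},k)\to k$ with $y\mapsto\mu$, $x_1\mapsto a$. If $\mu,a$ are not both zero, the affine line in $|\mathbb{M}_{1;1}|$ through $(\mu,a)$ is $\{(\lambda\mu,\lambda^2a):\lambda\in k\}$ (the orbit closure under dilation by cohomological degree). Two nonzero points $(\mu_0,a_0)$ and $(\mu_1,a_1)$ lie on the same affine line iff $a_0\mu_1^2=a_1\mu_0^2$. The supermodules: for $(\mu,a)\in k^2$ nonzero, $L_{(\mu,a)}$ is the $k\mathbb{M}_{1;1}$-supermodule with basis of even vectors $x_0,\ldots,x_{p-1}$ and odd vectors $y_0,\ldots,y_{p-1}$; put $x_i=y_i=0$ for $i\geq p$. The action is $$s.x_0=-\mu^2x_1,\quad s.x_i=x_{i+1}\ (i\geq1),\quad s.y_i=y_{i+1}\ (i\geq0),$$ $$t.x_0=a\,y_{p-1},\quad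 t.x_i=0\ (i\geq1),\quad t.y_i=x_{i+1}\ (i\geq0).$$ (Thus for $L_{(\mu,a^p)}$ one has $t.x_0=a^py_{p-1}$.) *)

theory Defs
  imports
    "HOL-Library.Z2"
    "HOL-Library.Function_Algebras"
    "HOL-Computational_Algebra.Polynomial"
    "HOL-Algebra.QuotRing"
begin

section \<open>The superalgebras\<close>

text \<open>
  Parities are elements of the two-element field \<^typ>\<open>bit\<close>.
  All superalgebras below are quotients \<open>A = S/I\<close> of \<open>S = k[s,t]\<close>, where \<open>s\<close> is even, \<open>t\<close> is odd and
  \<open>I\<close> is a parity-homogeneous ideal contained in \<open>(s,t)\<close>. Here \<open>S\<close> is \<^typ>\<open>'k poly poly\<close> with outer
  variable \<open>t\<close>. A quotient is represented by the ideal \<open>I\<close>: a multilinear map on \<open>A\<close> is a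
  multilinear map on \<open>S\<close> that vanishes as soon as one of its arguments lies in \<open>I\<close>. In particular, if
  \<open>J \<subseteq> I\<close>, then pulling such a map back along \<open>S/J \<rightarrow> S/I\<close> does not change the underlying function.
\<close>

type_synonym 'k st = "'k poly poly"

definition s_gen :: "'k::field st" where "s_gen = [:[:0, 1:]:]"
definition t_gen :: "'k::field st" where "t_gen = [:0, 1:]"

definition M11_ideal :: "nat \<Rightarrow> 'k::field st set" \<comment> \<open>\<open>k[s,t]/\<langle>s\<^sup>p, t\<^sup>2\<rangle>\<close>\<close>
  where "M11_ideal p = {s_gen ^ p * f + t_gen ^ 2 * g | f g. True}"

definition P1_ideal :: "nat \<Rightarrow> 'k::field st set" \<comment> \<open>\<open>k[u,v]/\<langle>u\<^sup>p + v\<^sup>2\<rangle>\<close>, with \<open>u, v\<close> written \<open>s, t\<close>\<close>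
  where "P1_ideal p = {(s_gen ^ p + t_gen ^ 2) * f | f. True}"

definition Ga1_ideal :: "nat \<Rightarrow> 'k::field st set" \<comment> \<open>\<open>k[s]/\<langle>s\<^sup>p\<rangle>\<close>\<close>
  where "Ga1_ideal p = {s_gen ^ p * f + t_gen * g | f g. True}"

definition st_part :: "bit \<Rightarrow> 'k::field st set"
  where "st_part i = {q. \<forall>j. coeff q j \<noteq> 0 \<longrightarrow> of_nat j = i}"

definition counit :: "'k::field st \<Rightarrow> 'k"
  where "counit q = coeff (coeff q 0) 0"

definition koszul :: "bit \<Rightarrow> 'v::ab_group_add \<Rightarrow> 'v" \<comment> \<open>\<open>(-1)\<^sup>i v\<close>\<close>
  where "koszul i v = (if i = 0 then v else - v)"


section \<open>Supermodules\<close>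

text \<open>
  The underlying space of a supermodule is the sum of its two homogeneous parts, which are subspaces
  of an ambient vector space; the algebra acts through the operators of \<open>s\<close> and \<open>t\<close>.
\<close>

record ('k, 'v) supermodule =
  scl :: "'k \<Rightarrow> 'v \<Rightarrow> 'v"
  part :: "bit \<Rightarrow> 'v set"
  s_act :: "'v \<Rightarrow> 'v"
  t_act :: "'v \<Rightarrow> 'v"

definition smod_carrier :: "('k, 'v::ab_group_add) supermodule \<Rightarrow> 'v set"
  where "smod_carrier M = {v + w | v w. v \<in> part M 0 \<and> w \<in> part M 1}"

definition M11_supermodule :: "nat \<Rightarrow> ('k::field, 'v::ab_group_add) supermodule \<Rightarrow> bool" where
  "M11_supermodule p M \<longleftrightarrow>
     vector_space (scl M) \<and>
     (\<forall>i. module.subspace (scl M) (part M i)) \<and>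
     part M 0 \<inter> part M 1 = {0} \<and>
     (\<forall>i. \<forall>v\<in>part M i. s_act M v \<in> part M i \<and> t_act M v \<in> part M (i + 1)) \<and>
     (\<forall>v\<in>smod_carrier M. \<forall>w\<in>smod_carrier M.
        s_act M (v + w) = s_act M v + s_act M w \<and> t_act M (v + w) = t_act M v + t_act M w) \<and>
     (\<forall>c. \<forall>v\<in>smod_carrier M.
        s_act M (scl M c v) = scl M c (s_act M v) \<and> t_act M (scl M c v) = scl M c (t_act M v)) \<and>
     (\<forall>v\<in>smod_carrier M.
        s_act M (t_act M v) = t_act M (s_act M v) \<and>
        (s_act M ^^ p) v = 0 \<and> t_act M (t_act M v) = 0)"

definition trivial_smod :: "('k::field, 'k) supermodule"
  where "trivial_smod =
    \<lparr>scl = (*), part = (\<lambda>i. if i = 0 then UNIV else {0}), s_act = (\<lambda>_. 0), t_act = (\<lambda>_. 0)\<rparr>"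


section \<open>Ext via the bar resolution\<close>

text \<open>
  Let \<open>B\<^sub>n = A \<otimes> A\<^bsup>\<otimes>n\<^esup>\<close> be the bar resolution of the trivial module \<open>k\<close>, with \<open>A\<close> acting on the left
  factor and (even) differential
  \<open>[a\<^sub>0|\<dots>|a\<^sub>n] \<mapsto> \<Sum>\<^bsub>i<n\<^esub> (-1)\<^sup>i [a\<^sub>0|\<dots>|a\<^sub>i a\<^bsub>i+1\<^esub>|\<dots>|a\<^sub>n] + (-1)\<^sup>n \<epsilon>(a\<^sub>n) [a\<^sub>0|\<dots>|a\<^bsub>n-1\<^esub>]\<close>.
  As \<open>A\<close> is a Hopf superalgebra with \<open>s, t\<close> primitive, \<open>V \<otimes> B\<^sub>*\<close> with the diagonal action
    \<open>s(v \<otimes> b) = sv \<otimes> b + v \<otimes> sb\<close>,  \<open>t(v \<otimes> b) = tv \<otimes> b + (-1)\<^sup>|\<^sup>v\<^sup>| v \<otimes> tb\<close>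
  is a projective resolution of \<open>V\<close>, so that \<open>Ext\<^sub>A\<^sup>n(V,W)\<close> is the \<open>n\<close>-th cohomology of
  \<open>Hom\<^sub>A(V \<otimes> B\<^sub>*, W)\<close>.

  An element of \<open>\<Oplus>\<^sub>n Hom\<^sub>A(V \<otimes> B\<^sub>n, W)\<close> is a function \<open>f\<close> with
  \<open>f [a\<^sub>0,\<dots>,a\<^sub>n] v\<close> the value at \<open>v \<otimes> [a\<^sub>0|\<dots>|a\<^sub>n]\<close>; degree \<open>n\<close> corresponds to lists of length \<open>n + 1\<close>.
  We only need the part \<open>\<Oplus>\<^sub>n Hom\<^sub>A(V \<otimes> B\<^sub>n, W)\<^bsub>n+q\<^esub>\<close> in which the parity of the degree \<open>n\<close>
  component is \<open>n + q\<close>; homomorphisms \<open>\<phi>\<close> satisfy \<open>\<phi>(tx) = (-1)\<^sup>|\<^sup>\<phi>\<^sup>| t\<phi>(x)\<close>. The function is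
  required to be zero off the carrier of \<open>V\<close> to make it unique.
\<close>

definition bar_cochain ::
  "'k::field st set \<Rightarrow> ('k, 'v::ab_group_add) supermodule \<Rightarrow> ('k, 'w::ab_group_add) supermodule
     \<Rightarrow> bit \<Rightarrow> ('k st list \<Rightarrow> 'v \<Rightarrow> 'w) \<Rightarrow> bool" where
  "bar_cochain I V W q f \<longleftrightarrow>
     f [] = 0 \<and>
     (\<exists>N. \<forall>as. length as > N \<longrightarrow> f as = 0) \<and>
     (\<forall>as v. v \<notin> smod_carrier V \<longrightarrow> f as v = 0) \<and>
     \<comment> \<open>multilinearity\<close>
     (\<forall>as. \<forall>v\<in>smod_carrier V. \<forall>w\<in>smod_carrier V. f as (v + w) = f as v + f as w) \<and>
     (\<forall>as c. \<forall>v\<in>smod_carrier V. f as (scl V c v) = scl W c (f as v)) \<and>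
     (\<forall>as bs a b. f (as @ (a + b) # bs) = f (as @ a # bs) + f (as @ b # bs)) \<and>
     (\<forall>as bs a c. \<forall>v\<in>smod_carrier V. f (as @ [:[:c:]:] * a # bs) v = scl W c (f (as @ a # bs) v)) \<and>
     (\<forall>as bs. \<forall>a\<in>I. f (as @ a # bs) = 0) \<and>
     \<comment> \<open>parity\<close>
     (\<forall>as is j. \<forall>v\<in>part V j. as \<noteq> [] \<longrightarrow> list_all2 (\<lambda>a i. a \<in> st_part i) as is \<longrightarrow>
        f as v \<in> part W (of_nat (length as - 1) + q + sum_list is + j)) \<and>
     \<comment> \<open>\<open>A\<close>-linearity\<close>
     (\<forall>a as. \<forall>v\<in>smod_carrier V.
        f (a # as) (s_act V v) + f (s_gen * a # as) v = s_act W (f (a # as) v)) \<and>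
     (\<forall>a as j. \<forall>v\<in>part V j.
        f (a # as) (t_act V v) + koszul j (f (t_gen * a # as) v) =
        koszul (of_nat (length as) + q) (t_act W (f (a # as) v)))"

definition merge_at :: "nat \<Rightarrow> 'k::field st list \<Rightarrow> 'k st list"
  where "merge_at i as = take i as @ (as ! i * as ! Suc i) # drop (i + 2) as"

definition bar_diff ::
  "('k::field, 'w::ab_group_add) supermodule \<Rightarrow> ('k st list \<Rightarrow> 'v \<Rightarrow> 'w) \<Rightarrow> 'k st list \<Rightarrow> 'v \<Rightarrow> 'w" where
  "bar_diff W f as v =
     (if length as \<le> 1 then 0
      else (\<Sum>i<length as - 1. koszul (of_nat i) (f (merge_at i as) v)) +
           koszul (of_nat (length as - 1)) (scl W (counit (last as)) (f (butlast as) v)))"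


section \<open>The cohomology ring\<close>

definition cocycles :: "'k::field st set \<Rightarrow> ('k st list \<Rightarrow> 'k \<Rightarrow> 'k) set" where
  "cocycles I = {f. bar_cochain I trivial_smod trivial_smod 0 f \<and> bar_diff trivial_smod f = 0}"

definition coboundaries :: "'k::field st set \<Rightarrow> ('k st list \<Rightarrow> 'k \<Rightarrow> 'k) set" where
  "coboundaries I = bar_diff trivial_smod ` {g. bar_cochain I trivial_smod trivial_smod 1 g}"

text \<open>
  The product of \<open>f\<close> of degree \<open>m\<close> and \<open>g\<close> of degree \<open>n\<close> is the composite of \<open>f\<close> with the lift
  \<open>[a\<^sub>0|\<dots>|a\<^sub>m|b\<^sub>1|\<dots>|b\<^sub>n] \<mapsto> [a\<^sub>0|\<dots>|a\<^sub>m] g([1|b\<^sub>1|\<dots>|b\<^sub>n])\<close> of \<open>g\<close>. There is no sign because parities and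
  cohomological degrees agree mod 2 here, so that the two Koszul signs \<open>(-1)\<^bsup>mn\<^esup>\<close> cancel.
\<close>

definition cup ::
  "('k::field st list \<Rightarrow> 'k \<Rightarrow> 'k) \<Rightarrow> ('k st list \<Rightarrow> 'k \<Rightarrow> 'k) \<Rightarrow> 'k st list \<Rightarrow> 'k \<Rightarrow> 'k" where
  "cup f g as v = (\<Sum>i<length as. f (take (Suc i) as) (g (1 # drop (Suc i) as) v))"

definition scalar_cochain :: "'k::field \<Rightarrow> 'k st list \<Rightarrow> 'k \<Rightarrow> 'k" where
  "scalar_cochain c as v = (if length as = 1 then c * counit (hd as) * v else 0)"

definition cocycle_ring :: "'k::field st set \<Rightarrow> ('k st list \<Rightarrow> 'k \<Rightarrow> 'k) ring" where
  "cocycle_ring I =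
     \<lparr>carrier = cocycles I, mult = cup, one = scalar_cochain 1, zero = 0, add = (+)\<rparr>"

text \<open>\<open>H(A,k) = \<Oplus>\<^sub>n Ext\<^sub>A\<^sup>n(k,k)\<^bsub>n\<^esub>\<close>, the lower index being taken mod 2.\<close>

definition coh_ring :: "'k::field st set \<Rightarrow> ('k st list \<Rightarrow> 'k \<Rightarrow> 'k) set ring"
  where "coh_ring I = cocycle_ring I Quot coboundaries I"

definition coh_class :: "'k::field st set \<Rightarrow> ('k st list \<Rightarrow> 'k \<Rightarrow> 'k) \<Rightarrow> ('k st list \<Rightarrow> 'k \<Rightarrow> 'k) set"
  where "coh_class I f = coboundaries I +>\<^bsub>cocycle_ring I\<^esub> f"

definition coh_degree :: "'k::field st set \<Rightarrow> nat \<Rightarrow> ('k st list \<Rightarrow> 'k \<Rightarrow> 'k) set set"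
  where "coh_degree I n =
    {coh_class I f | f. f \<in> cocycles I \<and> (\<forall>as. length as \<noteq> Suc n \<longrightarrow> f as = 0)}"

text \<open>
  Inflation \<open>H(S/I,k) \<rightarrow> H(S/J,k)\<close> along \<open>S/J \<rightarrow> S/I\<close>, for \<open>J \<subseteq> I\<close>: a coset of \<open>coboundaries I\<close> is
  enlarged to the coset of \<open>coboundaries J\<close> containing it.
\<close>

definition inflate ::
  "'k::field st set \<Rightarrow> ('k st list \<Rightarrow> 'k \<Rightarrow> 'k) set \<Rightarrow> ('k st list \<Rightarrow> 'k \<Rightarrow> 'k) set"
  where "inflate J X = coboundaries J <+>\<^bsub>cocycle_ring J\<^esub> X"


section \<open>Coordinates on the spectrum\<close>

definition y_cochain :: "'k::field st list \<Rightarrow> 'k \<Rightarrow> 'k" where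
  "y_cochain as v = (if length as = 2 then counit (as ! 0) * coeff (coeff (as ! 1) 1) 0 * v else 0)"

definition y_class :: "nat \<Rightarrow> ('k::field st list \<Rightarrow> 'k \<Rightarrow> 'k) set"
  where "y_class p = coh_class (M11_ideal p) y_cochain"

definition x1_class :: "nat \<Rightarrow> ('k::field st list \<Rightarrow> 'k \<Rightarrow> 'k) set" where
  "x1_class p = (THE X.
     X \<in> inflate (M11_ideal p) ` coh_degree (Ga1_ideal p) 2 \<and>
     inflate (P1_ideal p) X =
       inflate (P1_ideal p) (y_class p) \<otimes>\<^bsub>coh_ring (P1_ideal p)\<^esub> inflate (P1_ideal p) (y_class p))"

definition scalar_ring :: "'k::field ring"
  where "scalar_ring = \<lparr>carrier = UNIV, mult = (*), one = 1, zero = 0, add = (+)\<rparr>"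

definition M11_coh :: "nat \<Rightarrow> ('k::field st list \<Rightarrow> 'k \<Rightarrow> 'k) set ring"
  where "M11_coh p = coh_ring (M11_ideal p)"

definition M11_characters :: "nat \<Rightarrow> (('k::field st list \<Rightarrow> 'k \<Rightarrow> 'k) set \<Rightarrow> 'k) set"
  \<comment> \<open>the \<open>k\<close>-algebra homomorphisms from the cohomology ring to \<open>k\<close>\<close>
  where "M11_characters p =
    {\<chi> \<in> ring_hom (M11_coh p) scalar_ring. \<forall>c. \<chi> (coh_class (M11_ideal p) (scalar_cochain c)) = c}"

definition M11_spectrum :: "nat \<Rightarrow> ('k::field st list \<Rightarrow> 'k \<Rightarrow> 'k) set set set"
  where "M11_spectrum p = {\<mm>. maximalideal \<mm> (M11_coh p)}"

definition M11_point :: "nat \<Rightarrow> 'k::field \<times> 'k \<Rightarrow> ('k st list \<Rightarrow> 'k \<Rightarrow> 'k) set set" where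
  "M11_point p = (\<lambda>(\<mu>, a). THE \<mm>. \<exists>\<chi>\<in>M11_characters p.
     \<chi> (y_class p) = \<mu> \<and> \<chi> (x1_class p) = a \<and> \<mm> = a_kernel (M11_coh p) scalar_ring \<chi>)"

definition affine_line :: "nat \<Rightarrow> 'k::field \<times> 'k \<Rightarrow> ('k st list \<Rightarrow> 'k \<Rightarrow> 'k) set set set"
  where "affine_line p = (\<lambda>(\<mu>, a). {M11_point p (c * \<mu>, c\<^sup>2 * a) | c. True})"


section \<open>Support varieties\<close>

text \<open>
  The class of \<open>f\<close> lies in the kernel of \<open>z \<mapsto> 1\<^sub>M \<union> z\<close> if the cocycle
  \<open>1\<^sub>M \<otimes> f : m \<otimes> b \<mapsto> (-1)\<^bsup>|f||m|\<^esup> f(b) m\<close> on \<open>M \<otimes> B\<^sub>*\<close> is a coboundary. The degree \<open>n\<close> component of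
  \<open>f\<close> has parity \<open>n\<close>.
\<close>

definition support_ideal ::
  "nat \<Rightarrow> ('k::field, 'v::ab_group_add) supermodule \<Rightarrow> ('k st list \<Rightarrow> 'k \<Rightarrow> 'k) set set" where
  "support_ideal p M =
     {coh_class (M11_ideal p) f | f. f \<in> cocycles (M11_ideal p) \<and>
        (\<exists>g. bar_cochain (M11_ideal p) M M 1 g \<and>
           (\<forall>j. \<forall>m\<in>part M j. \<forall>as.
              bar_diff M g as m = koszul (of_nat (length as - 1) * j) (scl M (f as 1) m)))}"

definition support_variety ::
  "nat \<Rightarrow> ('k::field, 'v::ab_group_add) supermodule \<Rightarrow> ('k st list \<Rightarrow> 'k \<Rightarrow> 'k) set set set"
  where "support_variety p M = {\<mm> \<in> M11_spectrum p. support_ideal p M \<subseteq> \<mm>}"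


section \<open>The supermodules \<open>L\<^bsub>(\<mu>,a)\<^esub>\<close>\<close>

text \<open>Vectors are coordinate functions; \<open>v 0 n\<close> and \<open>v 1 n\<close> are the coordinates at \<open>x\<^sub>n\<close> and \<open>y\<^sub>n\<close>.\<close>

type_synonym 'k lvec = "bit \<Rightarrow> nat \<Rightarrow> 'k"

definition lscale :: "'k::field \<Rightarrow> 'k lvec \<Rightarrow> 'k lvec"
  where "lscale c v = (\<lambda>i n. c * v i n)"

definition xvec :: "nat \<Rightarrow> nat \<Rightarrow> 'k::field lvec"
  where "xvec p n = (\<lambda>i m. if i = 0 \<and> m = n \<and> n < p then 1 else 0)"

definition yvec :: "nat \<Rightarrow> nat \<Rightarrow> 'k::field lvec"
  where "yvec p n = (\<lambda>i m. if i = 1 \<and> m = n \<and> n < p then 1 else 0)"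

definition L_s :: "nat \<Rightarrow> 'k::field \<Rightarrow> 'k lvec \<Rightarrow> 'k lvec" where
  "L_s p \<mu> v =
     (\<Sum>n<p. lscale (v 0 n) (if n = 0 then lscale (- (\<mu>\<^sup>2)) (xvec p 1) else xvec p (n + 1))) +
     (\<Sum>n<p. lscale (v 1 n) (yvec p (n + 1)))"

definition L_t :: "nat \<Rightarrow> 'k::field \<Rightarrow> 'k lvec \<Rightarrow> 'k lvec" where
  "L_t p a v =
     (\<Sum>n<p. lscale (v 0 n) (if n = 0 then lscale a (yvec p (p - 1)) else 0)) +
     (\<Sum>n<p. lscale (v 1 n) (xvec p (n + 1)))"

definition L_smod :: "nat \<Rightarrow> 'k::field \<times> 'k \<Rightarrow> ('k, 'k lvec) supermodule" where
  "L_smod p = (\<lambda>(\<mu>, a).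
     \<lparr>scl = lscale,
      part = (\<lambda>i. {v. \<forall>j n. v j n \<noteq> 0 \<longrightarrow> j = i \<and> n < p}),
      s_act = L_s p \<mu>,
      t_act = L_t p a\<rparr>)"

lemma sum_shift:
  "(\<Sum>n<p. if m = Suc n \<and> Suc n < p then g n else 0) =
     (if m = 0 \<or> m \<ge> p then 0 else g (m - 1))" for g :: "nat \<Rightarrow> 'a::comm_monoid_add"
proof (cases "m = 0 \<or> m \<ge> p")
  case True then show ?thesis by (auto intro!: sum.neutral)
next
  case False
  have "(\<Sum>n<p. if m = Suc n \<and> Suc n < p then g n else 0) = (\<Sum>n<p. if n = m - 1 then g n else 0)"
    using False by (intro sum.cong) auto
  then show ?thesis using False by (auto simp: sum.delta)
qed

lemma sum_lvec: "(\<Sum>n<(N::nat). f n) i m = (\<Sum>n<N. (f n :: 'k::field lvec) i m)"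
  by (induction N) auto

lemma L_s_eq: assumes "p \<ge> 2" shows "L_s p \<mu> v i m =
  (if i = 0 then (if m = 0 \<or> m \<ge> p then 0 else if m = 1 then - (\<mu>\<^sup>2) * v 0 0 else v 0 (m - 1))
   else (if m = 0 \<or> m \<ge> p then 0 else v 1 (m - 1)))"
proof -
  note * = sum_shift
  have a: "(\<Sum>n<p. lscale (v 0 n) (if n = 0 then lscale (- (\<mu>\<^sup>2)) (xvec p 1) else xvec p (n + 1)) i m)
     = (\<Sum>n<p. if m = Suc n \<and> Suc n < p then (if i = 0 then (if n = 0 then - (\<mu>\<^sup>2) * v 0 0 else v 0 n) else 0) else 0)"
    by (intro sum.cong) (auto simp: lscale_def xvec_def)
  have b: "(\<Sum>n<p. lscale (v 1 n) (yvec p (n + 1)) i m)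
     = (\<Sum>n<p. if m = Suc n \<and> Suc n < p then (if i = 1 then v 1 n else 0) else 0)"
    by (intro sum.cong) (auto simp: lscale_def yvec_def)
  show ?thesis
    unfolding L_s_def plus_fun_apply sum_lvec a b * by (cases i) auto
qed

lemma L_t_eq: assumes "p \<ge> 2" shows "L_t p c v i m =
  (if i = 0 then (if m = 0 \<or> m \<ge> p then 0 else v 1 (m - 1))
   else (if m = p - 1 then c * v 0 0 else 0))"
proof -
  note * = sum_shift
  have a: "(\<Sum>n<p. lscale (v 1 n) (xvec p (n + 1)) i m)
     = (\<Sum>n<p. if m = Suc n \<and> Suc n < p then (if i = 0 then v 1 n else 0) else 0)"
    by (intro sum.cong) (auto simp: lscale_def xvec_def)
  have b: "(\<Sum>n<p. lscale (v 0 n) (if n = 0 then lscale c (yvec p (p - 1)) else 0) i m)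
     = (\<Sum>n<p. if n = 0 then (if i = 1 \<and> m = p - 1 then c * v 0 0 else 0) else 0)"
    using assms by (intro sum.cong) (auto simp: lscale_def yvec_def)
  show ?thesis
    unfolding L_t_def plus_fun_apply sum_lvec a b * using assms by (cases i) auto
qed

lemma L_s_pow: assumes "p \<ge> 2" "0 < n" shows "(L_s p \<mu> ^^ n) v i m =
  (if m < n \<or> m \<ge> p then 0 else if i = 0 \<and> m = n then - (\<mu>\<^sup>2) * v 0 0 else v i (m - n))"
  using assms(2)
proof (induction n arbitrary: m)
  case 0 then show ?case by simp
next
  case (Suc n)
  show ?case
  proof (cases "n = 0")
    case True then show ?thesis using assms(1) by (cases i) (auto simp: L_s_eq)
  next
    case False
    then show ?thesis using assms(1) Suc.IH
      by (cases i) (auto simp: L_s_eq Suc_diff_le)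
  qed
qed

lemma vector_space_lscale: "vector_space (lscale :: 'k::field \<Rightarrow> _)"
  by unfold_locales (auto simp: lscale_def fun_eq_iff algebra_simps)

lemma L_smod_supermodule: assumes "p \<ge> 2" shows "M11_supermodule p (L_smod p (\<mu>, c :: 'k::field))"
proof -
  interpret vector_space "lscale :: 'k \<Rightarrow> _" by (rule vector_space_lscale)
  have sel: "scl (L_smod p (\<mu>,c)) = lscale" "s_act (L_smod p (\<mu>,c)) = L_s p \<mu>" "t_act (L_smod p (\<mu>,c)) = L_t p c"
    "part (L_smod p (\<mu>,c)) i = {v. \<forall>j n. v j n \<noteq> 0 \<longrightarrow> j = i \<and> n < p}" for i
    by (auto simp: L_smod_def)
  have sub: "subspace (part (L_smod p (\<mu>,c)) i)" for i
    unfolding subspace_def sel by (auto simp: lscale_def) (metis add.right_neutral)+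
  have 1: "part (L_smod p (\<mu>,c)) 0 \<inter> part (L_smod p (\<mu>,c)) 1 = {0}"
    unfolding sel by (auto simp: fun_eq_iff) (metis zero_neq_one)
  have 2: "L_s p \<mu> v \<in> part (L_smod p (\<mu>,c)) i \<and> L_t p c v \<in> part (L_smod p (\<mu>,c)) (i+1)" if "v \<in> part (L_smod p (\<mu>,c)) i" for v i
    using that assms unfolding sel by (cases i) (auto simp: L_s_eq L_t_eq split: if_splits)
  have 3: "L_s p \<mu> (v + w) = L_s p \<mu> v + L_s p \<mu> w \<and> L_t p c (v + w) = L_t p c v + L_t p c w" for v w
    using assms by (auto simp: fun_eq_iff L_s_eq L_t_eq algebra_simps)
  have 4: "L_s p \<mu> (lscale d v) = lscale d (L_s p \<mu> v) \<and> L_t p c (lscale d v) = lscale d (L_t p c v)" for v d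
    using assms by (auto simp: fun_eq_iff L_s_eq L_t_eq algebra_simps lscale_def)
  have 5: "L_s p \<mu> (L_t p c v) = L_t p c (L_s p \<mu> v)" for v
    using assms by (auto simp: fun_eq_iff L_s_eq L_t_eq)
  have 6: "(L_s p \<mu> ^^ p) v = 0" for v
    using assms by (auto simp: fun_eq_iff L_s_pow)
  have 7: "L_t p c (L_t p c v) = 0" for v
    using assms by (auto simp: fun_eq_iff L_t_eq)
  show ?thesis unfolding M11_supermodule_def
    using vector_space_lscale sub 1 2 3 4 5 6 7 by (simp add: sel(1-3))
qed

end

theory Submission
  imports Defs
begin

text \<open>
  The algebra \<open>H = H(M\<^bsub>1;1\<^esub>,k)\<close> is the polynomial ring in \<open>y\<close> and \<open>x\<^sub>1\<close>. Evaluating cocycles on the shuffles of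
  \<open>[s\<^bsup>p-1\<^esup>|s|\<dots>|s\<^bsup>p-1\<^esup>|s]\<close> with \<open>[t|\<dots>|t]\<close> and weighting by powers of \<open>a\<close> and \<open>\<mu>\<close> gives the character of
  \<open>H\<close> at \<open>(\<mu>,a)\<close>. Conversely, dividing the first argument of a cocycle by \<open>s\<close> yields a homotopy that
  rewrites every class as a combination of \<open>y\<close>- and \<open>x\<^sub>1\<close>-multiples, so characters are determined by their values
  at \<open>y\<close> and \<open>x\<^sub>1\<close>.

  For \<open>M = L\<^bsub>(\<mu>,\<alpha>)\<^esub>\<close> an explicit cochain with values in the endomorphisms of \<open>M\<close> shows that
  \<open>\<alpha>y\<^sup>2 - \<mu>\<^sup>2x\<^sub>1\<close> annihilates the identity of \<open>M\<close>. Modulo a maximal ideal containing this element, \<open>H\<close> is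
  generated by one element, so that by algebraic closedness the ideal is a point of the line. In the
  other direction, if \<open>1\<^sub>M \<union> z\<close> is a coboundary, then its \<open>x\<^sub>0\<close>-coordinate forces every homogeneous
  component of \<open>z\<close> to vanish at \<open>(\<mu>,\<alpha>)\<close>, and hence on the whole line.
\<close>

section \<open>Cochains\<close>

text \<open>Nothing about the cohomology can be taken as known: \<open>x1_class\<close> and
  \<open>M11_point\<close> are definite descriptions, and resolving them requires deciding which
  cocycles are coboundaries. Explicit representatives are y(a), the coefficient of t in a, and the
  carry x_1(a,b), the sum of a_k b_(p-k) over 0 < k < p for the coefficients of s^k. They commute
  only up to the coboundary of \<open>xy_red\<close>. The obstacle to generation is a term F(s,
  s^(p-1) t, ...) left over when s is split off the first argument: it prevents the coefficient of
  x_1 from being a cocycle. Removing it needs a criterion for being a coboundary, which is therefore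
  proved together with the decomposition. The class \<lambda>_1 has degree 1 and even parity, so its
  multiples by monomials in y and x_1 lie outside H; accordingly only shuffles with an even number
  of powers of s count. On the side of L, the vector x_0 is the test vector because it is outside
  the images of s and t, and the weights -\<mu>^2 and \<alpha> of L are the values of the top
  products s^(p-1) Y and t X in the endomorphisms of L, which become the coefficients of x_1 and
  y^2.\<close>

text \<open>For trivial coefficients a bar cochain is determined by its values at \<open>[1|a\<^sub>1|\<dots>|a\<^sub>n]\<close>; up to the section on
  the supermodule \<open>L\<close>, cochains are functions of \<open>[a\<^sub>1,\<dots>,a\<^sub>n]\<close>. The operator \<open>tdiff\<close> is the part of the
  differential that does not involve the action on the coefficients, so that minus \<open>tdiff\<close> is also the
  differential of functions of \<open>[a\<^sub>0,\<dots>,a\<^sub>n]\<close>.\<close>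

definition lin_on :: "'k::field st set \<Rightarrow> ('k st \<Rightarrow> 'k) \<Rightarrow> bool" where
  "lin_on I \<phi> \<longleftrightarrow>
     (\<forall>a b. \<phi> (a + b) = \<phi> a + \<phi> b) \<and> (\<forall>c a. \<phi> (smult [:c:] a) = c * \<phi> a) \<and> (\<forall>a\<in>I. \<phi> a = 0)"

definition multilin :: "'k::field st set \<Rightarrow> ('k st list \<Rightarrow> 'k) \<Rightarrow> bool" where
  "multilin I F \<longleftrightarrow> (\<forall>as bs. lin_on I (\<lambda>a. F (as @ a # bs)))"

definition aug_ideal :: "'k::field st set \<Rightarrow> bool" where
  "aug_ideal I \<longleftrightarrow> (\<forall>a\<in>I. \<forall>b. a * b \<in> I) \<and> (\<forall>a\<in>I. counit a = 0)"

text \<open>At the end of the list the next factor is the trivial module, on which a acts through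
  its augmentation. With this convention the last face of the differential needs no clause of its
  own in \<open>tdiff\<close>.\<close>

fun absorb :: "'k::field st \<Rightarrow> ('k st list \<Rightarrow> 'k) \<Rightarrow> 'k st list \<Rightarrow> 'k" where
  "absorb a F [] = counit a * F []"
| "absorb a F (b # bs) = F (a * b # bs)"

fun tdiff :: "('k::field st list \<Rightarrow> 'k) \<Rightarrow> 'k st list \<Rightarrow> 'k" where
  "tdiff F [] = 0"
| "tdiff F (a # as) = - absorb a F as - tdiff (\<lambda>bs. F (a # bs)) as"

fun head_counit :: "('k::field st list \<Rightarrow> 'k) \<Rightarrow> 'k st list \<Rightarrow> 'k" where
  "head_counit F [] = 0"
| "head_counit F (a # as) = counit a * F as"

definition cdiff :: "('k::field st list \<Rightarrow> 'k) \<Rightarrow> 'k st list \<Rightarrow> 'k" where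
  "cdiff F as = head_counit F as + tdiff F as"

fun ccup :: "('k::field st list \<Rightarrow> 'k) \<Rightarrow> ('k st list \<Rightarrow> 'k) \<Rightarrow> 'k st list \<Rightarrow> 'k" where
  "ccup F G [] = F [] * G []"
| "ccup F G (a # as) = F [] * G (a # as) + ccup (\<lambda>bs. F (a # bs)) G as"

definition alt_sign :: "('k::field st list \<Rightarrow> 'k) \<Rightarrow> 'k st list \<Rightarrow> 'k" where
  "alt_sign F as = (- 1) ^ length as * F as"

lemma counit_add [simp]: "counit (a + b) = counit a + counit b"
  by (simp add: counit_def)

lemma counit_0 [simp]: "counit 0 = 0" and counit_1 [simp]: "counit 1 = 1"
  by (simp_all add: counit_def)

lemma counit_mult [simp]: "counit (a * b) = counit a * counit b"
  by (simp add: counit_def coeff_mult_0)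

lemma counit_smult [simp]: "counit (smult [:c:] a) = c * counit a"
  by (simp add: counit_def)

lemma counit_s_gen [simp]: "counit s_gen = 0" and counit_t_gen [simp]: "counit t_gen = 0"
  by (simp_all add: counit_def s_gen_def t_gen_def)

lemma counit_power [simp]: "counit (a ^ n) = counit a ^ n"
  by (induction n) auto

lemma lin_onI [intro?]:
  assumes "\<And>a b. \<phi> (a + b) = \<phi> a + \<phi> b" "\<And>c a. \<phi> (smult [:c:] a) = c * \<phi> a" "\<And>a. a \<in> I \<Longrightarrow> \<phi> a = 0"
  shows "lin_on I \<phi>"
  using assms by (auto simp: lin_on_def)

lemma lin_on_zero [simp]: "lin_on I (\<lambda>_. 0)"
  by (simp add: lin_on_def)

lemma lin_on_add: "lin_on I f \<Longrightarrow> lin_on I g \<Longrightarrow> lin_on I (\<lambda>a. f a + g a)"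
  by (simp add: lin_on_def algebra_simps)

lemma lin_on_diff: "lin_on I f \<Longrightarrow> lin_on I g \<Longrightarrow> lin_on I (\<lambda>a. f a - g a)"
  by (simp add: lin_on_def algebra_simps)

lemma lin_on_neg: "lin_on I f \<Longrightarrow> lin_on I (\<lambda>a. - f a)"
  by (simp add: lin_on_def)

lemma lin_on_scale: "lin_on I f \<Longrightarrow> lin_on I (\<lambda>a. c * f a)"
  by (simp add: lin_on_def algebra_simps)

lemma lin_on_scale_right: "lin_on I f \<Longrightarrow> lin_on I (\<lambda>a. f a * c)"
  by (simp add: lin_on_def algebra_simps)

lemma lin_on_counit: "aug_ideal I \<Longrightarrow> lin_on I counit"
  by (auto simp: lin_on_def aug_ideal_def)

lemma lin_on_mult_right: "aug_ideal I \<Longrightarrow> lin_on I f \<Longrightarrow> lin_on I (\<lambda>a. f (a * b))"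
  by (auto simp: lin_on_def aug_ideal_def distrib_right)

lemma lin_on_mult_left: "aug_ideal I \<Longrightarrow> lin_on I f \<Longrightarrow> lin_on I (\<lambda>a. f (b * a))"
  by (subst mult.commute) (rule lin_on_mult_right)

lemma lin_on_mono: "J \<subseteq> I \<Longrightarrow> lin_on I f \<Longrightarrow> lin_on J f"
  by (auto simp: lin_on_def)

lemmas lin_on_intros = lin_on_zero lin_on_add lin_on_diff lin_on_neg lin_on_scale lin_on_scale_right
  lin_on_counit

lemma lin_on_0: "lin_on I f \<Longrightarrow> f 0 = 0"
  unfolding lin_on_def by (metis add_cancel_right_right add_0)

lemma lin_on_minus: "lin_on I f \<Longrightarrow> f (a - b) = f a - f b"
  unfolding lin_on_def by (metis add_diff_cancel diff_add_cancel)

lemma multilinD: "multilin I F \<Longrightarrow> lin_on I (\<lambda>a. F (as @ a # bs))"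
  by (simp add: multilin_def)

lemma multilin_head: "multilin I F \<Longrightarrow> lin_on I (\<lambda>a. F (a # bs))"
  using multilinD[of I F "[]"] by simp

lemma multilin_second: "multilin I F \<Longrightarrow> lin_on I (\<lambda>a. F (x # a # bs))"
  using multilinD[of I F "[x]"] by simp

lemma multilin_prepend: "multilin I F \<Longrightarrow> multilin I (\<lambda>bs. F (a # bs))"
  using multilinD[of I F "a # _"] by (simp add: multilin_def)

lemma multilin_mono: "J \<subseteq> I \<Longrightarrow> multilin I F \<Longrightarrow> multilin J F"
  by (auto simp: multilin_def intro: lin_on_mono)

lemma multilin_zero [simp]: "multilin I (\<lambda>_. 0)" "multilin I 0"
  by (simp_all add: multilin_def)

lemma multilin_add: "multilin I F \<Longrightarrow> multilin I G \<Longrightarrow> multilin I (\<lambda>as. F as + G as)"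
  by (simp add: multilin_def lin_on_add)

lemma multilin_diff: "multilin I F \<Longrightarrow> multilin I G \<Longrightarrow> multilin I (\<lambda>as. F as - G as)"
  by (simp add: multilin_def lin_on_diff)

lemma multilin_scale: "multilin I F \<Longrightarrow> multilin I (\<lambda>as. c * F as)"
  by (simp add: multilin_def lin_on_scale)

lemma multilin_neg: "multilin I F \<Longrightarrow> multilin I (\<lambda>as. - F as)"
  by (simp add: multilin_def lin_on_neg)

lemma multilin_consI:
  assumes "\<And>bs. lin_on I (\<lambda>a. F (a # bs))" "\<And>a. multilin I (\<lambda>bs. F (a # bs))"
  shows "multilin I F"
  unfolding multilin_def
proof safe
  fix as bs show "lin_on I (\<lambda>a. F (as @ a # bs))"
    using assms by (cases as) (auto simp: multilin_def)
qed

lemma absorb_add: "absorb a (\<lambda>bs. F bs + G bs) as = absorb a F as + absorb a G as"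
  by (cases as) (auto simp: algebra_simps)

lemma absorb_scale: "absorb a (\<lambda>bs. c * F bs) as = c * absorb a F as"
  by (cases as) (auto simp: algebra_simps)

lemma tdiff_add: "tdiff (\<lambda>bs. F bs + G bs) as = tdiff F as + tdiff G as"
  by (induction as arbitrary: F G) (auto simp: absorb_add)

lemma tdiff_scale: "tdiff (\<lambda>bs. c * F bs) as = c * tdiff F as"
  by (induction as arbitrary: F) (auto simp: absorb_scale algebra_simps)

lemma tdiff_neg: "tdiff (\<lambda>bs. - F bs) as = - tdiff F as"
  using tdiff_scale[of "-1" F as] by simp

lemma tdiff_diff: "tdiff (\<lambda>bs. F bs - G bs) as = tdiff F as - tdiff G as"
  using tdiff_add[of F "\<lambda>bs. - G bs" as] by (simp add: tdiff_neg)

lemma tdiff_zero [simp]: "tdiff (\<lambda>bs. 0) as = 0"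
  using tdiff_scale[of 0 "\<lambda>_. 0" as] by simp

lemma head_counit_add: "head_counit (\<lambda>bs. F bs + G bs) as = head_counit F as + head_counit G as"
  by (cases as) (auto simp: algebra_simps)

lemma head_counit_scale: "head_counit (\<lambda>bs. c * F bs) as = c * head_counit F as"
  by (cases as) (auto simp: algebra_simps)

lemma cdiff_add: "cdiff (\<lambda>bs. F bs + G bs) as = cdiff F as + cdiff G as"
  by (simp add: cdiff_def tdiff_add head_counit_add)

lemma cdiff_scale: "cdiff (\<lambda>bs. c * F bs) as = c * cdiff F as"
  by (simp add: cdiff_def tdiff_scale head_counit_scale algebra_simps)

lemma cdiff_neg: "cdiff (\<lambda>bs. - F bs) as = - cdiff F as"
  using cdiff_scale[of "-1" F as] by simp

lemma cdiff_diff: "cdiff (\<lambda>bs. F bs - G bs) as = cdiff F as - cdiff G as"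
  using cdiff_add[of F "\<lambda>bs. - G bs" as] by (simp add: cdiff_neg)

lemma cdiff_zero [simp]: "cdiff (\<lambda>bs. 0) as = 0"
  using cdiff_scale[of 0 "\<lambda>_. 0" as] by simp

lemma cdiff_Nil [simp]: "cdiff F [] = 0"
  by (simp add: cdiff_def)

lemma ccup_add_left: "ccup (\<lambda>bs. F bs + G bs) H as = ccup F H as + ccup G H as"
  by (induction as arbitrary: F G) (auto simp: algebra_simps)

lemma ccup_scale_left: "ccup (\<lambda>bs. c * F bs) H as = c * ccup F H as"
  by (induction as arbitrary: F) (auto simp: algebra_simps)

lemma ccup_neg_left: "ccup (\<lambda>bs. - F bs) H as = - ccup F H as"
  using ccup_scale_left[of "-1" F H as] by simp

lemma ccup_diff_left: "ccup (\<lambda>bs. F bs - G bs) H as = ccup F H as - ccup G H as"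
  using ccup_add_left[of F "\<lambda>bs. - G bs" H as] by (simp add: ccup_neg_left)

lemma ccup_zero_left [simp]: "ccup (\<lambda>bs. 0) H as = 0"
  using ccup_scale_left[of 0 "\<lambda>_. 0" H as] by simp

lemma ccup_add_right: "ccup F (\<lambda>bs. G bs + H bs) as = ccup F G as + ccup F H as"
  by (induction as arbitrary: F) (auto simp: algebra_simps)

lemma ccup_scale_right: "ccup F (\<lambda>bs. c * G bs) as = c * ccup F G as"
  by (induction as arbitrary: F) (auto simp: algebra_simps)

lemma ccup_neg_right: "ccup F (\<lambda>bs. - G bs) as = - ccup F G as"
  using ccup_scale_right[of F "-1" G as] by simp

lemma ccup_diff_right: "ccup F (\<lambda>bs. G bs - H bs) as = ccup F G as - ccup F H as"
  using ccup_add_right[of F G "\<lambda>bs. - H bs" as] by (simp add: ccup_neg_right)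

lemma ccup_zero_right [simp]: "ccup F (\<lambda>bs. 0) as = 0"
  using ccup_scale_right[of F 0 "\<lambda>_. 0" as] by simp

lemma ccup_assoc: "ccup (ccup F G) H as = ccup F (ccup G H) as"
proof (induction as arbitrary: F)
  case Nil then show ?case by simp
next
  case (Cons a as)
  have "ccup (\<lambda>bs. ccup F G (a # bs)) H as =
      F [] * ccup (\<lambda>bs. G (a # bs)) H as + ccup (ccup (\<lambda>bs. F (a # bs)) G) H as"
    by (simp add: ccup_add_left ccup_scale_left)
  then show ?case using Cons.IH[of "\<lambda>bs. F (a # bs)"] by (simp add: algebra_simps)
qed

lemma ccup_eq_sum: "ccup F G as = (\<Sum>i\<le>length as. F (take i as) * G (drop i as))"
proof (induction as arbitrary: F)
  case (Cons a as)
  then show ?case by (simp add: sum.atMost_Suc_shift del: sum.atMost_Suc)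
qed auto

lemma absorb_mult: "absorb a (absorb b F) as = absorb (a * b) F as"
  by (cases as) (auto simp: algebra_simps)

lemma tdiff_tdiff: "tdiff (tdiff F) as = 0"
proof (induction as arbitrary: F)
  case Nil then show ?case by simp
next
  case (Cons a as)
  have "tdiff (\<lambda>bs. tdiff F (a # bs)) as = - tdiff (absorb a F) as - tdiff (tdiff (\<lambda>bs. F (a # bs))) as"
    by (simp add: tdiff_diff tdiff_neg)
  also have "\<dots> = - tdiff (absorb a F) as" using Cons.IH by simp
  finally have 1: "tdiff (\<lambda>bs. tdiff F (a # bs)) as = - tdiff (absorb a F) as" .
  \<comment> \<open>\<open>absorb a\<close> commutes with \<open>tdiff\<close> by associativity and
    commutativity of the product, so the two remaining terms cancel.\<close>
  have 2: "absorb a (tdiff F) as = tdiff (absorb a F) as"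
  proof (cases as)
    case (Cons b bs)
    have "absorb b (absorb a F) bs = absorb (a * b) F bs" by (simp add: absorb_mult mult.commute)
    then show ?thesis using Cons by simp
  qed auto
  show ?case using 1 2 by simp
qed

lemma absorb_ccup: "absorb a (ccup F G) as = F [] * absorb a G as + ccup (absorb a F) G as - counit a * F [] * G as"
  by (cases as) (auto simp: algebra_simps)

text \<open>At the seam of a product the last face of \<open>tdiff F\<close> cancels against the
  head term of \<open>cdiff G\<close>. This is why the right factor carries the full differential
  although the left one does not.\<close>

lemma tdiff_ccup: "tdiff (ccup F G) as = ccup (tdiff F) G as + ccup (alt_sign F) (cdiff G) as"
proof (induction as arbitrary: F)
  case Nil then show ?case by simp
next
  case (Cons a as)
  have s: "(\<lambda>bs. alt_sign F (a # bs)) = (\<lambda>bs. - alt_sign (\<lambda>bs. F (a # bs)) bs)"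
    by (auto simp: alt_sign_def)
  show ?case
    using Cons.IH[of "\<lambda>bs. F (a # bs)"]
    by (simp add: tdiff_add tdiff_scale absorb_ccup s ccup_neg_left ccup_diff_left cdiff_def alt_sign_def[of _ "[]"]
        algebra_simps)
qed

lemma cdiff_ccup: "cdiff (ccup F G) as = ccup (cdiff F) G as + ccup (alt_sign F) (cdiff G) as"
proof -
  have "head_counit (ccup F G) as = ccup (head_counit F) G as"
    by (cases as) (auto simp: ccup_scale_left)
  then show ?thesis
    by (simp add: cdiff_def[abs_def] tdiff_ccup[unfolded cdiff_def[abs_def]] ccup_add_left)
qed

lemma head_counit_cong: "tdiff (head_counit F) (a # as) = - counit a * cdiff F as"
proof (cases as)
  case (Cons b bs)
  then show ?thesis by (simp add: cdiff_def tdiff_scale algebra_simps)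
qed simp

text \<open>Filling an extra leading slot with the augmentation turns the coefficient-free
  differential into the full one. This compares functions of [a_0,...,a_n] with functions of
  [a_1,...,a_n].\<close>

lemma tdiff_head_counit: "tdiff (head_counit F) as = - head_counit (cdiff F) as"
  by (cases as) (simp_all add: head_counit_cong del: tdiff.simps(2))

lemma cdiff_cdiff: "cdiff (cdiff F) as = 0"
proof -
  have "tdiff (cdiff F) as = tdiff (head_counit F) as + tdiff (tdiff F) as"
    by (simp add: cdiff_def[abs_def] tdiff_add[of "head_counit F" "tdiff F"])
  then show ?thesis by (simp add: cdiff_def[of "cdiff F"] tdiff_head_counit tdiff_tdiff)
qed

section \<open>Multilinearity of differentials and products\<close>

lemma multilin_head_counit: "aug_ideal I \<Longrightarrow> multilin I F \<Longrightarrow> multilin I (head_counit F)"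
  by (rule multilin_consI) (auto intro!: lin_on_intros multilin_scale)

lemma lin_on_absorb:
  assumes "aug_ideal I" "multilin I F" shows "lin_on I (\<lambda>a. absorb a F as)"
proof (cases as)
  case Nil
  then show ?thesis using assms by (auto intro: lin_on_scale_right lin_on_counit)
next
  case (Cons b bs)
  then show ?thesis using lin_on_mult_right[OF assms(1) multilin_head[OF assms(2)]] by simp
qed

lemma multilin_absorb:
  assumes "aug_ideal I" "multilin I F" shows "multilin I (absorb a F)"
proof (rule multilin_consI)
  show "lin_on I (\<lambda>b. absorb a F (b # bs))" for bs
    using lin_on_mult_left[OF assms(1) multilin_head[OF assms(2)]] by simp
  show "multilin I (\<lambda>bs. absorb a F (b # bs))" for b
    using multilin_prepend[OF assms(2)] by simp
qed

lemma lin_on_tdiff: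
  assumes "\<And>bs. lin_on I (\<lambda>a. F a bs)" shows "lin_on I (\<lambda>a. tdiff (F a) as)"
proof -
  have [simp]: "F (a + b) = (\<lambda>bs. F a bs + F b bs)" "F (smult [:c:] a) = (\<lambda>bs. c * F a bs)" for a b c
    using assms by (auto simp: lin_on_def)
  have [simp]: "F a = (\<lambda>_. 0)" if "a \<in> I" for a
    using assms that by (auto simp: lin_on_def)
  show ?thesis by (rule lin_onI) (simp_all add: tdiff_add tdiff_scale)
qed

lemma multilin_tdiff:
  assumes "aug_ideal I" "multilin I F" shows "multilin I (tdiff F)"
  unfolding multilin_def
proof safe
  fix as bs show "lin_on I (\<lambda>a. tdiff F (as @ a # bs))"
    using assms(2)
  proof (induction as arbitrary: F)
    case Nil
    then show ?case
      using assms(1) by (auto intro!: lin_on_diff lin_on_neg lin_on_absorb lin_on_tdiff multilin_head)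
  next
    case (Cons x as)
    from Cons.IH[OF multilin_prepend[OF Cons.prems]] multilinD[OF multilin_absorb[OF assms(1) Cons.prems, of x], of as bs]
    show ?case by (auto intro!: lin_on_diff lin_on_neg)
  qed
qed

lemma multilin_cdiff: "aug_ideal I \<Longrightarrow> multilin I F \<Longrightarrow> multilin I (cdiff F)"
  by (auto simp: cdiff_def[abs_def] intro!: multilin_add multilin_head_counit multilin_tdiff)

lemma multilin_alt_sign: "multilin I F \<Longrightarrow> multilin I (alt_sign F)"
  by (simp add: multilin_def alt_sign_def lin_on_scale del: power_Suc)

lemma lin_on_ccup_left:
  assumes "\<And>bs. lin_on I (\<lambda>a. F a bs)" shows "lin_on I (\<lambda>a. ccup (F a) G as)"
proof -
  have [simp]: "F (a + b) = (\<lambda>bs. F a bs + F b bs)" "F (smult [:c:] a) = (\<lambda>bs. c * F a bs)" for a b c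
    using assms by (auto simp: lin_on_def)
  have [simp]: "F a = (\<lambda>_. 0)" if "a \<in> I" for a
    using assms that by (auto simp: lin_on_def)
  show ?thesis by (rule lin_onI) (simp_all add: ccup_add_left ccup_scale_left)
qed

lemma multilin_ccup:
  assumes "multilin I F" "multilin I G" shows "multilin I (ccup F G)"
  unfolding multilin_def
proof safe
  fix as bs show "lin_on I (\<lambda>a. ccup F G (as @ a # bs))"
    using assms(1)
  proof (induction as arbitrary: F)
    case Nil
    then show ?case
      using assms(2) by (auto intro!: lin_on_intros lin_on_ccup_left multilin_head[of I F] multilin_head[of I G])
  next
    case (Cons x as)
    from Cons.IH[OF multilin_prepend[OF Cons.prems]] multilinD[OF assms(2), of "x # as" bs]
    show ?case by (auto intro!: lin_on_intros)
  qed
qed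

section \<open>Parity, cocycles and coboundaries\<close>

declare add_bit_eq_xor [simp del] mult_bit_eq_and [simp del]

lemma bit_add_self [simp]: "x + x = (0::bit)" and bit_add_left_self [simp]: "x + (x + y) = (y::bit)"
  by (cases x; cases y; simp)+

lemma st_partD: "a \<in> st_part i \<Longrightarrow> coeff a j \<noteq> 0 \<Longrightarrow> of_nat j = i"
  by (simp add: st_part_def)

lemma st_part_mult: "a \<in> st_part i \<Longrightarrow> b \<in> st_part j \<Longrightarrow> a * b \<in> st_part (i + j)"
  unfolding st_part_def
proof safe
  fix n
  assume a: "\<forall>n. coeff a n \<noteq> 0 \<longrightarrow> of_nat n = i" and b: "\<forall>n. coeff b n \<noteq> 0 \<longrightarrow> of_nat n = j"
    and "coeff (a * b) n \<noteq> 0"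
  then obtain k where "k \<le> n" "coeff a k * coeff b (n - k) \<noteq> 0"
    unfolding coeff_mult by (meson atMost_iff sum.neutral)
  then have "of_nat k = i" "of_nat (n - k) = j" "k + (n - k) = n" using a b by auto
  then show "of_nat n = i + j" by (metis of_nat_add)
qed

lemma counit_st_part: "a \<in> st_part i \<Longrightarrow> counit a \<noteq> 0 \<Longrightarrow> i = 0"
  using st_partD[of a i 0] by (cases "coeff a 0 = 0") (auto simp: counit_def)

lemma s_gen_st_part: "s_gen \<in> st_part 0" and t_gen_st_part: "t_gen \<in> st_part 1"
  by (auto simp: st_part_def s_gen_def t_gen_def coeff_pCons split: nat.splits)

lemma one_st_part: "1 \<in> st_part 0"
  by (auto simp: st_part_def)

lemma s_gen_power_st_part: "s_gen ^ n \<in> st_part 0"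
  by (induction n) (use st_part_mult[OF s_gen_st_part] one_st_part in auto)

text \<open>The coefficients k are even, so a map of parity n + q in degree n can be nonzero only on
  arguments of total parity n + q. Cocycles have q = 0, and their primitives, one degree lower with
  the same parity, have q = 1.\<close>

definition has_parity :: "bit \<Rightarrow> ('k::field st list \<Rightarrow> 'k) \<Rightarrow> bool" where
  "has_parity q F \<longleftrightarrow> (\<forall>as is. list_all2 (\<lambda>a i. a \<in> st_part i) as is \<longrightarrow> F as \<noteq> 0 \<longrightarrow>
     of_nat (length as) + q + sum_list is = 0)"

definition bounded_deg :: "('k::field st list \<Rightarrow> 'k) \<Rightarrow> bool" where
  "bounded_deg F \<longleftrightarrow> (\<exists>N. \<forall>as. length as > N \<longrightarrow> F as = 0)"

definition cochains :: "'k::field st set \<Rightarrow> bit \<Rightarrow> ('k st list \<Rightarrow> 'k) set" where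
  "cochains I q = {F. multilin I F \<and> has_parity q F \<and> bounded_deg F}"

definition cocyc :: "'k::field st set \<Rightarrow> ('k st list \<Rightarrow> 'k) set" where
  "cocyc I = {F \<in> cochains I 0. \<forall>as. cdiff F as = 0}"

definition cobound :: "'k::field st set \<Rightarrow> ('k st list \<Rightarrow> 'k) set" where
  "cobound I = cdiff ` cochains I 1"

lemma has_parityD:
  "has_parity q F \<Longrightarrow> list_all2 (\<lambda>a i. a \<in> st_part i) as is \<Longrightarrow> F as \<noteq> 0 \<Longrightarrow> of_nat (length as) + q + sum_list is = 0"
  by (simp add: has_parity_def)

lemma has_parity_prepend: "has_parity q F \<Longrightarrow> a \<in> st_part i \<Longrightarrow> has_parity (q + 1 + i) (\<lambda>bs. F (a # bs))"
  unfolding has_parity_def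
proof safe
  fix as "is"
  assume "\<forall>as is. list_all2 (\<lambda>a i. a \<in> st_part i) as is \<longrightarrow> F as \<noteq> 0 \<longrightarrow>
     of_nat (length as) + q + sum_list is = 0" "a \<in> st_part i"
    "list_all2 (\<lambda>a i. a \<in> st_part i) as is" "F (a # as) \<noteq> 0"
  then have "of_nat (length (a # as)) + q + sum_list (i # is) = 0" by blast
  then show "of_nat (length as) + (q + 1 + i) + sum_list is = 0" by (simp add: ac_simps)
qed

lemma has_parity_add: "has_parity q F \<Longrightarrow> has_parity q G \<Longrightarrow> has_parity q (\<lambda>as. F as + G as)"
  by (force simp: has_parity_def)

lemma has_parity_scale: "has_parity q F \<Longrightarrow> has_parity q (\<lambda>as. c * F as)"
  by (auto simp: has_parity_def)

lemma has_parity_tdiff: assumes "has_parity q F" shows "has_parity (q + 1) (tdiff F)"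
  unfolding has_parity_def
proof (intro allI impI)
  fix as "is"
  assume "list_all2 (\<lambda>a i. a \<in> st_part i) as is" "tdiff F as \<noteq> 0"
  then show "of_nat (length as) + (q + 1) + sum_list is = 0"
    using assms
  proof (induction as "is" arbitrary: F q rule: list_all2_induct)
    case (Cons a as i "is")
    then have "absorb a F as \<noteq> 0 \<or> tdiff (\<lambda>bs. F (a # bs)) as \<noteq> 0" by auto
    then show ?case
    proof
      assume "tdiff (\<lambda>bs. F (a # bs)) as \<noteq> 0"
      from Cons.IH[OF this has_parity_prepend[OF Cons.prems(2) Cons.hyps(1)]] show ?thesis by (simp add: ac_simps)
    next
      assume nz: "absorb a F as \<noteq> 0"
      show ?thesis
      proof (cases as)
        case Nil
        then have "counit a \<noteq> 0" "F [] \<noteq> 0" "is = []" using nz Cons.hyps by auto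
        then have "i = 0" "q = 0"
          using counit_st_part[OF Cons.hyps(1)] has_parityD[OF Cons.prems(2), of "[]" "[]"] by auto
        then show ?thesis using Nil \<open>is = []\<close> by simp
      next
        case (Cons b bs)
        then obtain j js where j: "is = j # js" "b \<in> st_part j" "list_all2 (\<lambda>a i. a \<in> st_part i) bs js"
          using Cons.hyps(2) by (auto simp: list_all2_Cons1)
        have "list_all2 (\<lambda>a i. a \<in> st_part i) (a * b # bs) ((i + j) # js)"
          using j st_part_mult[OF Cons.hyps(1) j(2)] by simp
        moreover have "F (a * b # bs) \<noteq> 0" using nz Cons by simp
        ultimately have "of_nat (length (a * b # bs)) + q + sum_list ((i + j) # js) = 0"
          using has_parityD[OF Cons.prems(2)] by blast
        then show ?thesis using j Cons by (simp add: ac_simps)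
      qed
    qed
  qed simp
qed

lemma has_parity_head_counit: assumes "has_parity q F" shows "has_parity (q + 1) (head_counit F)"
  unfolding has_parity_def
proof (intro allI impI)
  fix as "is"
  assume *: "list_all2 (\<lambda>a i. a \<in> st_part i) as is" "head_counit F as \<noteq> 0"
  then obtain a as' i is' where e: "as = a # as'" "is = i # is'" "a \<in> st_part i"
    "list_all2 (\<lambda>a i. a \<in> st_part i) as' is'" "counit a \<noteq> 0" "F as' \<noteq> 0"
    by (cases as) (auto simp: list_all2_Cons1)
  then show "of_nat (length as) + (q + 1) + sum_list is = 0"
    using counit_st_part[OF e(3)] has_parityD[OF assms e(4)] by (simp add: ac_simps)
qed

lemma has_parity_cdiff: "has_parity q F \<Longrightarrow> has_parity (q + 1) (cdiff F)"
  unfolding cdiff_def[abs_def] by (intro has_parity_add has_parity_head_counit has_parity_tdiff)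

lemma has_parity_ccup:
  assumes "has_parity q F" "has_parity r G" shows "has_parity (q + r) (ccup F G)"
  unfolding has_parity_def
proof (intro allI impI)
  fix as "is"
  assume "list_all2 (\<lambda>a i. a \<in> st_part i) as is" "ccup F G as \<noteq> 0"
  then show "of_nat (length as) + (q + r) + sum_list is = 0"
    using assms(1)
  proof (induction as "is" arbitrary: F q rule: list_all2_induct)
    case Nil
    then show ?case
      using has_parityD[OF Nil(2), of "[]" "[]"] has_parityD[OF assms(2), of "[]" "[]"] by simp
  next
    case (Cons a as i "is")
    then have "F [] * G (a # as) + ccup (\<lambda>bs. F (a # bs)) G as \<noteq> 0" by simp
    then consider "ccup (\<lambda>bs. F (a # bs)) G as \<noteq> 0" | "F [] \<noteq> 0" "G (a # as) \<noteq> 0"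
      by (cases "F [] = 0 \<or> G (a # as) = 0") auto
    then show ?case
    proof cases
      case 1
      from Cons.IH[OF this has_parity_prepend[OF Cons.prems(2) Cons.hyps(1)]] show ?thesis by (simp add: ac_simps)
    next
      case 2
      then have "q = 0" using has_parityD[OF Cons.prems(2), of "[]" "[]"] by simp
      moreover have "of_nat (length (a # as)) + r + sum_list (i # is) = 0"
        using has_parityD[OF assms(2) _ 2(2), of "i # is"] Cons.hyps by simp
      ultimately show ?thesis by simp
    qed
  qed
qed

lemma has_parity_alt_sign: "has_parity q F \<Longrightarrow> has_parity q (alt_sign F)"
  by (auto simp: has_parity_def alt_sign_def)

lemma tdiff_bounded: "(\<And>as. length as > N \<Longrightarrow> F as = 0) \<Longrightarrow> length as > Suc N \<Longrightarrow> tdiff F as = 0"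
proof (induction as arbitrary: F N)
  case (Cons a as)
  have "absorb a F as = 0" using Cons.prems by (cases as) auto
  moreover have "tdiff (\<lambda>bs. F (a # bs)) as = 0"
  proof (cases N)
    case 0
    then have "(\<lambda>bs. F (a # bs)) = (\<lambda>_. 0)" using Cons.prems by auto
    then show ?thesis by simp
  next
    case (Suc M)
    show ?thesis by (rule Cons.IH[of M]) (use Suc Cons.prems in auto)
  qed
  ultimately show ?case by simp
qed simp

lemma bounded_deg_cdiff: assumes "bounded_deg F" shows "bounded_deg (cdiff F)"
proof -
  obtain N where N: "\<And>as. length as > N \<Longrightarrow> F as = 0" using assms by (auto simp: bounded_deg_def)
  have "cdiff F as = 0" if "length as > Suc N" for as
    using that N tdiff_bounded[of N F as] by (cases as) (auto simp: cdiff_def)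
  then show ?thesis unfolding bounded_deg_def by blast
qed

lemma bounded_deg_add: assumes "bounded_deg F" "bounded_deg G" shows "bounded_deg (\<lambda>as. F as + G as)"
proof -
  obtain N M where "\<And>as. length as > N \<Longrightarrow> F as = 0" "\<And>as. length as > M \<Longrightarrow> G as = 0"
    using assms by (auto simp: bounded_deg_def)
  then show ?thesis unfolding bounded_deg_def by (intro exI[of _ "max M N"]) auto
qed

lemma bounded_deg_scale: "bounded_deg F \<Longrightarrow> bounded_deg (\<lambda>as. c * F as)"
  unfolding bounded_deg_def by auto

lemma bounded_deg_alt_sign: "bounded_deg F \<Longrightarrow> bounded_deg (alt_sign F)"
  unfolding bounded_deg_def by (auto simp: alt_sign_def)

lemma bounded_deg_ccup: assumes "bounded_deg F" "bounded_deg G" shows "bounded_deg (ccup F G)"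
proof -
  obtain N M where "\<And>as. length as > N \<Longrightarrow> F as = 0" "\<And>as. length as > M \<Longrightarrow> G as = 0"
    using assms by (auto simp: bounded_deg_def)
  then have "F (take i as) * G (drop i as) = 0" if "length as > N + M" "i \<le> length as" for i as
    using that by (cases "i > N") auto
  then show ?thesis unfolding bounded_deg_def ccup_eq_sum by (intro exI[of _ "N + M"]) (auto intro: sum.neutral)
qed

lemma bounded_degI: "(\<And>as. length as > N \<Longrightarrow> F as = 0) \<Longrightarrow> bounded_deg F"
  by (auto simp: bounded_deg_def)

lemma cochains_add: "F \<in> cochains I q \<Longrightarrow> G \<in> cochains I q \<Longrightarrow> (\<lambda>as. F as + G as) \<in> cochains I q"
  by (simp add: cochains_def multilin_add has_parity_add bounded_deg_add)

lemma cochains_scale: "F \<in> cochains I q \<Longrightarrow> (\<lambda>as. c * F as) \<in> cochains I q"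
  by (simp add: cochains_def multilin_scale has_parity_scale bounded_deg_scale)

lemma cochains_zero [simp]: "(\<lambda>_. 0) \<in> cochains I q"
  by (simp add: cochains_def bounded_deg_def has_parity_def)

lemma cochains_cdiff: "aug_ideal I \<Longrightarrow> F \<in> cochains I q \<Longrightarrow> cdiff F \<in> cochains I (q + 1)"
  by (simp add: cochains_def multilin_cdiff has_parity_cdiff bounded_deg_cdiff)

lemma cochains_ccup: "F \<in> cochains I q \<Longrightarrow> G \<in> cochains I r \<Longrightarrow> ccup F G \<in> cochains I (q + r)"
  by (simp add: cochains_def multilin_ccup has_parity_ccup bounded_deg_ccup)

lemma cochains_alt_sign: "F \<in> cochains I q \<Longrightarrow> alt_sign F \<in> cochains I q"
  by (simp add: cochains_def multilin_alt_sign has_parity_alt_sign bounded_deg_alt_sign)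

lemma cochains_mono: "J \<subseteq> I \<Longrightarrow> F \<in> cochains I q \<Longrightarrow> F \<in> cochains J q"
  by (auto simp: cochains_def intro: multilin_mono)

lemma alt_sign_alt_sign [simp]: "alt_sign (alt_sign F) = F"
  by (rule ext) (simp add: alt_sign_def flip: mult.assoc power_mult_distrib)

lemma tdiff_alt_sign: "tdiff (alt_sign F) as = - alt_sign (tdiff F) as"
proof (induction as arbitrary: F)
  case Nil then show ?case by (simp add: alt_sign_def)
next
  case (Cons a as)
  have s: "(\<lambda>bs. alt_sign F (a # bs)) = (\<lambda>bs. - alt_sign (\<lambda>bs. F (a # bs)) bs)"
    by (auto simp: alt_sign_def)
  have "absorb a (alt_sign F) as = (- 1) ^ length as * absorb a F as"
    by (cases as) (auto simp: alt_sign_def)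
  then show ?case using Cons.IH[of "\<lambda>bs. F (a # bs)"]
    by (simp add: s tdiff_neg) (simp add: alt_sign_def algebra_simps)
qed

lemma cdiff_alt_sign: "cdiff (alt_sign F) as = - alt_sign (cdiff F) as"
proof -
  have "head_counit (alt_sign F) as = - alt_sign (head_counit F) as"
    by (cases as) (auto simp: alt_sign_def)
  then show ?thesis by (simp add: cdiff_def tdiff_alt_sign) (simp add: alt_sign_def cdiff_def algebra_simps)
qed

lemma cocycD: "F \<in> cocyc I \<Longrightarrow> F \<in> cochains I 0" "F \<in> cocyc I \<Longrightarrow> cdiff F = (\<lambda>_. 0)"
  by (auto simp: cocyc_def)

lemma cocycI: "F \<in> cochains I 0 \<Longrightarrow> (\<And>as. cdiff F as = 0) \<Longrightarrow> F \<in> cocyc I"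
  by (auto simp: cocyc_def)

lemma cocyc_add: "F \<in> cocyc I \<Longrightarrow> G \<in> cocyc I \<Longrightarrow> (\<lambda>as. F as + G as) \<in> cocyc I"
  by (simp add: cocyc_def cochains_add cdiff_add)

lemma cocyc_scale: "F \<in> cocyc I \<Longrightarrow> (\<lambda>as. c * F as) \<in> cocyc I"
  by (simp add: cocyc_def cochains_scale cdiff_scale)

lemma cocyc_neg: "F \<in> cocyc I \<Longrightarrow> (\<lambda>as. - F as) \<in> cocyc I"
  using cocyc_scale[of F I "-1"] by simp

lemma cocyc_diff: "F \<in> cocyc I \<Longrightarrow> G \<in> cocyc I \<Longrightarrow> (\<lambda>as. F as - G as) \<in> cocyc I"
  using cocyc_add[OF _ cocyc_neg, of F I G] by simp

lemma cocyc_zero [simp]: "(\<lambda>_. 0) \<in> cocyc I"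
  by (simp add: cocyc_def)

lemma cocyc_ccup: assumes "F \<in> cocyc I" "G \<in> cocyc I" shows "ccup F G \<in> cocyc I"
  using assms cochains_ccup[of F I 0 G 0] by (intro cocycI) (auto simp: cdiff_ccup cocycD)

lemma cocyc_mono: "J \<subseteq> I \<Longrightarrow> F \<in> cocyc I \<Longrightarrow> F \<in> cocyc J"
  by (auto simp: cocyc_def intro: cochains_mono)

lemma cobound_subset: "aug_ideal I \<Longrightarrow> cobound I \<subseteq> cocyc I"
  using cochains_cdiff[of I _ 1] by (auto simp: cobound_def cocyc_def cdiff_cdiff)

lemma coboundI: "H \<in> cochains I 1 \<Longrightarrow> (\<And>as. F as = cdiff H as) \<Longrightarrow> F \<in> cobound I"
  unfolding cobound_def by (intro image_eqI[of _ _ H]) auto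

lemma coboundE: assumes "F \<in> cobound I" obtains H where "H \<in> cochains I 1" "F = cdiff H"
  using assms by (auto simp: cobound_def)

lemma cobound_add: assumes "F \<in> cobound I" "G \<in> cobound I" shows "(\<lambda>as. F as + G as) \<in> cobound I"
proof -
  obtain H K where "H \<in> cochains I 1" "K \<in> cochains I 1" "F = cdiff H" "G = cdiff K"
    using assms by (auto simp: cobound_def)
  then show ?thesis by (intro coboundI[OF cochains_add]) (auto simp: cdiff_add)
qed

lemma cobound_scale: assumes "F \<in> cobound I" shows "(\<lambda>as. c * F as) \<in> cobound I"
proof -
  obtain H where "H \<in> cochains I 1" "F = cdiff H"
    using assms by (auto simp: cobound_def)
  then show ?thesis by (intro coboundI[OF cochains_scale]) (auto simp: cdiff_scale)
qed

lemma cobound_neg: "F \<in> cobound I \<Longrightarrow> (\<lambda>as. - F as) \<in> cobound I"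
  using cobound_scale[of F I "-1"] by simp

lemma cobound_diff: "F \<in> cobound I \<Longrightarrow> G \<in> cobound I \<Longrightarrow> (\<lambda>as. F as - G as) \<in> cobound I"
  using cobound_add[OF _ cobound_neg, of F I G] by simp

lemma cobound_zero [simp]: "(\<lambda>_. 0) \<in> cobound I"
  by (rule coboundI[of "\<lambda>_. 0"]) auto

lemma cobound_mono: "J \<subseteq> I \<Longrightarrow> F \<in> cobound I \<Longrightarrow> F \<in> cobound J"
  by (auto simp: cobound_def intro: cochains_mono)

text \<open>The sign twist of a cocycle is again a cocycle and cancels the sign in the Leibniz rule,
  so \<open>ccup (alt_sign F) H\<close> is a primitive of the product of F with the coboundary of
  H.\<close>

lemma cobound_ccup_right: assumes "F \<in> cocyc I" "G \<in> cobound I" shows "ccup F G \<in> cobound I"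
proof -
  obtain H where H: "H \<in> cochains I 1" "G = cdiff H" using assms by (auto simp: cobound_def)
  have "ccup (alt_sign F) H \<in> cochains I 1"
    using cochains_ccup[OF cochains_alt_sign[OF cocycD(1)[OF assms(1)]] H(1)] by simp
  moreover have "cdiff (alt_sign F) = (\<lambda>_. 0)"
    by (rule ext) (use cocycD(2)[OF assms(1)] in \<open>simp add: cdiff_alt_sign\<close>, simp add: alt_sign_def)
  ultimately show ?thesis using H by (intro coboundI) (auto simp: cdiff_ccup)
qed

lemma cobound_ccup_left: assumes "F \<in> cocyc I" "G \<in> cobound I" shows "ccup G F \<in> cobound I"
proof -
  obtain H where H: "H \<in> cochains I 1" "G = cdiff H" using assms by (auto simp: cobound_def)
  have "ccup H F \<in> cochains I 1"
    using cochains_ccup[OF H(1) cocycD(1)[OF assms(1)]] by simp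
  then show ?thesis using H cocycD(2)[OF assms(1)] by (intro coboundI) (auto simp: cdiff_ccup)
qed

section \<open>The cohomology ring\<close>

text \<open>Inverse to restricting a bar cochain to leading entry 1: with trivial coefficients,
  linearity over A lets the leading entry act only through its augmentation.\<close>

definition full :: "('k::field st list \<Rightarrow> 'k) \<Rightarrow> 'k st list \<Rightarrow> 'k \<Rightarrow> 'k" where
  "full F as v = head_counit F as * v"

definition const_cochain :: "'k::field \<Rightarrow> 'k st list \<Rightarrow> 'k" where
  "const_cochain c as = (if as = [] then c else 0)"

lemma koszul_zero [simp]: "koszul i (0 :: 'v::ab_group_add) = 0"
  by (simp add: koszul_def)

lemma koszul_of_0 [simp]: "koszul 0 x = x"
  by (simp add: koszul_def)

lemma koszul_Suc: "koszul (of_nat (Suc n)) x = - koszul (of_nat n) x"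
proof (cases "of_nat n :: bit")
  case zero
  then show ?thesis by (simp add: koszul_def)
next
  case one
  then show ?thesis by (simp add: koszul_def)
qed

lemma merge_at_0: "merge_at 0 (a # b # bs) = a * b # bs"
  by (simp add: merge_at_def)

lemma merge_at_Suc: "merge_at (Suc i) (a # as) = a # merge_at i as"
  by (simp add: merge_at_def)

lemma tdiff_eq_sum:
  assumes "as \<noteq> []"
  shows "- tdiff F as = (\<Sum>i<length as - 1. koszul (of_nat i) (F (merge_at i as))) +
    koszul (of_nat (length as - 1)) (counit (last as) * F (butlast as))"
  using assms
proof (induction as arbitrary: F)
  case Nil
  then show ?case by simp
next
  case (Cons a as)
  show ?case
  proof (cases as)
    case Nil
    then show ?thesis by (simp add: koszul_def)
  next
    case (Cons b bs)
    have 1: "(\<Sum>i<length (a # b # bs) - 1. koszul (of_nat i) (F (merge_at i (a # b # bs)))) =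
        F (a * b # bs) - (\<Sum>i<length (b # bs) - 1. koszul (of_nat i) (F (a # merge_at i (b # bs))))"
      by (simp add: sum.lessThan_Suc_shift merge_at_0 merge_at_Suc koszul_Suc sum_negf del: of_nat_Suc sum.lessThan_Suc)
    have 2: "koszul (of_nat (length (a # b # bs) - 1)) (counit (last (a # b # bs)) * F (butlast (a # b # bs))) =
      - koszul (of_nat (length (b # bs) - 1)) (counit (last (b # bs)) * F (a # butlast (b # bs)))"
      by (cases bs) (simp_all add: koszul_Suc del: of_nat_Suc)
    have 3: "tdiff (\<lambda>bs. F (a # bs)) (b # bs) =
        - ((\<Sum>i<length (b # bs) - 1. koszul (of_nat i) (F (a # merge_at i (b # bs)))) +
        koszul (of_nat (length (b # bs) - 1)) (counit (last (b # bs)) * F (a # butlast (b # bs))))"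
      using arg_cong[OF Cons.IH[of "\<lambda>bs. F (a # bs)", unfolded Cons, OF list.distinct(2)], of uminus]
      by (simp only: minus_minus)
    have "- tdiff F (a # b # bs) = F (a * b # bs) + tdiff (\<lambda>bs. F (a # bs)) (b # bs)" by simp
    then show ?thesis unfolding Cons 1 2 3 by (simp only: diff_conv_add_uminus minus_add_distrib add.assoc)
  qed
qed

text \<open>A linear functional on the coefficient module turns the bar differential into the scalar
  operator. It is applied to the identity of k here, and to the coordinate at x_0 for the module
  L.\<close>

lemma tdiff_bar_diff:
  assumes "\<And>x y. \<pi> (x + y) = \<pi> x + (\<pi> y :: 'k::field)" "\<And>c x. \<pi> (scl W c x) = c * \<pi> x" "\<pi> (f [] v) = 0"
  shows "\<pi> (bar_diff W f as v) = - tdiff (\<lambda>bs. \<pi> (f bs v)) as"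
proof -
  have 0: "\<pi> 0 = 0" using assms(1)[of 0 0] by (metis add_0_left add_cancel_right_right)
  then have neg: "\<pi> (- x) = - \<pi> x" for x using assms(1)[of x "- x"] by (simp add: eq_neg_iff_add_eq_0 add.commute)
  have k: "\<pi> (koszul i x) = koszul i (\<pi> x)" for i x by (simp add: koszul_def neg)
  have s: "\<pi> (sum g {..<n}) = (\<Sum>i<n. \<pi> (g i))" for g and n :: nat
    by (induction n) (auto simp: 0 assms(1))
  show ?thesis
  proof (cases "length as \<le> 1")
    case True
    then have "as = [] \<or> (\<exists>a. as = [a])" by (cases as) auto
    then show ?thesis using assms(3) by (auto simp: bar_diff_def 0)
  next
    case False
    then have ne: "as \<noteq> []" by auto
    show ?thesis using False unfolding bar_diff_def tdiff_eq_sum[OF ne] by (simp add: assms(1,2) s k)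
  qed
qed

lemma bar_diff_full: "bar_diff trivial_smod (full F) = full (cdiff F)"
proof (intro ext)
  fix as v
  have "bar_diff trivial_smod (full F) as v = - tdiff (\<lambda>bs. full F bs v) as"
    by (rule tdiff_bar_diff[of "\<lambda>x. x"]) (simp_all add: trivial_smod_def full_def)
  also have "tdiff (\<lambda>bs. full F bs v) as = v * tdiff (head_counit F) as"
    unfolding tdiff_scale[symmetric] full_def by (simp only: mult.commute)
  finally show "bar_diff trivial_smod (full F) as v = full (cdiff F) as v"
    by (simp add: tdiff_head_counit full_def[of "cdiff F"])
qed

lemma cup_full: "cup (full F) (full G) = full (ccup F G)"
proof (intro ext)
  fix as and v :: 'a
  show "cup (full F) (full G) as v = full (ccup F G) as v"
  proof (cases as)
    case Nil then show ?thesis by (simp add: cup_def full_def)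
  next
    case (Cons a bs)
    then show ?thesis
      by (simp add: cup_def full_def ccup_eq_sum sum_distrib_left sum_distrib_right mult_ac lessThan_Suc_atMost)
  qed
qed

lemma full_add: "full F + full G = full (\<lambda>as. F as + G as)"
  by (intro ext) (simp add: full_def head_counit_add algebra_simps)

lemma full_zero: "full (\<lambda>_. 0) = 0"
proof (intro ext)
  show "full (\<lambda>_. 0) as v = 0 as v" for as and v :: 'a
    by (cases as) (auto simp: full_def)
qed

lemma full_const: "full (const_cochain c) = scalar_cochain c"
proof (intro ext)
  show "full (const_cochain c) as v = scalar_cochain c as v" for as and v :: 'a
    by (cases as) (auto simp: full_def const_cochain_def scalar_cochain_def)
qed

lemma full_eq_iff: "full F = full G \<longleftrightarrow> F = G"
proof
  assume "full F = full G"
  then have "full F (1 # as) 1 = full G (1 # as) 1" for as by simp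
  then show "F = G" by (auto simp: full_def)
qed simp

lemma st_decompose: "\<exists>b c. a = smult [:counit a:] 1 + s_gen * b + t_gen * (c :: 'k::field st)"
proof -
  obtain a0 c where a: "a = pCons a0 c" by (cases a)
  obtain x b where a0: "a0 = pCons x b" by (cases a0)
  have "a = smult [:counit a:] 1 + s_gen * [:b:] + t_gen * c"
  proof -
    have "t_gen * c = pCons 0 c" by (simp add: t_gen_def)
    moreover have "s_gen * [:b:] = [:pCons 0 b:]" by (simp add: s_gen_def)
    moreover have "smult [:counit a:] 1 = [:[:x:]:]" by (simp add: a a0 counit_def one_pCons)
    ultimately show ?thesis by (simp add: a a0)
  qed
  then show ?thesis by blast
qed

lemma bar_cochain_trivialI:
  fixes F :: "'k::field st list \<Rightarrow> 'k"
  assumes "aug_ideal I" "F \<in> cochains I q" shows "bar_cochain I trivial_smod trivial_smod q (full F)"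
proof -
  from assms(2) have F: "multilin I F" "has_parity q F" "bounded_deg F" by (auto simp: cochains_def)
  have lin: "lin_on I (\<lambda>a. head_counit F (as @ a # bs))" for as bs
    using multilinD[OF multilin_head_counit[OF assms(1) F(1)]] .
  have car: "smod_carrier (trivial_smod :: ('k, 'k) supermodule) = UNIV"
    by (force simp: smod_carrier_def trivial_smod_def)
  have hp: "has_parity (q + 1) (head_counit F)" by (rule has_parity_head_counit[OF F(2)])
  show ?thesis
    unfolding bar_cochain_def car
  proof (intro conjI allI ballI impI)
    show "full F [] = 0" by (auto simp: full_def)
    obtain N where N: "\<And>as. length as > N \<Longrightarrow> F as = 0" using F(3) by (auto simp: bounded_deg_def)
    show "\<exists>N. \<forall>as. N < length as \<longrightarrow> full F as = 0"
    proof (intro exI[of _ "Suc N"] allI impI ext)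
      fix as :: "'k st list" and v assume "Suc N < length as"
      then show "full F as v = 0 v" using N by (cases as) (auto simp: full_def)
    qed
  next
    fix as :: "'k st list" and v w c :: 'k
    show "full F as (v + w) = full F as v + full F as w" by (simp add: full_def algebra_simps)
    show "full F as (scl trivial_smod c v) = scl trivial_smod c (full F as v)"
      by (simp add: full_def trivial_smod_def)
  next
    fix as bs :: "'k st list" and a b
    show "full F (as @ (a + b) # bs) = full F (as @ a # bs) + full F (as @ b # bs)"
      using lin[of as bs] by (auto simp: full_def lin_on_def algebra_simps)
  next
    fix as bs :: "'k st list" and a and c v :: 'k
    show "full F (as @ [:[:c:]:] * a # bs) v = scl trivial_smod c (full F (as @ a # bs) v)"
      using lin[of as bs] by (auto simp: full_def lin_on_def trivial_smod_def algebra_simps)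
  next
    fix as bs :: "'k st list" and a assume "a \<in> I"
    then show "full F (as @ a # bs) = 0"
      using lin[of as bs] by (auto simp: full_def lin_on_def)
  next
    fix as :: "'k st list" and "is" j and v :: 'k
    assume *: "v \<in> part trivial_smod j" "as \<noteq> []" "list_all2 (\<lambda>a i. a \<in> st_part i) as is"
    show "full F as v \<in> part trivial_smod (of_nat (length as - 1) + q + sum_list is + j)"
    proof (cases "head_counit F as = 0 \<or> v = 0")
      case True
      then show ?thesis by (auto simp: full_def trivial_smod_def)
    next
      case False
      then have "j = 0" using *(1) by (auto simp: trivial_smod_def split: if_splits)
      moreover have "of_nat (length as) + (q + 1) + sum_list is = 0"
        using has_parityD[OF hp *(3)] False by auto
      moreover have "length as = Suc (length as - 1)" using *(2) by (cases as) auto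
      ultimately have "of_nat (Suc (length as - 1)) + (q + 1) + sum_list is = 0" by metis
      then have "of_nat (length as - 1) + q + sum_list is + j = 0"
        using \<open>j = 0\<close> by (simp add: ac_simps)
      then show ?thesis by (simp add: trivial_smod_def)
    qed
  next
    fix a :: "'k st" and as and v :: 'k
    show "full F (a # as) (s_act trivial_smod v) + full F (s_gen * a # as) v = s_act trivial_smod (full F (a # as) v)"
      by (simp add: full_def trivial_smod_def)
  next
    fix a :: "'k st" and as j and v :: 'k
    show "full F (a # as) (t_act trivial_smod v) + koszul j (full F (t_gen * a # as) v) =
       koszul (of_nat (length as) + q) (t_act trivial_smod (full F (a # as) v))"
      by (simp add: full_def trivial_smod_def)
  qed (auto)
qed

text \<open>Since s and t act by zero on k, f vanishes whenever its leading entry is a multiple of s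
  or t. By \<open>st_decompose\<close> only the augmentation of the leading entry survives.\<close>

lemma bar_cochain_trivialE:
  fixes f :: "'k::field st list \<Rightarrow> 'k \<Rightarrow> 'k"
  assumes "bar_cochain I trivial_smod trivial_smod q f"
  obtains F where "F \<in> cochains I q" "f = full F"
proof -
  have car: "smod_carrier (trivial_smod :: ('k, 'k) supermodule) = UNIV"
    by (force simp: smod_carrier_def trivial_smod_def)
  note f = assms[unfolded bar_cochain_def car]
  have f0: "f [] = 0" and scal: "f as (c * v) = c * f as v" for as c v
    using f by (auto simp: trivial_smod_def)
  have add: "f (as @ (a + b) # bs) = f (as @ a # bs) + f (as @ b # bs)"
    and smul: "f (as @ smult [:c:] a # bs) v = c * f (as @ a # bs) v"
    and van: "a \<in> I \<Longrightarrow> f (as @ a # bs) = 0" for as bs a b c v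
  proof -
    have *: "\<forall>as bs a b. f (as @ (a + b) # bs) = f (as @ a # bs) + f (as @ b # bs)"
        "\<forall>as bs a c. \<forall>v\<in>UNIV. f (as @ [:[:c:]:] * a # bs) v = scl trivial_smod c (f (as @ a # bs) v)"
        "\<forall>as bs. \<forall>a\<in>I. f (as @ a # bs) = 0"
      using f by - (elim conjE, assumption)+
    show "f (as @ (a + b) # bs) = f (as @ a # bs) + f (as @ b # bs)" using *(1) by simp
    show "a \<in> I \<Longrightarrow> f (as @ a # bs) = 0" using *(3) by simp
    show "f (as @ smult [:c:] a # bs) v = c * f (as @ a # bs) v"
      using *(2)[rule_format, of v as c a bs] by (simp add: trivial_smod_def)
  qed
  have f00: "f as 0 = 0" for as using scal[of as 0 0] by simp
  have s: "f (s_gen * a # as) v = 0" for a as v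
  proof -
    have "f (a # as) (s_act trivial_smod v) + f (s_gen * a # as) v = s_act trivial_smod (f (a # as) v)" using f by blast
    then show ?thesis by (simp add: trivial_smod_def f00)
  qed
  have t: "f (t_gen * a # as) v = 0" for a as v
  proof -
    have *: "\<And>j. v \<in> part trivial_smod j \<Longrightarrow> f (a # as) (t_act trivial_smod v) + koszul j (f (t_gen * a # as) v) =
        koszul (of_nat (length as) + q) (t_act trivial_smod (f (a # as) v))" using f by blast
    show ?thesis using *[of 0] by (simp add: trivial_smod_def f00 koszul_def)
  qed
  define F where "F as = f (1 # as) 1" for as
  have fF: "f as v = full F as v" for as v
  proof (cases as)
    case (Cons a bs)
    obtain b c where a: "a = smult [:counit a:] 1 + s_gen * b + t_gen * c" using st_decompose by blast
    have "f (a # bs) v = f (smult [:counit a:] 1 # bs) v + f (s_gen * b # bs) v + f (t_gen * c # bs) v"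
      by (subst a) (simp add: add[of "[]", simplified])
    also have "\<dots> = counit a * (v * f (1 # bs) 1)"
      using smul[of "[]" "counit a" 1 bs v] scal[of "1 # bs" v 1] by (simp add: s t)
    finally show ?thesis by (simp add: Cons full_def F_def)
  qed (simp add: f0 full_def)
  have "multilin I F"
    unfolding multilin_def
  proof (intro allI lin_onI)
    fix as bs a b c
    show "F (as @ (a + b) # bs) = F (as @ a # bs) + F (as @ b # bs)"
      using add[of "1 # as"] by (simp add: F_def)
    show "F (as @ smult [:c:] a # bs) = c * F (as @ a # bs)"
      using smul[of "1 # as"] by (simp add: F_def)
    show "a \<in> I \<Longrightarrow> F (as @ a # bs) = 0"
      using van[of a "1 # as"] by (simp add: F_def)
  qed
  moreover have "has_parity q F"
    unfolding has_parity_def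
  proof (intro allI impI)
    fix as "is" assume *: "list_all2 (\<lambda>a i. a \<in> st_part i) as is" "F as \<noteq> 0"
    have l: "list_all2 (\<lambda>a i. a \<in> st_part i) (1 # as) (0 # is)" using * one_st_part by simp
    have v: "1 \<in> part (trivial_smod :: ('k, 'k) supermodule) 0" by (simp add: trivial_smod_def)
    have "\<forall>as is j. \<forall>v\<in>part trivial_smod j. as \<noteq> [] \<longrightarrow> list_all2 (\<lambda>a i. a \<in> st_part i) as is \<longrightarrow>
        f as v \<in> part trivial_smod (of_nat (length as - 1) + q + sum_list is + j)" using f by - (elim conjE, assumption)
    then have "f (1 # as) 1 \<in> part trivial_smod (of_nat (length (1 # as) - 1) + q + sum_list (0 # is) + 0)"
      using v l by blast
    then show "of_nat (length as) + q + sum_list is = 0"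
      using *(2) by (auto simp: F_def trivial_smod_def split: if_splits)
  qed
  moreover have "bounded_deg F"
  proof -
    have "\<exists>N. \<forall>as. length as > N \<longrightarrow> f as = 0" using f by - (elim conjE, assumption)
    then obtain N where "\<forall>as. length as > N \<longrightarrow> f as = 0" by blast
    then show ?thesis by (intro bounded_degI[of N]) (auto simp: F_def)
  qed
  ultimately show ?thesis using that[of F] fF by (auto simp: cochains_def)
qed

lemma cocycles_eq: assumes "aug_ideal I" shows "cocycles I = full ` cocyc I"
proof -
  have *: "bar_diff trivial_smod (full F) = 0 \<longleftrightarrow> (\<forall>as. cdiff F as = 0)" for F :: "'a st list \<Rightarrow> 'a"
    using full_eq_iff[of "cdiff F" "\<lambda>_. 0"] by (auto simp: bar_diff_full full_zero fun_eq_iff)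
  show ?thesis
  proof (intro subset_antisym subsetI)
    fix x :: "'a st list \<Rightarrow> 'a \<Rightarrow> 'a" assume "x \<in> cocycles I"
    then have x: "bar_cochain I trivial_smod trivial_smod 0 x" "bar_diff trivial_smod x = 0"
      by (auto simp: cocycles_def)
    then obtain F where "F \<in> cochains I 0" "x = full F" by (elim bar_cochain_trivialE)
    then show "x \<in> full ` cocyc I" using x(2) * by (auto simp: cocyc_def)
  next
    fix x :: "'a st list \<Rightarrow> 'a \<Rightarrow> 'a" assume "x \<in> full ` cocyc I"
    then show "x \<in> cocycles I" using * bar_cochain_trivialI[OF assms] by (auto simp: cocycles_def cocyc_def)
  qed
qed

lemma coboundaries_eq: assumes "aug_ideal I" shows "coboundaries I = full ` cobound I"
proof (intro subset_antisym subsetI)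
  fix x assume "x \<in> coboundaries I"
  then obtain g where "bar_cochain I trivial_smod trivial_smod 1 g" "x = bar_diff trivial_smod g"
    by (auto simp: coboundaries_def)
  then show "x \<in> full ` cobound I"
    by (elim bar_cochain_trivialE) (auto simp: bar_diff_full cobound_def)
next
  fix x assume "x \<in> full ` cobound I"
  then obtain H where "H \<in> cochains I 1" "x = bar_diff trivial_smod (full H)"
    by (auto simp: cobound_def bar_diff_full)
  then show "x \<in> coboundaries I"
    using bar_cochain_trivialI[OF assms] by (auto simp: coboundaries_def)
qed

lemma const_cochain_cocyc: "const_cochain c \<in> cocyc I"
proof -
  have "cdiff (const_cochain c) as = 0" for as
  proof (cases as)
    case (Cons a bs)
    then show ?thesis by (cases bs) (auto simp: cdiff_def const_cochain_def)
  qed simp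
  moreover have "const_cochain c \<in> cochains I 0"
    by (auto simp: cochains_def multilin_def has_parity_def const_cochain_def lin_on_def
        intro!: bounded_degI[of 0])
  ultimately show ?thesis by (rule cocycI[rotated])
qed

lemma ccup_const_left [simp]: "ccup (const_cochain c) F as = c * F as"
  by (cases as) (auto simp: const_cochain_def)

lemma ccup_const_right [simp]: "ccup F (const_cochain c) as = c * F as"
  by (induction as arbitrary: F) (auto simp: const_cochain_def)

lemma ccup_add_fun:
  "ccup (\<lambda>as. F as + G as) H = (\<lambda>as. ccup F H as + ccup G H as)"
  "ccup F (\<lambda>as. G as + H as) = (\<lambda>as. ccup F G as + ccup F H as)"
  by (auto simp: fun_eq_iff ccup_add_left ccup_add_right)

lemma cocycle_ring_ring: assumes "aug_ideal I" shows "ring (cocycle_ring I)"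
proof (rule ringI)
  let ?R = "cocycle_ring I"
  have car: "carrier ?R = full ` cocyc I" using cocycles_eq[OF assms] by (simp add: cocycle_ring_def)
  have ops: "mult ?R = cup" "add ?R = (+)" "one ?R = full (const_cochain 1)" "zero ?R = full (\<lambda>_. 0)"
    by (auto simp: cocycle_ring_def full_const full_zero)
  show "abelian_group ?R"
  proof (rule abelian_groupI, unfold car ops)
    fix x assume "x \<in> full ` cocyc I"
    then obtain F where F: "F \<in> cocyc I" "x = full F" by auto
    show "\<exists>y\<in>full ` cocyc I. y + x = full (\<lambda>_. 0)"
      using F cocyc_neg[OF F(1)] by (intro bexI[of _ "full (\<lambda>as. - F as)"]) (auto simp: full_add)
  qed (use imageI[OF cocyc_zero, of full I] in \<open>auto simp: full_add cocyc_add add.assoc add.commute full_zero\<close>)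
  show "Group.monoid ?R"
    using const_cochain_cocyc
  proof (intro monoidI, unfold car ops)
    have [simp]: "ccup (const_cochain 1) F = F" "ccup F (const_cochain 1) = F" for F :: "'a st list \<Rightarrow> 'a"
      by (auto simp: fun_eq_iff)
    have [simp]: "ccup (ccup F G) H = ccup F (ccup G H)" for F G H :: "'a st list \<Rightarrow> 'a"
      by (rule ext) (rule ccup_assoc)
    fix x y z assume x: "x \<in> full ` cocyc I"
    then show "cup (full (const_cochain 1)) x = x" "cup x (full (const_cochain 1)) = x" by (auto simp: cup_full)
    assume y: "y \<in> full ` cocyc I"
    then show "cup x y \<in> full ` cocyc I" using x by (auto simp: cup_full cocyc_ccup)
    assume "z \<in> full ` cocyc I"
    then show "cup (cup x y) z = cup x (cup y z)" using x y by (auto simp: cup_full)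
  qed (use const_cochain_cocyc in auto)
qed (auto simp: cocycles_eq[OF assms] cocycle_ring_def full_add cup_full ccup_add_fun)

lemma coboundaries_ideal: assumes "aug_ideal I" shows "ideal (coboundaries I) (cocycle_ring I)"
proof (rule idealI[OF cocycle_ring_ring[OF assms]])
  interpret R: ring "cocycle_ring I" by (rule cocycle_ring_ring[OF assms])
  note eqs = cocycles_eq[OF assms] coboundaries_eq[OF assms]
  show "subgroup (coboundaries I) (add_monoid (cocycle_ring I))"
  proof (rule R.add.subgroupI)
    show "coboundaries I \<subseteq> carrier (cocycle_ring I)"
      using cobound_subset[OF assms] by (auto simp: cocycle_ring_def eqs)
    show "coboundaries I \<noteq> {}" using cobound_zero[of I] by (auto simp: eqs simp del: cobound_zero)
  next
    fix x assume x: "x \<in> coboundaries I"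
    then obtain F where F: "F \<in> cobound I" "x = full F" by (auto simp: eqs)
    have Z: "F \<in> cocyc I" using F cobound_subset[OF assms] by auto
    have "\<ominus>\<^bsub>cocycle_ring I\<^esub> x = full (\<lambda>as. - F as)"
      using cocyc_neg[OF Z] Z F(2)
      by (intro R.minus_equality) (auto simp: cocycle_ring_def eqs full_add full_zero)
    then show "\<ominus>\<^bsub>cocycle_ring I\<^esub> x \<in> coboundaries I" using cobound_neg[OF F(1)] by (auto simp: eqs)
  next
    fix x y assume "x \<in> coboundaries I" "y \<in> coboundaries I"
    then show "x \<oplus>\<^bsub>cocycle_ring I\<^esub> y \<in> coboundaries I"
      by (auto simp: eqs cocycle_ring_def full_add cobound_add)
  qed
qed (auto simp: cocycles_eq[OF assms] coboundaries_eq[OF assms] cocycle_ring_def cup_full cobound_ccup_left cobound_ccup_right)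

section \<open>Calculating with cohomology classes\<close>

definition cls :: "'k::field st set \<Rightarrow> ('k st list \<Rightarrow> 'k) \<Rightarrow> ('k st list \<Rightarrow> 'k \<Rightarrow> 'k) set" where
  "cls I F = coh_class I (full F)"

lemma coh_ring_ring: "aug_ideal I \<Longrightarrow> ring (coh_ring I)"
  unfolding coh_ring_def using coboundaries_ideal by (rule ideal.quotient_is_ring)

lemma cls_eq_image: assumes "aug_ideal I" shows "cls I F = {full (\<lambda>as. H as + F as) | H. H \<in> cobound I}"
  unfolding cls_def coh_class_def a_r_coset_def' coboundaries_eq[OF assms]
  by (auto simp: cocycle_ring_def full_add)

lemma carrier_coh_ring: assumes "aug_ideal I" shows "carrier (coh_ring I) = cls I ` cocyc I"
  unfolding coh_ring_def FactRing_def A_RCOSETS_def' cls_def coh_class_def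
  by (auto simp: cocycle_ring_def cocycles_eq[OF assms])

lemma cls_eq_iff:
  assumes "aug_ideal I" shows "cls I F = cls I G \<longleftrightarrow> (\<lambda>as. F as - G as) \<in> cobound I"
proof
  assume "cls I F = cls I G"
  moreover have "full F \<in> cls I F"
    unfolding cls_eq_image[OF assms] by (intro CollectI exI[of _ "\<lambda>_. 0"]) simp
  ultimately obtain H where H: "H \<in> cobound I" "F = (\<lambda>as. H as + G as)"
    unfolding cls_eq_image[OF assms] full_eq_iff by (auto simp: full_eq_iff)
  then show "(\<lambda>as. F as - G as) \<in> cobound I" by simp
next
  assume *: "(\<lambda>as. F as - G as) \<in> cobound I"
  have sub: "cls I F \<subseteq> cls I G" if "(\<lambda>as. F as - G as) \<in> cobound I" for F G
  proof
    fix x assume "x \<in> cls I F"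
    then obtain H where "H \<in> cobound I" "x = full (\<lambda>as. H as + F as)" by (auto simp: cls_eq_image[OF assms])
    then show "x \<in> cls I G"
      unfolding cls_eq_image[OF assms]
      by (intro CollectI exI[of _ "\<lambda>as. H as + (F as - G as)"]) (simp add: cobound_add[OF _ that])
  qed
  show "cls I F = cls I G"
    using sub[OF *] sub[of G F] cobound_neg[OF *] by auto
qed

lemma cls_mult:
  assumes "aug_ideal I" "F \<in> cocyc I" "G \<in> cocyc I"
  shows "cls I F \<otimes>\<^bsub>coh_ring I\<^esub> cls I G = cls I (ccup F G)"
proof -
  interpret ideal "coboundaries I" "cocycle_ring I" by (rule coboundaries_ideal[OF assms(1)])
  show ?thesis
    unfolding coh_ring_def cls_def coh_class_def FactRing_def
    using rcoset_mult_add[of "full F" "full G"] assms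
    by (simp add: cocycle_ring_def cocycles_eq cup_full)
qed

lemma cls_add:
  assumes "aug_ideal I" "F \<in> cocyc I" "G \<in> cocyc I"
  shows "cls I F \<oplus>\<^bsub>coh_ring I\<^esub> cls I G = cls I (\<lambda>as. F as + G as)"
proof -
  interpret ideal "coboundaries I" "cocycle_ring I" by (rule coboundaries_ideal[OF assms(1)])
  show ?thesis
    unfolding coh_ring_def cls_def coh_class_def FactRing_def
    using a_rcos_sum[of "full F" "full G"] assms
    by (simp add: cocycle_ring_def cocycles_eq full_add)
qed

lemma cls_one: "\<one>\<^bsub>coh_ring I\<^esub> = cls I (const_cochain 1)"
  unfolding coh_ring_def cls_def coh_class_def FactRing_def by (simp add: cocycle_ring_def full_const)

lemma cls_zero: assumes "aug_ideal I" shows "\<zero>\<^bsub>coh_ring I\<^esub> = cls I (\<lambda>_. 0)"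
  by (auto simp: coh_ring_def FactRing_def cls_eq_image[OF assms] coboundaries_eq[OF assms])

text \<open>Pulling back does not change the underlying function, and for J \<subseteq> I every
  coboundary over I is one over J and is absorbed into the larger coset.\<close>

lemma inflate_cls:
  assumes "aug_ideal I" "aug_ideal J" "J \<subseteq> I" shows "inflate J (cls I F) = cls J F"
proof -
  have "inflate J (cls I F) = {full (\<lambda>as. H as + (K as + F as)) | H K. H \<in> cobound J \<and> K \<in> cobound I}"
    unfolding inflate_def set_add_def' cls_eq_image[OF assms(1)] coboundaries_eq[OF assms(2)]
    by (auto simp: cocycle_ring_def full_add Setcompr_eq_image)
  also have "\<dots> = {full (\<lambda>as. H as + F as) | H. H \<in> cobound J}"
  proof (intro subset_antisym subsetI)
    fix x assume "x \<in> {full (\<lambda>as. H as + (K as + F as)) | H K. H \<in> cobound J \<and> K \<in> cobound I}"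
    then obtain H K where "H \<in> cobound J" "K \<in> cobound I" "x = full (\<lambda>as. H as + (K as + F as))" by auto
    then show "x \<in> {full (\<lambda>as. H as + F as) | H. H \<in> cobound J}"
      using cobound_add[of H J K] cobound_mono[OF assms(3)] by (intro CollectI exI[of _ "\<lambda>as. H as + K as"]) (auto simp: add.assoc)
  next
    fix x assume "x \<in> {full (\<lambda>as. H as + F as) | H. H \<in> cobound J}"
    then obtain H where "H \<in> cobound J" "x = full (\<lambda>as. H as + F as)" by auto
    then show "x \<in> {full (\<lambda>as. H as + (K as + F as)) | H K. H \<in> cobound J \<and> K \<in> cobound I}"
      using cobound_zero[of I] by (intro CollectI exI[of _ H] exI[of _ "\<lambda>_. 0"]) auto
  qed
  finally show ?thesis by (simp add: cls_eq_image[OF assms(2)])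
qed

section \<open>Carrying modulo \<open>s\<^sup>p\<close>\<close>

definition tau :: "'k::field st \<Rightarrow> 'k" where "tau a = coeff (coeff a 1) 0"

lemma coeff_mult_1: "coeff (a * b) 1 = coeff a 0 * coeff b 1 + coeff a 1 * coeff b 0"
  by (simp add: coeff_mult)

lemma coeff_s_gen_mult [simp]: "coeff (s_gen * a) j = pCons 0 (coeff a j)"
  by (simp add: s_gen_def)

lemma coeff_s_gen_power_mult: "coeff (s_gen ^ n * a) j = monom 1 n * coeff a j"
  by (induction n arbitrary: j) (auto simp: mult.assoc monom_Suc)

lemma coeff_s_gen_power: "coeff (s_gen ^ n) j = (if j = 0 then monom 1 n else 0)"
  using coeff_s_gen_power_mult[of n 1 j] by auto

lemma coeff_t_gen_mult [simp]: "coeff (t_gen * a) 0 = 0" "coeff (t_gen * a) (Suc j) = coeff a j"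
  by (simp_all add: t_gen_def)

lemma tau_mult: "tau (a * b) = counit a * tau b + tau a * counit b"
  by (simp add: tau_def counit_def coeff_mult_1 coeff_mult_0 flip: One_nat_def)

lemma tau_simps [simp]:
  "tau (a + b) = tau a + tau b" "tau (smult [:c:] a) = c * tau a" "tau s_gen = 0" "tau t_gen = 1" "tau 1 = 0"
  by (simp_all add: tau_def s_gen_def t_gen_def)

lemma tau_s_gen_power [simp]: "tau (s_gen ^ n) = 0"
  by (simp add: tau_def coeff_s_gen_power)

lemma M11_ideal_iff:
  "a \<in> M11_ideal p \<longleftrightarrow> (\<forall>i<p. coeff (coeff a 0) i = 0 \<and> coeff (coeff a 1) i = 0)"
proof
  assume "a \<in> M11_ideal p"
  then obtain f g where "a = s_gen ^ p * f + t_gen ^ 2 * g" by (auto simp: M11_ideal_def)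
  then show "\<forall>i<p. coeff (coeff a 0) i = 0 \<and> coeff (coeff a 1) i = 0"
    by (simp add: power2_eq_square mult.assoc coeff_s_gen_power_mult coeff_monom_mult)
next
  assume *: "\<forall>i<p. coeff (coeff a 0) i = 0 \<and> coeff (coeff a 1) i = 0"
  obtain a0 a1 g where a: "a = pCons a0 (pCons a1 g)" by (metis pCons_cases)
  define f where "f = [:poly_shift p a0, poly_shift p a1:]"
  have "monom 1 p * poly_shift p q = q" if "\<forall>i<p. coeff q i = 0" for q :: "'a poly"
    using that by (auto simp: poly_eq_iff coeff_monom_mult coeff_poly_shift)
  then have f: "monom 1 p * coeff f 0 = a0" "monom 1 p * coeff f (Suc 0) = a1" "coeff f (Suc (Suc j)) = 0" for j
    using * by (simp_all add: a f_def)
  have "coeff a j = coeff (s_gen ^ p * f + t_gen ^ 2 * g) j" for j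
  proof -
    consider "j = 0" | "j = Suc 0" | k where "j = Suc (Suc k)" by (metis not0_implies_Suc)
    then show ?thesis
      by cases (simp_all add: coeff_s_gen_power_mult power2_eq_square mult.assoc f, simp_all add: a)
  qed
  then have "a = s_gen ^ p * f + t_gen ^ 2 * g" by (rule poly_eqI)
  then show "a \<in> M11_ideal p" by (auto simp: M11_ideal_def)
qed

lemma aug_ideal_M11: "p > 0 \<Longrightarrow> aug_ideal (M11_ideal p)"
proof -
  assume "p > 0"
  then have "counit a = 0" if "a \<in> M11_ideal p" for a :: "'a st"
    using that by (auto simp: M11_ideal_iff counit_def)
  moreover have "a * b \<in> M11_ideal p" if a: "a \<in> M11_ideal p" for a b :: "'a st"
  proof -
    obtain f g where "a = s_gen ^ p * f + t_gen ^ 2 * g" using a by (auto simp: M11_ideal_def)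
    then have "a * b = s_gen ^ p * (f * b) + t_gen ^ 2 * (g * b)" by (simp add: algebra_simps)
    then show ?thesis unfolding M11_ideal_def by blast
  qed
  ultimately show ?thesis by (auto simp: aug_ideal_def)
qed

lemma aug_ideal_P1: "p > 0 \<Longrightarrow> aug_ideal (P1_ideal p)"
  by (auto simp: aug_ideal_def P1_ideal_def power2_eq_square mult.assoc)

lemma aug_ideal_Ga1: "p > 0 \<Longrightarrow> aug_ideal (Ga1_ideal p)"
proof -
  assume "p > 0"
  moreover have "a * b \<in> Ga1_ideal p" if a: "a \<in> Ga1_ideal p" for a b :: "'a st"
  proof -
    obtain f g where "a = s_gen ^ p * f + t_gen * g" using a by (auto simp: Ga1_ideal_def)
    then have "a * b = s_gen ^ p * (f * b) + t_gen * (g * b)" by (simp add: algebra_simps)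
    then show ?thesis unfolding Ga1_ideal_def by blast
  qed
  ultimately show ?thesis by (auto simp: aug_ideal_def Ga1_ideal_def)
qed

lemma M11_ideal_subset_Ga1: "M11_ideal p \<subseteq> Ga1_ideal p"
  unfolding M11_ideal_def Ga1_ideal_def power2_eq_square by (auto simp: mult.assoc)

lemma P1_ideal_subset_M11: "P1_ideal p \<subseteq> M11_ideal p"
  unfolding M11_ideal_def P1_ideal_def by (auto simp: distrib_right)

lemma lin_on_M11_cong:
  assumes "lin_on (M11_ideal p) f"
    and "\<And>i. i < p \<Longrightarrow> coeff (coeff a 0) i = coeff (coeff b 0) i"
    and "\<And>i. i < p \<Longrightarrow> coeff (coeff a 1) i = coeff (coeff b 1) i"
  shows "f a = f b"
proof -
  have "a - b \<in> M11_ideal p" using assms(2,3) by (simp add: M11_ideal_iff)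
  then have "f (a - b) = 0" using assms(1) by (simp add: lin_on_def)
  then show ?thesis using lin_on_minus[OF assms(1), of a b] by simp
qed

lemma lin_on_tau: "p > 0 \<Longrightarrow> lin_on (M11_ideal p) tau"
  by (auto simp: lin_on_def M11_ideal_iff) (simp add: tau_def)

text \<open>The quotient (P - P(0)) / s after reducing P modulo s^p. It depends only on P modulo
  s^p.\<close>

definition trunc_quot :: "nat \<Rightarrow> 'k::field poly \<Rightarrow> 'k poly" where
  "trunc_quot p P = poly_shift 1 (poly_cutoff p P)"

definition s_quot :: "nat \<Rightarrow> 'k::field st \<Rightarrow> 'k st" where
  "s_quot p a = [:trunc_quot p (coeff a 0), trunc_quot p (coeff a 1):]"

text \<open>For p > 0 this is the sum of P_k Q_(p-k) over 0 < k < p. On k[s] it is, up to sign, the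
  coboundary of the functional "coefficient of s^p". That functional does not descend to k[s]/s^p,
  whereas the carry does.\<close>

definition carry :: "nat \<Rightarrow> 'k::field poly \<Rightarrow> 'k poly \<Rightarrow> 'k" where
  "carry p P Q = coeff (P * Q) p - coeff P p * coeff Q 0 - coeff P 0 * coeff Q p"

lemma coeff_trunc_quot: "coeff (trunc_quot p P) i = (if Suc i < p then coeff P (Suc i) else 0)"
  by (simp add: trunc_quot_def coeff_poly_shift coeff_poly_cutoff)

lemma coeff_s_quot [simp]: "coeff (s_quot p a) 0 = trunc_quot p (coeff a 0)"
  "coeff (s_quot p a) (Suc 0) = trunc_quot p (coeff a 1)"
  by (simp_all add: s_quot_def)

text \<open>With P = P_0 + s P' one has PQ = P_0 Q + s P' Q, so exact division by s is a derivation
  over the augmentation. Truncation disturbs this only at the coefficient of s^(p-1), where the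
  carry remains.\<close>

lemma trunc_quot_mult:
  assumes "i < p"
  shows "coeff P 0 * coeff (trunc_quot p Q) i - coeff (trunc_quot p (P * Q)) i + coeff (trunc_quot p P * Q) i =
    (if Suc i = p then carry p P Q else 0)"
proof -
  have 1: "coeff (P * Q) (Suc i) = coeff P 0 * coeff Q (Suc i) + (\<Sum>k\<le>i. coeff P (Suc k) * coeff Q (i - k))"
    unfolding coeff_mult sum.atMost_Suc_shift by simp
  show ?thesis
  proof (cases "Suc i = p")
    case False
    then have "Suc i < p" using assms by simp
    then have "coeff (trunc_quot p P * Q) i = (\<Sum>k\<le>i. coeff P (Suc k) * coeff Q (i - k))"
      unfolding coeff_mult coeff_trunc_quot by (intro sum.cong) auto
    then show ?thesis using False \<open>Suc i < p\<close> 1 by (simp add: coeff_trunc_quot)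
  next
    case True
    have "coeff (trunc_quot p P * Q) i = (\<Sum>k<i. coeff P (Suc k) * coeff Q (i - k))"
      unfolding coeff_mult coeff_trunc_quot using True
      by (cases i) (auto simp: lessThan_Suc_atMost)
    then show ?thesis using 1
      by (simp add: coeff_trunc_quot carry_def True[symmetric] lessThan_Suc_atMost[symmetric])
  qed
qed

lemma trunc_quot_linear [simp]:
  "trunc_quot p (P + Q) = trunc_quot p P + trunc_quot p Q"
  "trunc_quot p ([:c:] * P) = [:c:] * trunc_quot p P"
  "trunc_quot p (smult c P) = smult c (trunc_quot p P)"
  by (auto simp: poly_eq_iff coeff_trunc_quot)

lemma s_quot_add: "s_quot p (a + b) = s_quot p a + s_quot p b"
  and s_quot_smult: "s_quot p (smult [:c:] a) = smult [:c:] (s_quot p a)"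
  by (auto simp: s_quot_def)

lemma s_quot_ideal: "a \<in> M11_ideal p \<Longrightarrow> s_quot p a = 0"
proof -
  assume "a \<in> M11_ideal p"
  then have "trunc_quot p (coeff a 0) = 0" "trunc_quot p (coeff a (Suc 0)) = 0"
    by (auto simp: M11_ideal_iff poly_eq_iff coeff_trunc_quot)
  then show ?thesis by (simp add: s_quot_def)
qed

lemma lin_on_s_quot: "lin_on I f \<Longrightarrow> lin_on (M11_ideal p) (\<lambda>a. f (s_quot p a))"
  using lin_on_0[of I f] by (auto simp: lin_on_def s_quot_add s_quot_smult s_quot_ideal)

lemma carry_linear [simp]:
  "carry p (P + P') Q = carry p P Q + carry p P' Q" "carry p P (Q + Q') = carry p P Q + carry p P Q'"
  "carry p (smult c P) Q = c * carry p P Q" "carry p P (smult c Q) = c * carry p P Q"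
  by (auto simp: carry_def algebra_simps)

lemma carry_ideal:
  assumes "\<forall>i<p. coeff P i = 0" "p > 0" shows "carry p P Q = 0" "carry p Q P = 0"
proof -
  have P: "P = monom 1 p * poly_shift p P"
    using assms by (auto simp: poly_eq_iff coeff_monom_mult coeff_poly_shift)
  have "coeff (P * Q) p = coeff P p * coeff Q 0"
    by (subst P) (simp add: mult.assoc coeff_monom_mult coeff_mult_0 coeff_poly_shift)
  then show "carry p P Q = 0" "carry p Q P = 0"
    using assms by (auto simp: carry_def mult.commute)
qed

definition y_red :: "'k::field st list \<Rightarrow> 'k" where
  "y_red as = (case as of [a] \<Rightarrow> tau a | _ \<Rightarrow> 0)"

definition x_red :: "nat \<Rightarrow> 'k::field st list \<Rightarrow> 'k" where
  "x_red p as = (case as of [a, b] \<Rightarrow> carry p (coeff a 0) (coeff b 0) | _ \<Rightarrow> 0)"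

text \<open>A homotopy between \<open>x\<^sub>1y\<close> and \<open>yx\<^sub>1\<close>, see \<open>cdiff_xy_red\<close>.\<close>

definition xy_red :: "nat \<Rightarrow> 'k::field st list \<Rightarrow> 'k" where
  "xy_red p as = (case as of [a, b] \<Rightarrow>
     carry p (coeff a 0) (coeff b 1) + carry p (coeff a 1) (coeff b 0) | _ \<Rightarrow> 0)"

lemma red_simps [simp]:
  "y_red [] = 0" "y_red [a] = tau a" "y_red (a # b # bs) = 0"
  "x_red p [] = 0" "x_red p [a] = 0" "x_red p [a, b] = carry p (coeff a 0) (coeff b 0)" "x_red p (a # b # c # bs) = 0"
  "xy_red p [] = 0" "xy_red p [a] = 0" "xy_red p (a # b # c # bs) = 0"
  "xy_red p [a, b] = carry p (coeff a 0) (coeff b 1) + carry p (coeff a 1) (coeff b 0)"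
  by (simp_all add: y_red_def x_red_def xy_red_def)

lemma ccup_y_red [simp]: "ccup y_red G [] = 0" "ccup y_red G (a # as) = tau a * G as"
proof -
  have "(\<lambda>bs. y_red (a # bs)) = const_cochain (tau a)"
    by (rule ext) (auto simp: const_cochain_def y_red_def split: list.splits)
  then show "ccup y_red G (a # as) = tau a * G as" by simp
qed simp

lemma ccup_x_red [simp]: "ccup (x_red p) G [] = 0" "ccup (x_red p) G [a] = 0"
  "ccup (x_red p) G (a # b # as) = carry p (coeff a 0) (coeff b 0) * G as"
proof -
  have "(\<lambda>bs. x_red p (a # b # bs)) = const_cochain (carry p (coeff a 0) (coeff b 0))"
    by (rule ext) (auto simp: const_cochain_def x_red_def split: list.splits)
  then show "ccup (x_red p) G (a # b # as) = carry p (coeff a 0) (coeff b 0) * G as" by simp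
qed simp_all

lemma ccup_xy_red [simp]: "ccup (xy_red p) G [] = 0" "ccup (xy_red p) G [a] = 0"
  "ccup (xy_red p) G (a # b # as) = (carry p (coeff a 0) (coeff b 1) + carry p (coeff a 1) (coeff b 0)) * G as"
proof -
  have "(\<lambda>bs. xy_red p (a # b # bs)) =
      const_cochain (carry p (coeff a 0) (coeff b 1) + carry p (coeff a 1) (coeff b 0))"
    by (rule ext) (auto simp: const_cochain_def xy_red_def split: list.splits)
  then show "ccup (xy_red p) G (a # b # as) =
      (carry p (coeff a 0) (coeff b 1) + carry p (coeff a 1) (coeff b 0)) * G as" by simp
qed simp_all

lemma multilin_y_red: assumes "p > 0" shows "multilin (M11_ideal p) y_red"
proof (rule multilin_consI)
  show "lin_on (M11_ideal p) (\<lambda>a. y_red (a # bs))" for bs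
    using lin_on_tau[OF assms] by (cases bs) auto
  show "multilin (M11_ideal p) (\<lambda>bs. y_red (a # bs))" for a
  proof (rule multilin_consI)
    show "lin_on (M11_ideal p) (\<lambda>b. y_red (a # b # bs))" for bs by simp
  qed simp
qed

text \<open>The ideal is left general because \<open>x_red\<close> is needed both on the factor
  k[s]/s^p, from which x_1 is inflated, and on the whole algebra.\<close>

lemma multilin_x_red:
  assumes "p > 0" and I: "\<And>a i. a \<in> I \<Longrightarrow> i < p \<Longrightarrow> coeff (coeff a 0) i = 0"
  shows "multilin I (x_red p)"
proof (rule multilin_consI)
  have c: "carry p (coeff a 0) Q = 0" "carry p Q (coeff a 0) = 0" if "a \<in> I" for a Q
    using carry_ideal[OF _ assms(1), of "coeff a 0"] I[OF that] by auto
  show "lin_on I (\<lambda>a. x_red p (a # bs))" for bs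
  proof (cases bs)
    case (Cons b cs)
    then show ?thesis by (cases cs) (auto intro!: lin_onI simp: c)
  qed auto
  show "multilin I (\<lambda>bs. x_red p (a # bs))" for a
  proof (rule multilin_consI)
    show "lin_on I (\<lambda>b. x_red p (a # b # bs))" for bs
      by (cases bs) (auto intro!: lin_onI simp: c)
    show "multilin I (\<lambda>bs. x_red p (a # b # bs))" for b
      by (rule multilin_consI) simp_all
  qed
qed

lemma multilin_xy_red:
  assumes "p > 0" shows "multilin (M11_ideal p) (xy_red p)"
proof (rule multilin_consI)
  have c: "carry p (coeff a 0) Q = 0" "carry p Q (coeff a 0) = 0"
    "carry p (coeff a (Suc 0)) Q = 0" "carry p Q (coeff a (Suc 0)) = 0" if "a \<in> M11_ideal p" for a :: "'a st" and Q
    using carry_ideal[OF _ assms(1), of "coeff a 0"] carry_ideal[OF _ assms(1), of "coeff a 1"] that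
    by (auto simp: M11_ideal_iff)
  show "lin_on (M11_ideal p) (\<lambda>a. xy_red p (a # bs))" for bs :: "'a st list"
  proof (cases bs)
    case (Cons b cs)
    then show ?thesis by (cases cs) (auto intro!: lin_onI simp: c algebra_simps)
  qed auto
  show "multilin (M11_ideal p) (\<lambda>bs. xy_red p (a # bs))" for a :: "'a st"
  proof (rule multilin_consI)
    show "lin_on (M11_ideal p) (\<lambda>b. xy_red p (a # b # bs))" for bs
      by (cases bs) (auto intro!: lin_onI simp: c algebra_simps)
    show "multilin (M11_ideal p) (\<lambda>bs. xy_red p (a # b # bs))" for b
      by (rule multilin_consI) simp_all
  qed
qed

lemma cdiff_y_red [simp]: "cdiff y_red as = 0"
proof -
  consider "as = []" | a where "as = [a]" | a b where "as = [a, b]" | a b c bs where "as = a # b # c # bs"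
    by (metis list.exhaust)
  then show ?thesis by cases (auto simp: cdiff_def tau_mult)
qed

lemma cdiff_x_red [simp]: "cdiff (x_red p) as = 0"
proof -
  consider "as = []" | a where "as = [a]" | a b where "as = [a, b]" | a b c where "as = [a, b, c]"
    | a b c d bs where "as = a # b # c # d # bs"
    by (metis list.exhaust)
  then show ?thesis
    by cases (auto simp: cdiff_def carry_def coeff_mult_0 counit_def algebra_simps)
qed

text \<open>The sum \<open>x_red\<close> + t \<open>xy_red\<close> is the carry with coefficients in
  the dual numbers k[t]/t^2, a cocycle for the augmentation \<open>counit\<close> + t
  \<open>tau\<close>. The coefficient of t in its cocycle identity is this equation.\<close>

lemma cdiff_xy_red: "cdiff (xy_red p) as = ccup (x_red p) y_red as - ccup y_red (x_red p) as"
proof -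
  consider "as = []" | a where "as = [a]" | a b where "as = [a, b]" | a b c where "as = [a, b, c]"
    | a b c d bs where "as = a # b # c # d # bs"
    by (metis list.exhaust)
  then show ?thesis
    by cases (auto simp: cdiff_def carry_def coeff_mult_0 coeff_mult_1[unfolded One_nat_def] counit_def tau_def algebra_simps)
qed

section \<open>Evaluation on shuffles\<close>

declare ccup.simps(2) [simp del]

text \<open>Let \<open>c\<^sub>i\<^sub>j\<close> be the signed shuffle of the chain \<open>[\<dots>|s\<^bsup>p-1\<^esup>|s|s\<^bsup>p-1\<^esup>|s]\<close> of length \<open>i\<close> with \<open>[t|\<dots>|t]\<close> of length
  \<open>j\<close>. The values with flag \<open>False\<close> and \<open>True\<close> are the sums over \<open>i + j = n\<close> of \<open>\<alpha>\<^bsup>i div 2\<^esup> \<mu>\<^sup>j F(c\<^sub>i\<^sub>j)\<close> with \<open>i\<close>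
  even and odd respectively. Expanding by the first entry of the shuffle gives this recursion.\<close>

fun ev :: "nat \<Rightarrow> ('k::field \<Rightarrow> 'r::comm_ring_1) \<Rightarrow> 'r \<Rightarrow> 'r \<Rightarrow> bool \<Rightarrow> nat \<Rightarrow> ('k st list \<Rightarrow> 'k) \<Rightarrow> 'r" where
  "ev p \<iota> \<alpha> \<mu> False 0 F = \<iota> (F [])"
| "ev p \<iota> \<alpha> \<mu> True 0 F = 0"
| "ev p \<iota> \<alpha> \<mu> False (Suc n) F =
     \<alpha> * ev p \<iota> \<alpha> \<mu> True n (\<lambda>as. F (s_gen ^ (p - 1) # as)) + \<mu> * ev p \<iota> \<alpha> \<mu> False n (\<lambda>as. F (t_gen # as))"
| "ev p \<iota> \<alpha> \<mu> True (Suc n) F =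
     ev p \<iota> \<alpha> \<mu> False n (\<lambda>as. F (s_gen # as)) - \<mu> * ev p \<iota> \<alpha> \<mu> True n (\<lambda>as. F (t_gen # as))"

context
  fixes \<iota> :: "'k::field \<Rightarrow> 'r::comm_ring_1"
  assumes \<iota>: "additive \<iota>"
begin

lemma ev_add: "ev p \<iota> \<alpha> \<mu> b n (\<lambda>as. F as + G as) = ev p \<iota> \<alpha> \<mu> b n F + ev p \<iota> \<alpha> \<mu> b n G"
proof (induction n arbitrary: b F G)
  case 0 then show ?case by (cases b) (simp_all add: additive.add[OF \<iota>])
next
  case (Suc n) then show ?case by (cases b) (simp_all add: algebra_simps)
qed

lemma ev_neg: "ev p \<iota> \<alpha> \<mu> b n (\<lambda>as. - F as) = - ev p \<iota> \<alpha> \<mu> b n F"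
proof (induction n arbitrary: b F)
  case 0 then show ?case by (cases b) (simp_all add: additive.minus[OF \<iota>])
next
  case (Suc n) then show ?case by (cases b) (simp_all add: algebra_simps)
qed

lemma ev_diff: "ev p \<iota> \<alpha> \<mu> b n (\<lambda>as. F as - G as) = ev p \<iota> \<alpha> \<mu> b n F - ev p \<iota> \<alpha> \<mu> b n G"
  using ev_add[of p \<alpha> \<mu> b n F "\<lambda>as. - G as"] by (simp add: ev_neg)

lemma ev_zero [simp]: "ev p \<iota> \<alpha> \<mu> b n (\<lambda>as. 0) = 0"
  using ev_diff[of p \<alpha> \<mu> b n "\<lambda>_. 0" "\<lambda>_. 0"] by simp

lemma ev_cong: "(\<And>as. length as = n \<Longrightarrow> F as = G as) \<Longrightarrow> ev p \<iota> \<alpha> \<mu> b n F = ev p \<iota> \<alpha> \<mu> b n G"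
proof (induction n arbitrary: b F G)
  case 0 then show ?case by (cases b) auto
next
  case (Suc n)
  have "ev p \<iota> \<alpha> \<mu> b n (\<lambda>as. F (x # as)) = ev p \<iota> \<alpha> \<mu> b n (\<lambda>as. G (x # as))" for b x
    using Suc.prems by (intro Suc.IH) auto
  then show ?case by (cases b) auto
qed

lemma ev_eq_0: "(\<And>as. length as = n \<Longrightarrow> F as = 0) \<Longrightarrow> ev p \<iota> \<alpha> \<mu> b n F = 0"
  using ev_cong[of n F "\<lambda>_. 0"] by simp

text \<open>The weighted shuffles are cycles: neighbouring entries multiply either to s^p or t^2,
  which vanish, or to a product of t with a power of s, which occurs in both orders with opposite
  signs.\<close>

lemma ev_tdiff:
  assumes F: "multilin (M11_ideal p) F" and p: "p \<ge> 2"
  shows "ev p \<iota> \<alpha> \<mu> b n (tdiff F) = 0"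
  using F
proof (induction n arbitrary: b F)
  case 0 then show ?case by (cases b) (simp_all add: additive.zero[OF \<iota>])
next
  case (Suc n)
  have pos: "0 < p" using p by simp
  have s0: "(s_gen ^ (p - 1) * s_gen :: 'k st) \<in> M11_ideal p" "(s_gen * s_gen ^ (p - 1) :: 'k st) \<in> M11_ideal p"
    "(t_gen * t_gen :: 'k st) \<in> M11_ideal p"
  proof -
    have e: "s_gen ^ (p - 1) * s_gen = (s_gen ^ p :: 'k st)" "s_gen * s_gen ^ (p - 1) = (s_gen ^ p :: 'k st)"
      using pos by (simp_all add: power_eq_if)
    have m: "(s_gen ^ p :: 'k st) \<in> M11_ideal p" "(t_gen * t_gen :: 'k st) \<in> M11_ideal p"
      by (auto simp: M11_ideal_iff coeff_s_gen_power) (simp add: t_gen_def)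
    show "(s_gen ^ (p - 1) * s_gen :: 'k st) \<in> M11_ideal p" "(s_gen * s_gen ^ (p - 1) :: 'k st) \<in> M11_ideal p"
      "(t_gen * t_gen :: 'k st) \<in> M11_ideal p" using m by (simp_all only: e)
  qed
  have z [simp]: "F (s_gen ^ (p - 1) * s_gen # bs) = 0" "F (s_gen * s_gen ^ (p - 1) # bs) = 0" "F (t_gen * t_gen # bs) = 0" for bs
    using multilin_head[OF Suc.prems, of bs] s0 by (auto simp: lin_on_def)
  \<comment> \<open>The inner differential is removed by the induction hypothesis, so only the face
    that merges the first two entries is left.\<close>
  have ih: "ev p \<iota> \<alpha> \<mu> b n (\<lambda>as. tdiff F (a # as)) = - ev p \<iota> \<alpha> \<mu> b n (absorb a F)" for a b
    using Suc.IH[OF multilin_prepend[OF Suc.prems]] by (simp add: ev_diff ev_neg)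
  show ?case
  proof (cases n)
    case 0
    then show ?thesis using ih p by (cases b) (auto simp: additive.zero[OF \<iota>])
  next
    case (Suc m)
    define G where "G x y = (\<lambda>as. F (x * y # as))" for x y
    have abs: "(\<lambda>as. absorb x F (y # as)) = G x y" for x y by (simp add: G_def)
    have G0: "G (s_gen ^ (p - 1)) s_gen = (\<lambda>_. 0)" "G s_gen (s_gen ^ (p - 1)) = (\<lambda>_. 0)" "G t_gen t_gen = (\<lambda>_. 0)"
      unfolding G_def by (simp_all only: z)
    have G1: "G (s_gen ^ (p - 1)) t_gen = G t_gen (s_gen ^ (p - 1))" "G s_gen t_gen = G t_gen s_gen"
      unfolding G_def by (simp_all only: mult.commute)
    have "ev p \<iota> \<alpha> \<mu> b (Suc n) (tdiff F) =
        (if b then - ev p \<iota> \<alpha> \<mu> False n (absorb s_gen F) + \<mu> * ev p \<iota> \<alpha> \<mu> True n (absorb t_gen F)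
         else - \<alpha> * ev p \<iota> \<alpha> \<mu> True n (absorb (s_gen ^ (p - 1)) F) - \<mu> * ev p \<iota> \<alpha> \<mu> False n (absorb t_gen F))"
      by (cases b) (simp_all only: ev.simps ih if_True if_False, simp_all)
    also have "\<dots> = 0"
      unfolding Suc ev.simps abs G0 G1 ev_zero by (simp add: algebra_simps)
    finally show ?thesis .
  qed
qed

text \<open>All entries of the shuffles have augmentation 0; for s^(p-1) this uses p \<ge>
  2.\<close>

lemma ev_head_counit: assumes "p \<ge> 2" shows "ev p \<iota> \<alpha> \<mu> b n (head_counit F) = 0"
proof (cases n)
  case 0
  then show ?thesis by (cases b) (simp_all add: additive.zero[OF \<iota>])
next
  case (Suc m)
  have [simp]: "(0::'k) ^ (p - Suc 0) = 0" using assms by simp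
  show ?thesis using Suc by (cases b) simp_all
qed

lemma ev_cdiff: "multilin (M11_ideal p) F \<Longrightarrow> p \<ge> 2 \<Longrightarrow> ev p \<iota> \<alpha> \<mu> b n (cdiff F) = 0"
  unfolding cdiff_def[abs_def] by (simp add: ev_add ev_tdiff ev_head_counit)

lemma ev_ccup_y:
  "ev p \<iota> \<alpha> \<mu> b (Suc n) (ccup y_red G) = (if b then - \<mu> else \<mu>) * ev p \<iota> \<alpha> \<mu> b n G"
  by (cases b) simp_all

end

lemma additive_const_poly: "additive (\<lambda>c :: 'k::field. [:c:])"
  by unfold_locales simp

text \<open>Keeping \<mu> as a variable separates the shuffles by their number of entries t. A
  criterion for coboundaries needs all these values, which might cancel after specialising to
  scalars.\<close>

abbreviation ev_poly :: "nat \<Rightarrow> bool \<Rightarrow> nat \<Rightarrow> ('k::field st list \<Rightarrow> 'k) \<Rightarrow> 'k poly" where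
  "ev_poly p b n F \<equiv> ev p (\<lambda>c. [:c:]) 1 [:0, 1:] b n F"

lemma coeff_ev_poly_Suc:
  "coeff (ev_poly p False (Suc n) F) 0 = coeff (ev_poly p True n (\<lambda>as. F (s_gen ^ (p - 1) # as))) 0"
  "coeff (ev_poly p True (Suc n) F) 0 = coeff (ev_poly p False n (\<lambda>as. F (s_gen # as))) 0"
  by (simp_all add: coeff_mult_0)

text \<open>The component of degree n - 1, and zero for n = 0. The shift is chosen so that the
  differential, and multiplication by y, lead to degree n exactly.\<close>

definition low_part :: "nat \<Rightarrow> ('k::field st list \<Rightarrow> 'k) \<Rightarrow> 'k st list \<Rightarrow> 'k" where
  "low_part n F as = (if Suc (length as) = n then F as else 0)"

lemma tdiff_low_part: "tdiff (low_part n F) as = (if length as = n then tdiff F as else 0)"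
proof (induction as arbitrary: n F)
  case (Cons a as)
  have "absorb a (low_part n F) as = (if Suc (length as) = n then absorb a F as else 0)"
    by (cases as) (auto simp: low_part_def)
  moreover have "tdiff (\<lambda>bs. low_part n F (a # bs)) as =
      (if Suc (length as) = n then tdiff (\<lambda>bs. F (a # bs)) as else 0)"
  proof (cases n)
    case 0
    then show ?thesis by (simp add: low_part_def)
  next
    case (Suc m)
    then have "(\<lambda>bs. low_part n F (a # bs)) = low_part m (\<lambda>bs. F (a # bs))"
      by (auto simp: low_part_def)
    then show ?thesis using Cons.IH Suc by simp
  qed
  ultimately show ?case by simp
qed simp

lemma cdiff_low_part: "cdiff (low_part n F) as = (if length as = n then cdiff F as else 0)"
  unfolding cdiff_def by (cases as) (auto simp: tdiff_low_part low_part_def simp del: tdiff.simps(2))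

lemma ccup_y_low_part: "ccup y_red (low_part n F) as = (if length as = n then ccup y_red F as else 0)"
  by (cases as) (auto simp: low_part_def)

lemma multilin_low_part: "multilin I F \<Longrightarrow> multilin I (low_part n F)"
proof -
  assume F: "multilin I F"
  have "lin_on I (\<lambda>a. if c then F (as @ a # bs) else 0)" for as bs c
    using multilinD[OF F] by (cases c) auto
  then show ?thesis by (simp add: multilin_def low_part_def)
qed

context
  fixes p :: nat
  assumes p2: "p \<ge> 2"
begin

lemma M11_decompose:
  assumes "lin_on (M11_ideal p) f"
  shows "f (a :: 'k::field st) = counit a * f 1 + tau a * f t_gen + f (s_gen * s_quot p a)"
proof -
  have "f a = f (smult [:counit a:] 1 + smult [:tau a:] t_gen + s_gen * s_quot p a)"
  proof (rule lin_on_M11_cong[OF assms])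
    fix i assume "i < p"
    show "coeff (coeff a 0) i = coeff (coeff (smult [:counit a:] 1 + smult [:tau a:] t_gen + s_gen * s_quot p a) 0) i"
      using \<open>i < p\<close> by (cases i) (simp_all add: counit_def t_gen_def coeff_trunc_quot)
    show "coeff (coeff a 1) i = coeff (coeff (smult [:counit a:] 1 + smult [:tau a:] t_gen + s_gen * s_quot p a) 1) i"
      using \<open>i < p\<close> by (cases i) (simp_all add: tau_def t_gen_def coeff_trunc_quot)
  qed
  moreover have "f (x + y) = f x + f y" "f (smult [:c:] x) = c * f x" for x y c
    using assms by (auto simp: lin_on_def)
  ultimately show ?thesis by (simp only:)
qed

text \<open>\<open>trunc_quot_mult\<close> is used once for the coefficient of t^0 and twice for
  that of t. The term with \<open>tau a\<close> arises because the constant term of the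
  t-coefficient of a multiplies the quotient of b, yet is not part of the augmentation.\<close>

lemma s_quot_mult:
  assumes "lin_on (M11_ideal p) f"
  shows "counit a * f (s_quot p b) - f (s_quot p (a * b)) + f (s_quot p a * b) =
    carry p (coeff a 0) (coeff b 0) * f (s_gen ^ (p - 1)) +
    (carry p (coeff a 0) (coeff b 1) + carry p (coeff a 1) (coeff b 0)) * f (s_gen ^ (p - 1) * t_gen) -
    tau a * f (t_gen * s_quot p (b :: 'k::field st))"
proof -
  let ?c0 = "carry p (coeff a 0) (coeff b 0)"
  let ?c1 = "carry p (coeff a 0) (coeff b 1) + carry p (coeff a 1) (coeff b 0)"
  let ?L = "smult [:counit a:] (s_quot p b) - s_quot p (a * b) + s_quot p a * b"
  let ?R = "smult [:?c0:] (s_gen ^ (p - 1)) + smult [:?c1:] (s_gen ^ (p - 1) * t_gen) - smult [:tau a:] (t_gen * s_quot p b)"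
  have "f ?L = f ?R"
  proof (rule lin_on_M11_cong[OF assms])
    fix i assume i: "i < p"
    have m: "coeff (monom (1::'k) (p - Suc 0)) i = (if Suc i = p then 1 else 0)" using i by auto
    have r: "coeff (coeff ?R 0) i = (if Suc i = p then ?c0 else 0)"
      "coeff (coeff ?R 1) i = (if Suc i = p then ?c1 else 0) - tau a * coeff (trunc_quot p (coeff b 0)) i"
      by (simp_all add: coeff_s_gen_power coeff_s_gen_power_mult m del: coeff_monom)
         (simp_all add: t_gen_def m del: coeff_monom)
    show "coeff (coeff ?L 0) i = coeff (coeff ?R 0) i"
      using trunc_quot_mult[OF i, of "coeff a 0" "coeff b 0"]
      by (simp only: r) (simp add: counit_def coeff_mult_0)
    show "coeff (coeff ?L 1) i = coeff (coeff ?R 1) i"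
      using trunc_quot_mult[OF i, of "coeff a 0" "coeff b 1"] trunc_quot_mult[OF i, of "coeff a 1" "coeff b 0"]
      by (simp only: r) (simp add: counit_def tau_def coeff_mult_1[unfolded One_nat_def] algebra_simps split: if_splits)
  qed
  then show ?thesis using assms by (simp add: lin_on_minus[OF assms] lin_on_def)
qed

text \<open>Subtracting the coboundary of \<open>s_homotopy F\<close> from a cocycle \<open>F\<close> moves the first factor \<open>s\<close> of the first
  argument to an argument of its own. What is left of the second argument is the failure of \<open>s_quot\<close> to
  be a derivation over the augmentation, computed in \<open>s_quot_mult\<close>.\<close>

definition s_homotopy :: "('k::field st list \<Rightarrow> 'k) \<Rightarrow> 'k st list \<Rightarrow> 'k" where
  "s_homotopy F as = (case as of [] \<Rightarrow> 0 | a # bs \<Rightarrow> - F (s_gen # s_quot p a # bs))"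

lemma multilin_s_homotopy:
  assumes "multilin (M11_ideal p) F" shows "multilin (M11_ideal p) (s_homotopy F)"
proof (rule multilin_consI)
  show "lin_on (M11_ideal p) (\<lambda>a. s_homotopy F (a # bs))" for bs
    using lin_on_s_quot[OF multilin_second[OF assms]] by (simp add: s_homotopy_def lin_on_neg)
  show "multilin (M11_ideal p) (\<lambda>bs. s_homotopy F (a # bs))" for a
    using multilin_prepend[OF multilin_prepend[OF assms]] by (simp add: s_homotopy_def multilin_neg)
qed

lemma cocycle_reduce:
  fixes F :: "'k::field st list \<Rightarrow> 'k"
  assumes F: "multilin (M11_ideal p) F" and z: "\<And>as. cdiff F as = 0"
  shows "F (a # b # bs) - cdiff (s_homotopy F) (a # b # bs) =
    counit a * F (1 # b # bs) + tau a * (F (t_gen # b # bs) - F (s_gen # t_gen * s_quot p b # bs)) +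
    carry p (coeff a 0) (coeff b 0) * F (s_gen # s_gen ^ (p - 1) # bs) +
    (carry p (coeff a 0) (coeff b 1) + carry p (coeff a 1) (coeff b 0)) * F (s_gen # s_gen ^ (p - 1) * t_gen # bs)"
proof -
  \<comment> \<open>The cocycle identity at (s, \<open>s_quot p a\<close>, b, ...). Its head term is
    absent since s has augmentation 0.\<close>
  have 1: "tdiff (\<lambda>cs. F (s_gen # s_quot p a # cs)) (b # bs) =
      F (s_gen * s_quot p a # b # bs) - F (s_gen # s_quot p a * b # bs)"
    using z[of "s_gen # s_quot p a # b # bs"] by (simp add: cdiff_def algebra_simps)
  have 2: "cdiff (s_homotopy F) (a # b # bs) =
      - counit a * F (s_gen # s_quot p b # bs) + F (s_gen # s_quot p (a * b) # bs)
      + tdiff (\<lambda>cs. F (s_gen # s_quot p a # cs)) (b # bs)"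
    by (simp add: cdiff_def s_homotopy_def tdiff_neg del: tdiff.simps(2)) (simp add: s_homotopy_def tdiff_neg)
  show ?thesis
    unfolding 2 1
    using M11_decompose[OF multilin_head[OF F], of a "b # bs"] s_quot_mult[OF multilin_second[OF F, of s_gen bs], of a b]
    by (simp add: algebra_simps)
qed

end

section \<open>Cocycles on which all evaluations vanish\<close>

lemma alt_sign_red [simp]:
  "alt_sign y_red = (\<lambda>as. - y_red as)" "alt_sign (x_red p) = x_red p" "alt_sign (xy_red p) = xy_red p"
  by (auto simp: fun_eq_iff alt_sign_def y_red_def x_red_def xy_red_def split: list.splits)

lemma cdiff_red_fun [simp]: "cdiff y_red = (\<lambda>_. 0)" "cdiff (x_red p) = (\<lambda>_. 0)"
  by (auto simp: fun_eq_iff)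

lemma cdiff_ccup_y: "cdiff (ccup y_red F) as = - ccup y_red (cdiff F) as"
  by (simp add: cdiff_ccup ccup_neg_left)

lemma cdiff_ccup_x: "cdiff (ccup (x_red p) F) as = ccup (x_red p) (cdiff F) as"
  by (simp add: cdiff_ccup)

lemma cdiff_ccup_xy:
  "cdiff (ccup (xy_red p) F) as =
     ccup (x_red p) (ccup y_red F) as - ccup y_red (ccup (x_red p) F) as + ccup (xy_red p) (cdiff F) as"
proof -
  have "cdiff (xy_red p) = (\<lambda>as. ccup (x_red p) y_red as - ccup y_red (x_red p) as)"
    by (auto simp: fun_eq_iff cdiff_xy_red)
  then have "ccup (cdiff (xy_red p)) F as = ccup (\<lambda>as. ccup (x_red p) y_red as - ccup y_red (x_red p) as) F as"
    by metis
  then show ?thesis by (simp add: cdiff_ccup ccup_diff_left ccup_assoc)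
qed

lemma cdiff_head_counit: "cdiff (head_counit F) (a # as) = - counit a * tdiff F as"
  unfolding cdiff_def[of "head_counit F"] head_counit_cong by (simp add: cdiff_def algebra_simps)

lemma carry_s_gen: assumes "p \<ge> 2"
  shows "carry p (coeff (s_gen ^ (p - 1)) 0) (coeff s_gen 0) = (1 :: 'k::field)"
    "carry p (coeff s_gen 0) (coeff (s_gen ^ (p - 1)) 0) = (1 :: 'k::field)"
proof -
  have s: "coeff s_gen 0 = (monom 1 1 :: 'k poly)" by (simp add: s_gen_def monom_altdef)
  have "monom 1 (p - 1) * monom 1 1 = (monom 1 p :: 'k poly)" "monom 1 1 * monom 1 (p - 1) = (monom 1 p :: 'k poly)"
    using assms by (simp_all add: mult_monom)
  then show "carry p (coeff (s_gen ^ (p - 1)) 0) (coeff s_gen 0) = (1 :: 'k)"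
    "carry p (coeff s_gen 0) (coeff (s_gen ^ (p - 1)) 0) = (1 :: 'k)"
    using assms by (auto simp: carry_def s coeff_s_gen_power)
qed

lemma coeff_s_gen_1 [simp]: "coeff s_gen (Suc 0) = 0" "coeff (s_gen ^ n) (Suc 0) = 0"
  by (simp_all add: s_gen_def) (use coeff_s_gen_power[of n "Suc 0"] in \<open>simp add: s_gen_def\<close>)

lemma carry_0 [simp]: "carry p 0 Q = 0" "carry p P 0 = 0"
  by (simp_all add: carry_def)

text \<open>Constant coefficients see only the chain of alternating s^(p-1) and s. There y vanishes,
  the carry of the first two entries is 1, and \<open>xy_red\<close> vanishes because neither entry
  has a t-part.\<close>

lemma coeff_ev_poly_ccup:
  assumes "p \<ge> 2"
  shows "coeff (ev_poly p b n (ccup y_red (G :: 'k::field st list \<Rightarrow> 'k))) 0 = 0"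
    "coeff (ev_poly p b (Suc (Suc m)) (ccup (x_red p) G)) 0 = coeff (ev_poly p b m G) 0"
    "coeff (ev_poly p b (Suc (Suc m)) (ccup (xy_red p) G)) 0 = 0"
proof -
  interpret additive "\<lambda>c :: 'k. [:c:]" by (rule additive_const_poly)
  show "coeff (ev_poly p b n (ccup y_red G)) 0 = 0"
    by (cases n; cases b) (simp_all only: coeff_ev_poly_Suc, simp_all add: ev_zero[OF additive_const_poly])
  show "coeff (ev_poly p b (Suc (Suc m)) (ccup (x_red p) G)) 0 = coeff (ev_poly p b m G) 0"
    by (cases b) (simp_all only: coeff_ev_poly_Suc ccup_x_red carry_s_gen[OF assms] mult_1)
  show "coeff (ev_poly p b (Suc (Suc m)) (ccup (xy_red p) G)) 0 = 0"
    by (cases b) (simp_all only: coeff_ev_poly_Suc ccup_xy_red coeff_s_gen_1 carry_0 One_nat_def,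
       simp_all add: ev_zero[OF additive_const_poly])
qed

context
  fixes p :: nat
  assumes p2: "p \<ge> 2"
begin

text \<open>In the cocycle identity at (s, x, ...) the product s x is zero for both x = s^(p-1) and
  x = s^(p-1) t, so only the product of x with the next argument c matters. Modulo the ideal,
  s^(p-1) c is \<open>counit c\<close> times s^(p-1) plus \<open>tau c\<close> times s^(p-1) t; the
  second summand is what keeps the first slice from being a cocycle.\<close>

lemma cocycle_second:
  fixes F :: "'k::field st list \<Rightarrow> 'k"
  assumes F: "multilin (M11_ideal p) F" and z: "\<And>as. cdiff F as = 0"
  shows "cdiff (\<lambda>bs. F (s_gen # s_gen ^ (p - 1) # bs)) as =
      - ccup y_red (\<lambda>bs. F (s_gen # s_gen ^ (p - 1) * t_gen # bs)) as"
    and "cdiff (\<lambda>bs. F (s_gen # s_gen ^ (p - 1) * t_gen # bs)) as = 0"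
proof -
  have sp: "s_gen * s_gen ^ (p - 1) = (s_gen ^ p :: 'k st)" using p2 by (simp add: power_eq_if)
  have van: "F (as @ s_gen ^ p * x # bs) = 0" for as bs x
  proof -
    have "s_gen ^ p * x = s_gen ^ p * x + t_gen ^ 2 * 0" by simp
    then have "s_gen ^ p * x \<in> M11_ideal p" unfolding M11_ideal_def by blast
    then show ?thesis using multilinD[OF F] by (simp add: lin_on_def)
  qed
  have 1: "tdiff (\<lambda>cs. F (s_gen # x # cs)) cs = - absorb x (\<lambda>bs. F (s_gen # bs)) cs"
    if "\<And>bs. F (s_gen * x # bs) = 0" for x cs
    using z[of "s_gen # x # cs"] that by (simp add: cdiff_def algebra_simps eq_neg_iff_add_eq_0)
  have v1: "F (s_gen * s_gen ^ (p - 1) # bs) = 0" "F (s_gen * (s_gen ^ (p - 1) * t_gen) # bs) = 0" for bs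
    using van[of "[]" 1] van[of "[]" t_gen] by (simp_all only: sp mult_1_right append_Nil mult.assoc[symmetric])
  have lin: "lin_on (M11_ideal p) (\<lambda>a. F (s_gen # a # bs))" for bs by (rule multilin_second[OF F])
  have m: "coeff (monom (1::'k) (p - Suc 0) * P) i = (if Suc i = p then coeff P 0 else 0)" if "i < p" for i P
    using that by (auto simp: coeff_monom_mult)
  have e1: "F (s_gen # s_gen ^ (p - 1) * c # bs) =
      counit c * F (s_gen # s_gen ^ (p - 1) # bs) + tau c * F (s_gen # s_gen ^ (p - 1) * t_gen # bs)" for c bs
  proof -
    have "F (s_gen # s_gen ^ (p - 1) * c # bs) =
        F (s_gen # (smult [:counit c:] (s_gen ^ (p - 1)) + smult [:tau c:] (s_gen ^ (p - 1) * t_gen)) # bs)"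
      using p2
      by (intro lin_on_M11_cong[OF lin])
         (simp_all add: coeff_s_gen_power_mult coeff_s_gen_power m counit_def tau_def del: coeff_monom,
          auto simp add: t_gen_def counit_def tau_def)
    then show ?thesis using lin by (simp add: lin_on_def)
  qed
  have e2: "F (s_gen # s_gen ^ (p - 1) * t_gen * c # bs) =
      counit c * F (s_gen # s_gen ^ (p - 1) * t_gen # bs)" for c bs
  proof -
    have "F (s_gen # s_gen ^ (p - 1) * t_gen * c # bs) =
        F (s_gen # smult [:counit c:] (s_gen ^ (p - 1) * t_gen) # bs)"
      by (intro lin_on_M11_cong[OF lin])
         (simp_all add: coeff_s_gen_power_mult mult.assoc m counit_def del: coeff_monom, auto simp add: t_gen_def)
    then show ?thesis using lin by (simp add: lin_on_def)
  qed
  show "cdiff (\<lambda>bs. F (s_gen # s_gen ^ (p - 1) # bs)) as =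
      - ccup y_red (\<lambda>bs. F (s_gen # s_gen ^ (p - 1) * t_gen # bs)) as"
  proof (cases as)
    case (Cons c cs)
    have "absorb (s_gen ^ (p - 1)) (\<lambda>bs. F (s_gen # bs)) as =
        counit c * F (s_gen # s_gen ^ (p - 1) # cs) + tau c * F (s_gen # s_gen ^ (p - 1) * t_gen # cs)"
      unfolding Cons absorb.simps by (rule e1)
    then show ?thesis unfolding cdiff_def 1[OF v1(1)] by (simp add: Cons)
  qed simp
  show "cdiff (\<lambda>bs. F (s_gen # s_gen ^ (p - 1) * t_gen # bs)) as = 0"
  proof (cases as)
    case (Cons c cs)
    have "absorb (s_gen ^ (p - 1) * t_gen) (\<lambda>bs. F (s_gen # bs)) as =
        counit c * F (s_gen # s_gen ^ (p - 1) * t_gen # cs)"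
      unfolding Cons absorb.simps by (rule e2)
    then show ?thesis unfolding cdiff_def 1[OF v1(2)] by (simp add: Cons)
  qed simp
qed

text \<open>The two statements are proved by a simultaneous induction on the degree: the second one in degree \<open>n\<close>
  uses both in degree \<open>n - 2\<close>, and the first one in degree \<open>n\<close> follows from the second one and from
  degree \<open>n - 1\<close>. The coefficients of the polynomial \<open>ev_poly p b n F\<close> are the individual \<open>F(c\<^sub>i\<^sub>j)\<close>.\<close>

lemma cocycle_vanishing:
  fixes F :: "'k::field st list \<Rightarrow> 'k"
  assumes "multilin (M11_ideal p) F" "\<And>as. F as \<noteq> 0 \<Longrightarrow> length as = n" "\<And>as. cdiff F as = 0"
  shows "((\<forall>b. ev_poly p b n F = 0) \<longrightarrow>
        (\<exists>H. multilin (M11_ideal p) H \<and> (\<forall>as. H as \<noteq> 0 \<longrightarrow> Suc (length as) = n) \<and> (\<forall>as. F as = cdiff H as))) \<and>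
    ((\<forall>b. coeff (ev_poly p b n F) 0 = 0) \<longrightarrow>
        (\<exists>G H. multilin (M11_ideal p) G \<and> (\<forall>as. G as \<noteq> 0 \<longrightarrow> Suc (length as) = n) \<and> (\<forall>as. cdiff G as = 0) \<and>
          multilin (M11_ideal p) H \<and> (\<forall>as. H as \<noteq> 0 \<longrightarrow> Suc (length as) = n) \<and>
          (\<forall>as. F as = ccup y_red G as + cdiff H as)))"
  using assms
proof (induction n arbitrary: F rule: less_induct)
  case (less n)
  let ?I = "M11_ideal p :: 'k st set"
  have aug_M11: "aug_ideal ?I" using p2 by (intro aug_ideal_M11) simp
  have p_pos: "p > 0" using p2 by simp
  note add = additive_const_poly
  note F = less.prems(1) and deg = less.prems(2) and z = less.prems(3)
  have 2: "\<exists>G H. multilin ?I G \<and> (\<forall>as. cdiff G as = 0) \<and> multilin ?I H \<and> (\<forall>as. F as = ccup y_red G as + cdiff H as)"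
    if ev0: "\<And>b. coeff (ev_poly p b n F) 0 = 0"
  proof -
    consider "n = 0" | "n = 1" | m where "n = Suc (Suc m)" by (metis One_nat_def not0_implies_Suc)
    then show ?thesis
    proof cases
      case 1
      then have "F as = 0" for as using ev0[of False] deg[of as] by (cases as) auto
      then show ?thesis by (intro exI[of _ "\<lambda>_. 0"]) auto
    next
      case 2
      \<comment> \<open>In degree 1 a cocycle is a derivation over the augmentation, hence a
        combination of \<lambda>_1 and y. The value with flag \<open>True\<close> removes
        \<lambda>_1.\<close>
      have F1: "F [s_gen] = 0" using ev0[of True] 2 by simp
      have c: "F [a * b] = counit a * F [b] + counit b * F [a]" for a b
        using z[of "[a, b]"] by (simp add: cdiff_def algebra_simps)
      have "F [1] = 0" using c[of 1 1] by (simp only: mult_1 counit_1) (metis add_cancel_right_right)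
      then have "F [a] = tau a * F [t_gen]" for a
        using M11_decompose[OF p2 multilin_head[OF F], of a "[]"] c[of s_gen] F1 by simp
      then obtain e where Fa: "\<And>a. F [a] = tau a * e" by blast
      have Fe: "F as = ccup y_red (const_cochain e) as + cdiff (\<lambda>_. 0) as" for as
      proof (cases as)
        case Nil
        then show ?thesis using deg[of "[]"] 2 by auto
      next
        case (Cons a bs)
        then show ?thesis using deg[of as] 2 Fa[of a] by (cases bs) (auto simp: const_cochain_def)
      qed
      have "multilin ?I (const_cochain e)" "\<forall>as. cdiff (const_cochain e) as = 0"
        using const_cochain_cocyc[of e ?I] unfolding cocyc_def cochains_def by blast+
      then show ?thesis using Fe multilin_zero(1)[of ?I] by blast
    next
      case (3 m)
      \<comment> \<open>Cochains are not normalized, so values at a leading 1 have to be carried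
        along. They turn out to be a coboundary at the end.\<close>
      define \<phi> where "\<phi> = (\<lambda>as. F (1 # as))"
      define g where "g as = (case as of [] \<Rightarrow> 0 | b # bs \<Rightarrow> F (t_gen # b # bs) - F (s_gen # t_gen * s_quot p b # bs))" for as
      define v where "v = (\<lambda>bs. F (s_gen # s_gen ^ (p - 1) # bs))"
      define u where "u = (\<lambda>bs. F (s_gen # s_gen ^ (p - 1) * t_gen # bs))"
      have ml: "multilin ?I \<phi>" "multilin ?I v" "multilin ?I u"
        unfolding \<phi>_def v_def u_def by (intro multilin_prepend F)+
      have mg: "multilin ?I g"
      proof (rule multilin_consI)
        fix bs
        have "lin_on ?I (\<lambda>a. F (s_gen # t_gen * s_quot p a # bs))"
          by (rule lin_on_s_quot[OF lin_on_mult_left[OF aug_M11 multilin_second[OF F]]])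
        then show "lin_on ?I (\<lambda>a. g (a # bs))"
          using multilin_second[OF F] by (simp add: g_def lin_on_diff)
      next
        show "multilin ?I (\<lambda>bs. g (a # bs))" for a
          using multilin_prepend[OF multilin_prepend[OF F]] by (simp add: g_def multilin_diff)
      qed
      have mh: "multilin ?I (s_homotopy p F)" by (rule multilin_s_homotopy[OF p2 F])
      have dv: "cdiff v as = - ccup y_red u as" and du: "cdiff u as = 0" for as
        unfolding v_def u_def by (rule cocycle_second[OF F z])+
      have W: "F as = cdiff (s_homotopy p F) as + head_counit \<phi> as + ccup y_red g as + ccup (x_red p) v as + ccup (xy_red p) u as" for as
      proof -
        consider "as = []" | a where "as = [a]" | a b bs where "as = a # b # bs" by (metis list.exhaust)
        then show ?thesis
        proof cases
          case 1
          then show ?thesis using deg[of "[]"] 3 by auto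
        next
          case (2 a)
          have "F [a] = 0" "F [1] = 0" using deg[of "[a]"] deg[of "[1]"] 3 by auto
          then show ?thesis using 2 by (simp add: cdiff_def s_homotopy_def[OF p2] \<phi>_def g_def)
        next
          case c3: (3 a b bs)
          show ?thesis
            using cocycle_reduce[OF p2 F z, of a b bs] unfolding c3
            by (simp add: \<phi>_def g_def v_def u_def algebra_simps)
        qed
      qed
      \<comment> \<open>The product y u is minus the coboundary of v, so its evaluations vanish.
        Multiplication by y multiplies evaluations by the variable up to sign, which is injective on
        polynomials.\<close>
      have "ev_poly p b m u = 0" for b
      proof -
        have "ccup y_red u = (\<lambda>as. - cdiff v as)" by (auto simp: dv fun_eq_iff)
        then have "ev_poly p b (Suc m) (ccup y_red u) = 0"
          using ev_cdiff[OF add ml(2) p2] by (simp only: ev_neg[OF add] minus_zero)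
        then show ?thesis unfolding ev_ccup_y[OF add] by (auto split: if_splits)
      qed
      moreover have "length as = m" if "u as \<noteq> 0" for as using deg[of "s_gen # _ # as"] that 3 by (auto simp: u_def)
      ultimately obtain w where w: "multilin ?I w" "\<And>as. w as \<noteq> 0 \<Longrightarrow> Suc (length as) = m" "\<And>as. u as = cdiff w as"
        using less.IH[of m u] 3 ml(3) du by auto
      \<comment> \<open>With u the coboundary of w, subtracting y w makes v a cocycle. The constant
        coefficients of the evaluations do not change, as they vanish on multiples of y.\<close>
      define v' where "v' = (\<lambda>as. v as - ccup y_red w as)"
      have mv': "multilin ?I v'" unfolding v'_def
        by (intro multilin_diff ml multilin_ccup multilin_y_red p_pos w)
      have u_fun: "u = cdiff w" using w(3) by auto
      have dv': "cdiff v' as = 0" for as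
        by (simp add: v'_def cdiff_diff dv cdiff_ccup_y u_fun)
      have degv': "length as = m" if "v' as \<noteq> 0" for as
      proof -
        have "v as \<noteq> 0 \<or> ccup y_red w as \<noteq> 0" using that by (auto simp: v'_def)
        then show ?thesis
          using deg[of "s_gen # _ # as"] 3 w(2) by (cases as) (auto simp: v_def)
      qed
      have "coeff (ev_poly p b m v') 0 = 0" for b
      proof -
        have "F = (\<lambda>as. cdiff (s_homotopy p F) as + head_counit \<phi> as + ccup y_red g as + ccup (x_red p) v as + ccup (xy_red p) u as)"
          using W by auto
        then have "ev_poly p b n F = ev_poly p b n (\<lambda>as. cdiff (s_homotopy p F) as + head_counit \<phi> as + ccup y_red g as + ccup (x_red p) v as + ccup (xy_red p) u as)"
          by metis
        then have "coeff (ev_poly p b m v) 0 = coeff (ev_poly p b n F) 0"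
          by (simp add: ev_add[OF add] ev_cdiff[OF add mh p2] ev_head_counit[OF add p2] 3 coeff_ev_poly_ccup[OF p2] del: ev.simps)
        then show ?thesis
          using ev0[of b] by (simp add: v'_def ev_diff[OF add] coeff_ev_poly_ccup[OF p2])
      qed
      then obtain g' w' where g': "multilin ?I g'" "\<And>as. cdiff g' as = 0" "multilin ?I w'"
          "\<And>as. v' as = ccup y_red g' as + cdiff w' as"
        using less.IH[of m v'] 3 mv' dv' degv' by auto
      have v_fun: "v = (\<lambda>as. ccup y_red g' as + cdiff w' as + ccup y_red w as)"
        using g'(4) by (auto simp: v'_def fun_eq_iff algebra_simps)
      \<comment> \<open>In x_1 y w and x_1 y g' the factor y is moved to the front by
        \<open>cdiff_ccup_xy\<close>. The swapped products go to G, the homotopies to H; the swap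
        for w also consumes the term \<open>ccup (xy_red p) u\<close>.\<close>
      define G where "G = (\<lambda>as. g as + ccup (x_red p) w as + ccup (x_red p) g' as)"
      define H where "H = (\<lambda>as. s_homotopy p F as + ccup (xy_red p) w as + ccup (x_red p) w' as + ccup (xy_red p) g' as)"
      have mx: "multilin ?I (x_red p)" using p_pos by (intro multilin_x_red) (auto simp: M11_ideal_iff)
      have mG: "multilin ?I G" unfolding G_def
        by (intro multilin_add mg multilin_ccup mx w g')
      have mH: "multilin ?I H" unfolding H_def
        by (intro multilin_add mh multilin_ccup mx multilin_xy_red p_pos w g')
      have g'_fun: "cdiff g' = (\<lambda>_. 0)" using g'(2) by auto
      have FG: "F as = cdiff H as + head_counit \<phi> as + ccup y_red G as" for as
        unfolding W[of as] H_def G_def v_fun u_fun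
        by (simp add: cdiff_add cdiff_ccup_xy cdiff_ccup_x ccup_add_right g'_fun algebra_simps)
      have dFG: "cdiff (head_counit \<phi>) as = ccup y_red (cdiff G) as" for as
      proof -
        have "F = (\<lambda>as. cdiff H as + head_counit \<phi> as + ccup y_red G as)" using FG by auto
        then have "cdiff F as = cdiff (\<lambda>as. cdiff H as + head_counit \<phi> as + ccup y_red G as) as" by metis
        then show ?thesis using z[of as] by (simp add: cdiff_add cdiff_cdiff cdiff_ccup_y)
      qed
      \<comment> \<open>A leading t has augmentation 0 and isolates the differential of G; a leading
        1 has no t-coefficient and then isolates that of \<phi>.\<close>
      have dG: "cdiff G as = 0" for as using dFG[of "t_gen # as"] by (simp add: cdiff_head_counit)
      then have "tdiff \<phi> as = 0" for as using dFG[of "1 # as"] by (simp add: cdiff_head_counit)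
      then have "head_counit \<phi> as = cdiff \<phi> as" for as by (simp add: cdiff_def)
      then have "F as = ccup y_red G as + cdiff (\<lambda>as. H as + \<phi> as) as" for as
        using FG[of as] by (simp add: cdiff_add)
      then show ?thesis using mG dG multilin_add[OF mH ml(1)] by blast
    qed
  qed
  have 3: "\<exists>G H. multilin ?I G \<and> (\<forall>as. G as \<noteq> 0 \<longrightarrow> Suc (length as) = n) \<and> (\<forall>as. cdiff G as = 0) \<and>
          multilin ?I H \<and> (\<forall>as. H as \<noteq> 0 \<longrightarrow> Suc (length as) = n) \<and> (\<forall>as. F as = ccup y_red G as + cdiff H as)"
    if e0: "\<And>b. coeff (ev_poly p b n F) 0 = 0"
  proof -
    obtain G H where GH: "multilin ?I G" "\<And>as. cdiff G as = 0" "multilin ?I H" "\<And>as. F as = ccup y_red G as + cdiff H as"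
      using 2[OF e0] by auto
    have "F as = ccup y_red (low_part n G) as + cdiff (low_part n H) as" for as
      using GH(4)[of as] deg[of as] by (auto simp: ccup_y_low_part cdiff_low_part)
    then show ?thesis
      using GH by (intro exI[of _ "low_part n G"] exI[of _ "low_part n H"])
        (auto simp: multilin_low_part cdiff_low_part low_part_def[of n _ "_ :: 'k st list"] split: if_splits)
  qed
  moreover have "\<exists>H. multilin ?I H \<and> (\<forall>as. H as \<noteq> 0 \<longrightarrow> Suc (length as) = n) \<and> (\<forall>as. F as = cdiff H as)"
    if ev0: "\<And>b. ev_poly p b n F = 0"
  proof -
    obtain G H where GH: "multilin ?I G" "\<And>as. G as \<noteq> 0 \<Longrightarrow> Suc (length as) = n" "\<And>as. cdiff G as = 0"
      "multilin ?I H" "\<And>as. F as = ccup y_red G as + cdiff H as"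
      using 3 ev0 by auto
    \<comment> \<open>Injectivity of multiplication by y on evaluations reduces the criterion for y
      G to that for G, one degree lower. A primitive K of G then gives the primitive -y K of y
      G.\<close>
    have "\<exists>K. multilin ?I K \<and> (\<forall>as. G as = cdiff K as)"
    proof (cases n)
      case 0
      then show ?thesis using GH(2) by (intro exI[of _ "\<lambda>_. 0"]) auto
    next
      case (Suc m)
      have "F = (\<lambda>as. ccup y_red G as + cdiff H as)" using GH(5) by auto
      then have "ev_poly p b n (\<lambda>as. ccup y_red G as + cdiff H as) = 0" for b using ev0 by metis
      then have yG: "ev_poly p b n (ccup y_red G) = 0" for b
        by (simp add: ev_add[OF add] ev_cdiff[OF add GH(4) p2])
      have "ev_poly p b m G = 0" for b
        using yG[of b] unfolding Suc ev_ccup_y[OF add] by (auto split: if_splits)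
      then show ?thesis using less.IH[of m G] Suc GH by auto
    qed
    then obtain K where K: "multilin ?I K" "G = cdiff K" by auto
    have "F as = cdiff (low_part n (\<lambda>as. H as - ccup y_red K as)) as" for as
      using GH(5)[of as] deg[of as] by (auto simp: cdiff_low_part cdiff_diff cdiff_ccup_y K)
    moreover have "multilin ?I (low_part n (\<lambda>as. H as - ccup y_red K as))"
      by (intro multilin_low_part multilin_diff GH multilin_ccup multilin_y_red p_pos K)
    ultimately show ?thesis
      by (intro exI[of _ "low_part n (\<lambda>as. H as - ccup y_red K as)"]) (auto simp: low_part_def split: if_splits)
  qed
  ultimately show ?case by blast
qed

end

section \<open>Generation by \<open>y\<close> and \<open>x\<^sub>1\<close>\<close>

definition t_flip :: "'k::field st \<Rightarrow> 'k st" where "t_flip a = pcompose a [:0, - 1:]"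

lemma coeff_t_flip: "coeff (t_flip a) j = (- 1) ^ j * coeff a j"
  by (simp add: t_flip_def coeff_pcompose_linear)

lemma coeff_t_flip_01 [simp]: "coeff (t_flip a) 0 = coeff a 0" "coeff (t_flip a) (Suc 0) = - coeff a (Suc 0)"
  by (simp_all add: coeff_t_flip)

lemma t_flip_add: "t_flip (a + b) = t_flip a + t_flip b"
  and t_flip_mult: "t_flip (a * b) = t_flip a * t_flip b"
  and t_flip_smult: "t_flip (smult c a) = smult c (t_flip a)"
  by (simp_all add: t_flip_def pcompose_add pcompose_mult pcompose_smult)

lemma counit_t_flip [simp]: "counit (t_flip a) = counit a" and tau_t_flip [simp]: "tau (t_flip a) = - tau a"
  by (simp_all add: counit_def tau_def)

lemma of_nat_bit_eq_0_iff: "(of_nat n :: bit) = 0 \<longleftrightarrow> even n"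
proof (induction n)
  case (Suc n)
  then show ?case by (cases "of_nat n :: bit") auto
qed simp

lemma of_nat_bit_eq_1_iff: "(of_nat n :: bit) = 1 \<longleftrightarrow> odd n"
  using of_nat_bit_eq_0_iff[of n] by (cases "of_nat n :: bit") auto

lemma t_flip_st_part: assumes "a \<in> st_part i" shows "t_flip a = (if i = 0 then a else - a)"
proof (rule poly_eqI)
  fix j
  show "coeff (t_flip a) j = coeff (if i = 0 then a else - a) j"
  proof (cases "coeff a j = 0")
    case False
    then have "of_nat j = i" using st_partD[OF assms] by blast
    then show ?thesis
      by (cases i) (auto simp: coeff_t_flip of_nat_bit_eq_0_iff of_nat_bit_eq_1_iff)
  qed (simp add: coeff_t_flip)
qed

lemma even_odd_split:
  fixes a :: "'k::field st"
  assumes "(2 :: 'k) \<noteq> 0"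
  obtains b c where "b \<in> st_part 0" "c \<in> st_part 1" "a = b + c"
proof
  define b where "b = smult [:1/2:] (a + t_flip a)"
  define c where "c = smult [:1/2:] (a + smult (-1) (t_flip a))"
  have e: "coeff b j = (if even j then coeff a j else 0)" "coeff c j = (if odd j then coeff a j else 0)" for j
  proof -
    have "(1/2) * (x + x) = x" for x :: 'k using assms by (simp flip: mult_2)
    then have "smult (1/2) (q + q) = q" for q :: "'k poly"
      by (intro poly_eqI) (simp only: coeff_smult coeff_add)
    then show "coeff b j = (if even j then coeff a j else 0)" "coeff c j = (if odd j then coeff a j else 0)"
      by (auto simp: b_def c_def coeff_t_flip)
  qed
  show "b \<in> st_part 0" "c \<in> st_part 1"
    by (auto simp: st_part_def e of_nat_bit_eq_0_iff of_nat_bit_eq_1_iff)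
  show "a = b + c" by (rule poly_eqI) (simp add: e)
qed

text \<open>Parity is ignored in the vanishing criterion. It is restored by averaging over the automorphism
  \<open>t \<mapsto> -t\<close>, which is possible as the characteristic is not 2.\<close>

definition avg :: "'k::field \<Rightarrow> ('k st list \<Rightarrow> 'k) \<Rightarrow> 'k st list \<Rightarrow> 'k" where
  "avg e F as = (F as + e * F (map t_flip as)) / 2"

text \<open>The sign (-1)^(n+q) by which \<open>t_flip\<close> acts on the degree n component of a
  cochain of type q.\<close>

definition parity_sign :: "bit \<Rightarrow> nat \<Rightarrow> 'k::field" where
  "parity_sign q n = (if of_nat n + q = 0 then 1 else - 1)"

lemma parity_sign_Suc: "parity_sign q (Suc n) = - parity_sign q n"
  and parity_sign_add_1: "parity_sign (q + 1) n = - parity_sign q n" "parity_sign (1 + q) n = - parity_sign q n"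
proof -
  have "(1 + x = 0) \<longleftrightarrow> x \<noteq> 0" for x :: bit by (cases x) auto
  then show "parity_sign q (Suc n) = - parity_sign q n" "parity_sign (q + 1) n = - parity_sign q n"
    "parity_sign (1 + q) n = - parity_sign q n"
    by (auto simp: parity_sign_def ac_simps)
qed

lemma parity_sign_1: "parity_sign 1 n = - parity_sign 0 n"
  using parity_sign_add_1(1)[of 0 n] by simp

lemma absorb_flip: "absorb a (\<lambda>as. F (map t_flip as)) as = absorb (t_flip a) F (map t_flip as)"
  by (cases as) (auto simp: t_flip_mult)

lemma tdiff_flip: "tdiff (\<lambda>as. F (map t_flip as)) as = tdiff F (map t_flip as)"
proof (induction as arbitrary: F)
  case (Cons a as)
  show ?case using Cons.IH[of "\<lambda>bs. F (t_flip a # bs)"] by (simp add: absorb_flip)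
qed simp

lemma cdiff_flip: "cdiff (\<lambda>as. F (map t_flip as)) as = cdiff F (map t_flip as)"
  by (cases as) (simp_all add: cdiff_def tdiff_flip del: tdiff.simps(2))

lemma cdiff_avg: "cdiff (avg e F) as = avg e (cdiff F) as"
proof -
  have "avg e F = (\<lambda>as. (1/2) * (F as + e * F (map t_flip as)))" by (auto simp: avg_def)
  then have "cdiff (avg e F) as = cdiff (\<lambda>as. (1/2) * (F as + e * F (map t_flip as))) as" by metis
  also have "\<dots> = (1/2) * (cdiff F as + e * cdiff F (map t_flip as))"
    by (simp only: cdiff_scale cdiff_add cdiff_flip)
  finally show ?thesis by (simp add: avg_def)
qed

lemma ccup_y_avg: "avg e (ccup y_red G) as = ccup y_red (avg (- e) G) as"
  by (cases as) (simp_all add: avg_def field_simps)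

lemma M11_t_flip: "a \<in> M11_ideal p \<Longrightarrow> t_flip a \<in> M11_ideal p"
  by (simp add: M11_ideal_iff)

lemma multilin_avg:
  assumes "multilin (M11_ideal p) F" shows "multilin (M11_ideal p) (avg e F)"
proof -
  have "lin_on (M11_ideal p) (\<lambda>a. F (map t_flip as @ t_flip a # map t_flip bs))" for as bs
    using multilinD[OF assms, of "map t_flip as" "map t_flip bs"] M11_t_flip[of _ p]
    unfolding lin_on_def t_flip_add t_flip_smult by blast
  then have "multilin (M11_ideal p) (\<lambda>as. F (map t_flip as))" by (simp add: multilin_def)
  then have "multilin (M11_ideal p) (\<lambda>as. (1/2) * (F as + e * F (map t_flip as)))"
    by (intro multilin_scale multilin_add assms)
  then show ?thesis by (simp add: avg_def[abs_def])
qed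

lemma flip_list:
  assumes "multilin I F" "list_all2 (\<lambda>a i. a \<in> st_part i) as is"
  shows "F (map t_flip as) = (if sum_list is = 0 then F as else - F as)"
  using assms(2,1)
proof (induction as "is" arbitrary: F rule: list_all2_induct)
  case (Cons a as i "is")
  have "F (- x # bs) = - F (x # bs)" for x bs
    using lin_on_minus[OF multilin_head[OF Cons.prems], of 0 x bs] lin_on_0[OF multilin_head[OF Cons.prems]] by simp
  moreover have "(1 + x = 0) \<longleftrightarrow> x \<noteq> 0" for x :: bit by (cases x) auto
  ultimately show ?case
    using Cons.IH[OF multilin_prepend[OF Cons.prems]] t_flip_st_part[OF Cons.hyps(1)]
    by (cases i) (auto split: if_splits)
qed simp

text \<open>Averaging with a sign projects onto an eigenspace of the flip. By
  \<open>flip_list\<close> the flip acts on values at homogeneous arguments by their total parity,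
  so the wrong parities cancel.\<close>

lemma has_parity_avg:
  fixes F :: "'k::field st list \<Rightarrow> 'k"
  assumes "(2 :: 'k) \<noteq> 0" "multilin I F" "\<And>as. F as \<noteq> 0 \<Longrightarrow> length as = n"
  shows "has_parity q (avg (parity_sign q n) F)"
  unfolding has_parity_def
proof (intro allI impI)
  fix as "is" assume l: "list_all2 (\<lambda>a i. a \<in> st_part i) as is" and nz: "avg (parity_sign q n) F as \<noteq> 0"
  have e: "avg (parity_sign q n) F as = (F as + parity_sign q n * (if sum_list is = 0 then F as else - F as)) / 2"
    unfolding avg_def flip_list[OF assms(2) l] ..
  have "F as \<noteq> 0" using nz unfolding e by (cases "F as = 0") (auto split: if_splits)
  then have n: "length as = n" by (rule assms(3))
  have "parity_sign q n = (if sum_list is = 0 then 1 else - 1 :: 'k)"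
  proof (rule ccontr)
    assume "parity_sign q n \<noteq> (if sum_list is = 0 then 1 else - 1 :: 'k)"
    then have "parity_sign q n * (if sum_list is = 0 then F as else - F as) = - F as"
      by (auto simp: parity_sign_def split: if_splits)
    then show False using nz e by simp
  qed
  moreover have "(1::'k) \<noteq> - 1" using assms(1) by (metis add.right_inverse one_add_one)
  ultimately have "(of_nat n + q = 0) \<longleftrightarrow> sum_list is = 0" by (auto simp: parity_sign_def split: if_splits)
  then show "of_nat (length as) + q + sum_list is = 0"
    unfolding n by (cases "of_nat n + q"; cases "sum_list is") auto
qed

lemma flip_parity:
  fixes F :: "'k::field st list \<Rightarrow> 'k"
  assumes "(2 :: 'k) \<noteq> 0" "multilin I F" "has_parity q F"
  shows "F (map t_flip as) = parity_sign q (length as) * F as"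
  using assms(2,3)
proof (induction as arbitrary: F q)
  case Nil
  show ?case using has_parityD[OF Nil(2), of "[]" "[]"] by (auto simp: parity_sign_def)
next
  case (Cons a as)
  obtain b c where bc: "b \<in> st_part 0" "c \<in> st_part 1" "a = b + c" using even_odd_split[OF assms(1)] .
  have lin: "F ((x + y) # bs) = F (x # bs) + F (y # bs)" "F (- x # bs) = - F (x # bs)" for x y bs
    using lin_on_minus[OF multilin_head[OF Cons.prems(1)], of 0 x bs] lin_on_0[OF multilin_head[OF Cons.prems(1)]]
      multilin_head[OF Cons.prems(1)] by (auto simp: lin_on_def)
  have "t_flip a = b + (- c)" using bc t_flip_st_part[of b 0] t_flip_st_part[of c 1] by (simp add: t_flip_add)
  then have "F (t_flip a # map t_flip as) = F (b # map t_flip as) - F (c # map t_flip as)"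
    by (simp only: lin) simp
  moreover have "F (b # map t_flip as) = parity_sign (q + 1 + 0) (length as) * F (b # as)"
    "F (c # map t_flip as) = parity_sign (q + 1 + 1) (length as) * F (c # as)"
    using Cons.IH[OF multilin_prepend[OF Cons.prems(1)] has_parity_prepend[OF Cons.prems(2)]] bc by blast+
  ultimately show ?case
    by (simp add: lin bc(3) parity_sign_Suc parity_sign_add_1 algebra_simps)
qed

lemma avg_parity:
  fixes F :: "'k::field st list \<Rightarrow> 'k"
  assumes "(2 :: 'k) \<noteq> 0" "multilin I F" "has_parity q F" "\<And>as. F as \<noteq> 0 \<Longrightarrow> length as = n"
  shows "avg (parity_sign q n) F as = F as"
proof (cases "F as = 0")
  case True
  then show ?thesis using flip_parity[OF assms(1-3), of as] by (simp add: avg_def)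
next
  case False
  have "parity_sign q n * parity_sign q n = (1::'k)" by (simp add: parity_sign_def)
  then show ?thesis using flip_parity[OF assms(1-3), of as] assms(4)[OF False] assms(1)
    by (simp add: avg_def flip: mult.assoc mult_2)
qed

text \<open>The powers of s are even and t is odd. A shuffle of i powers of s with j entries t has
  length i + j and parity j, so a nonzero value of a cochain of type q forces i = q modulo
  2.\<close>

lemma ev_parity:
  assumes "additive \<iota>" "has_parity q F"
  shows "(q = 0 \<longrightarrow> ev p \<iota> \<alpha> \<mu> True n F = 0) \<and> (q = 1 \<longrightarrow> ev p \<iota> \<alpha> \<mu> False n F = 0)"
  using assms(2)
proof (induction n arbitrary: q F)
  case 0
  have "F [] = 0" if "q = 1" using has_parityD[OF 0, of "[]" "[]"] that by auto
  then show ?case by (auto simp: additive.zero[OF assms(1)])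
next
  case (Suc n)
  have 1: "has_parity (q + 1) (\<lambda>as. F (s_gen ^ m # as))" "has_parity (q + 1) (\<lambda>as. F (s_gen # as))"
     "has_parity q (\<lambda>as. F (t_gen # as))" for m
    using has_parity_prepend[OF Suc.prems s_gen_power_st_part, of m] has_parity_prepend[OF Suc.prems s_gen_st_part]
      has_parity_prepend[OF Suc.prems t_gen_st_part] by (auto simp: ac_simps)
  show ?case using Suc.IH[OF 1(1)] Suc.IH[OF 1(2)] Suc.IH[OF 1(3)] by (cases q) auto
qed

text \<open>With flag \<open>False\<close> the number of powers of s is even, so a shuffle of odd
  length contains some t and contributes no constant coefficient.\<close>

lemma coeff_ev_poly_odd:
  assumes "odd n" shows "coeff (ev_poly p False n F) 0 = 0"
  using assms
proof (induction n arbitrary: F rule: less_induct)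
  case (less n)
  then consider "n = 1" | m where "n = Suc (Suc m)" "odd m"
    by (metis One_nat_def even_Suc old.nat.exhaust odd_pos less_not_refl)
  then show ?case
  proof cases
    case 1
    then show ?thesis by (simp add: coeff_ev_poly_Suc del: ev.simps(3,4))
  next
    case 2
    then show ?thesis using less.IH[of m] by (simp add: coeff_ev_poly_Suc del: ev.simps(3,4))
  qed
qed

lemma y_red_cochain: assumes "p > 0" shows "(y_red :: 'k::field st list \<Rightarrow> 'k) \<in> cocyc (M11_ideal p)"
proof (rule cocycI)
  have "has_parity 0 (y_red :: 'k st list \<Rightarrow> 'k)"
    unfolding has_parity_def
  proof (intro allI impI)
    fix as :: "'k st list" and "is" assume *: "list_all2 (\<lambda>a i. a \<in> st_part i) as is" "y_red as \<noteq> 0"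
    then obtain a where a: "as = [a]" "tau a \<noteq> 0" by (auto simp: y_red_def split: list.splits)
    then obtain i where i: "is = [i]" "a \<in> st_part i" using * by (auto simp: list_all2_Cons1)
    have "coeff a 1 \<noteq> 0" using a by (auto simp: tau_def)
    then have "i = 1" using st_partD[OF i(2), of 1] by simp
    then show "of_nat (length as) + 0 + sum_list is = 0" using a i by simp
  qed
  moreover have "bounded_deg (y_red :: 'k st list \<Rightarrow> 'k)"
    by (rule bounded_degI[of 1]) (auto simp: y_red_def split: list.splits)
  ultimately show "(y_red :: 'k st list \<Rightarrow> 'k) \<in> cochains (M11_ideal p) 0"
    using multilin_y_red[OF assms] by (simp add: cochains_def)
qed simp

lemma x_red_cochain:
  assumes "p > 0" and I: "\<And>a i. a \<in> I \<Longrightarrow> i < p \<Longrightarrow> coeff (coeff a 0) i = 0"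
  shows "x_red p \<in> cocyc I"
proof (rule cocycI)
  have "has_parity 0 (x_red p :: 'a st list \<Rightarrow> 'a)"
    unfolding has_parity_def
  proof (intro allI impI)
    fix as :: "'a st list" and "is" assume *: "list_all2 (\<lambda>a i. a \<in> st_part i) as is" "x_red p as \<noteq> 0"
    then obtain a b where a: "as = [a, b]" "carry p (coeff a 0) (coeff b 0) \<noteq> 0"
      by (auto simp: x_red_def split: list.splits)
    then obtain i j where i: "is = [i, j]" "a \<in> st_part i" "b \<in> st_part j" using * by (auto simp: list_all2_Cons1)
    have "coeff a 0 \<noteq> 0" "coeff b 0 \<noteq> 0" using a by auto
    then have "i = 0" "j = 0" using st_partD[OF i(2), of 0] st_partD[OF i(3), of 0] by simp_all
    then show "of_nat (length as) + 0 + sum_list is = 0" using a i by simp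
  qed
  moreover have "bounded_deg (x_red p :: 'a st list \<Rightarrow> 'a)"
    by (rule bounded_degI[of 2]) (auto simp: x_red_def split: list.splits)
  ultimately show "x_red p \<in> cochains I 0"
    using multilin_x_red[OF assms] by (simp add: cochains_def)
qed simp

lemma x_red_M11: "p > 0 \<Longrightarrow> x_red p \<in> cocyc (M11_ideal p)"
  by (rule x_red_cochain) (auto simp: M11_ideal_iff)

lemma x_red_Ga1: "p > 0 \<Longrightarrow> x_red p \<in> cocyc (Ga1_ideal p)"
  by (rule x_red_cochain) (auto simp: Ga1_ideal_def coeff_s_gen_power_mult coeff_monom_mult)

section \<open>Decomposition of homogeneous cocycles\<close>

fun x_pow :: "nat \<Rightarrow> 'k::field \<Rightarrow> nat \<Rightarrow> 'k st list \<Rightarrow> 'k" where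
  "x_pow p c 0 = const_cochain c"
| "x_pow p c (Suc l) = ccup (x_red p) (x_pow p c l)"

lemma x_pow_cocyc: "p > 0 \<Longrightarrow> x_pow p c l \<in> cocyc (M11_ideal p)"
  by (induction l) (auto simp: const_cochain_cocyc intro: cocyc_ccup x_red_M11)

lemma x_pow_degree: "x_pow p c l as \<noteq> 0 \<Longrightarrow> length as = 2 * l"
proof (induction l arbitrary: as)
  case 0 then show ?case by (auto simp: const_cochain_def split: if_splits)
next
  case (Suc l)
  consider "as = []" | a where "as = [a]" | a b bs where "as = a # b # bs" by (metis list.exhaust)
  then show ?case using Suc by cases auto
qed

lemma coeff_ev_poly_x_pow: "p \<ge> 2 \<Longrightarrow> coeff (ev_poly p False (2 * l) (x_pow p c l)) 0 = c"
proof (induction l)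
  case (Suc l)
  have "2 * Suc l = Suc (Suc (2 * l))" by simp
  then show ?case using Suc by (simp only: x_pow.simps coeff_ev_poly_ccup)
qed (simp add: const_cochain_def)

lemma cochains_avg:
  fixes F :: "'k::field st list \<Rightarrow> 'k"
  assumes "(2 :: 'k) \<noteq> 0" "multilin (M11_ideal p) F" "\<And>as. F as \<noteq> 0 \<Longrightarrow> length as = n"
  shows "avg (parity_sign q n) F \<in> cochains (M11_ideal p) q"
proof -
  have z: "F as = 0" if "length as > n" for as
    using assms(3)[of as] that by (cases "F as = 0") auto
  have "avg (parity_sign q n) F as = 0" if "length as > n" for as
    using z[OF that] z[of "map t_flip as"] that by (simp add: avg_def)
  then show ?thesis
    using has_parity_avg[OF assms] multilin_avg[OF assms(2)] by (auto simp: cochains_def intro: bounded_degI)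
qed

lemma low_part_cochains: assumes "F \<in> cochains I q" shows "low_part n F \<in> cochains I q"
  using assms by (auto simp: cochains_def multilin_low_part has_parity_def bounded_deg_def low_part_def)

lemma low_part_cocyc: "F \<in> cocyc I \<Longrightarrow> low_part n F \<in> cocyc I"
  by (auto simp: cocyc_def low_part_cochains cdiff_low_part)

context
  fixes p :: nat and ty :: "'k::field itself"
  assumes p2: "p \<ge> 2" and char2: "(2 :: 'k) \<noteq> 0"
begin

lemma homogeneous_cobound:
  assumes F: "F \<in> cocyc (M11_ideal p)" "\<And>as. F as \<noteq> 0 \<Longrightarrow> length as = n"
    and ev: "\<And>b. ev_poly p b n F = (0 :: 'k poly)"
  shows "F \<in> cobound (M11_ideal p)"
proof -
  have F': "multilin (M11_ideal p) F" "has_parity 0 F" "\<And>as. cdiff F as = 0"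
    using F(1) by (auto simp: cocyc_def cochains_def)
  obtain H where H: "multilin (M11_ideal p) H" "\<And>as. H as \<noteq> 0 \<Longrightarrow> Suc (length as) = n" "\<And>as. F as = cdiff H as"
    using cocycle_vanishing[OF p2 F'(1) F(2) F'(3)] ev by blast
  have "F = cdiff H" using H(3) by auto
  then have *: "F as = cdiff (avg (parity_sign 0 n) H) as" for as
    using avg_parity[OF char2 F'(1,2) F(2), of as] by (simp add: cdiff_avg)
  show ?thesis
  proof (cases n)
    case 0
    then have "H = (\<lambda>_. 0)" using H(2) by auto
    then have "F = cdiff (\<lambda>_. 0)" using \<open>F = cdiff H\<close> by metis
    then have "F = (\<lambda>_. 0)" by auto
    then show ?thesis by simp
  next
    case (Suc m)
    \<comment> \<open>H lives one degree below F: the sign for type 0 in degree n is the sign for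
      type 1 in degree n - 1, so averaging F and H uses the same projector.\<close>
    have "parity_sign 0 n = (parity_sign 1 m :: 'k)"
      by (simp add: Suc parity_sign_Suc parity_sign_1)
    then have "avg (parity_sign 0 n) H \<in> cochains (M11_ideal p) 1"
      using cochains_avg[OF char2 H(1), of m 1] H(2) Suc by auto
    then show ?thesis using * by (rule coboundI)
  qed
qed

lemma homogeneous_decompose:
  assumes F: "F \<in> cocyc (M11_ideal p)" "\<And>as. F as \<noteq> 0 \<Longrightarrow> length as = n"
  obtains c :: 'k and l G H where "G \<in> cocyc (M11_ideal p)" "\<And>as. G as \<noteq> 0 \<Longrightarrow> Suc (length as) = n"
    "H \<in> cobound (M11_ideal p)" "\<And>as. F as = x_pow p c l as + ccup y_red G as + H as"
proof -
  \<comment> \<open>For n = 2 l this is the value of F on the chain without t, which is also the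
    coefficient of the power of x_1. For odd n the choice c = 0 makes \<open>x_pow p c l\<close>
    vanish, whatever l is.\<close>
  define c where "c = (if even n then coeff (ev_poly p False n F) 0 else 0)"
  define l where "l = n div 2"
  define F' where "F' = (\<lambda>as. F as - x_pow p c l as)"
  have F'_z: "F' \<in> cocyc (M11_ideal p)"
    unfolding F'_def by (intro cocyc_diff F x_pow_cocyc) (use p2 in simp)
  have x0: "x_pow p 0 l as = 0" for as :: "'k st list"
  proof (induction l arbitrary: as)
    case 0 then show ?case by (simp add: const_cochain_def)
  next
    case (Suc l)
    then have "x_pow p 0 l = (\<lambda>_ :: 'k st list. 0)" by auto
    then show ?case by simp
  qed
  have deg: "length as = n" if "F' as \<noteq> 0" for as
  proof -
    have "F as \<noteq> 0 \<or> x_pow p c l as \<noteq> 0" using that by (auto simp: F'_def)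
    then show ?thesis
      using F(2) x_pow_degree[of p c l as] x0[of as] by (cases "even n") (auto simp: c_def l_def)
  qed
  have F'p: "multilin (M11_ideal p) F'" "has_parity 0 F'" "\<And>as. cdiff F' as = 0"
    using F'_z by (auto simp: cocyc_def cochains_def)
  have "coeff (ev_poly p b n F') 0 = 0" for b
  proof (cases b)
    case True
    then show ?thesis using ev_parity[OF additive_const_poly F'p(2)] by simp
  next
    case False
    show ?thesis
    proof (cases "even n")
      case True
      then have "coeff (ev_poly p False n (x_pow p c l)) 0 = c"
        using coeff_ev_poly_x_pow[OF p2, of l c] by (simp add: l_def)
      then show ?thesis using True False by (simp add: F'_def ev_diff[OF additive_const_poly] c_def)
    next
      case odd: False
      then show ?thesis using False coeff_ev_poly_odd by simp
    qed
  qed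
  then obtain G H where GH: "multilin (M11_ideal p) G" "\<And>as. G as \<noteq> 0 \<Longrightarrow> Suc (length as) = n" "\<And>as. cdiff G as = 0"
    "multilin (M11_ideal p) H" "\<And>as. H as \<noteq> 0 \<Longrightarrow> Suc (length as) = n" "\<And>as. F' as = ccup y_red G as + cdiff H as"
    using cocycle_vanishing[OF p2 F'p(1) deg F'p(3)] by blast
  let ?e = "parity_sign 0 n :: 'k"
  have F'_eq: "F' as = ccup y_red (avg (- ?e) G) as + cdiff (avg ?e H) as" for as
  proof -
    have "F' as = avg ?e F' as" using avg_parity[OF char2 F'p(1,2) deg] by simp
    also have "\<dots> = avg ?e (\<lambda>as. ccup y_red G as + cdiff H as) as"
      using ext[of F', OF GH(6)] by simp
    also have "avg ?e (\<lambda>as. ccup y_red G as + cdiff H as) as = avg ?e (ccup y_red G) as + avg ?e (cdiff H) as"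
      by (simp add: avg_def add_divide_distrib algebra_simps)
    finally show ?thesis by (simp add: ccup_y_avg cdiff_avg)
  qed
  have "avg (- ?e) G \<in> cochains (M11_ideal p) 0 \<and> avg ?e H \<in> cochains (M11_ideal p) 1"
  proof (cases n)
    case 0
    then have "G = (\<lambda>_. 0)" "H = (\<lambda>_. 0)" using GH by auto
    then have "avg (- ?e) G = (\<lambda>_. 0)" "avg ?e H = (\<lambda>_. 0)" by (auto simp: avg_def)
    then show ?thesis by simp
  next
    case (Suc m)
    have "- ?e = parity_sign 0 m" "?e = parity_sign 1 m"
      by (simp_all add: Suc parity_sign_Suc parity_sign_1)
    then show ?thesis
      using cochains_avg[OF char2 GH(1), of m 0] cochains_avg[OF char2 GH(4), of m 1] GH(2,5) Suc by auto
  qed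
  moreover have "cdiff G = (\<lambda>_. 0)" using GH(3) by auto
  then have "cdiff (avg (- ?e) G) as = 0" for as by (simp add: cdiff_avg) (simp add: avg_def)
  moreover have "Suc (length as) = n" if "avg (- ?e) G as \<noteq> 0" for as
    using that GH(2)[of as] GH(2)[of "map t_flip as"]
    by (cases "G as = 0"; cases "G (map t_flip as) = 0") (auto simp: avg_def)
  ultimately show ?thesis
    using that[of "avg (- ?e) G" "cdiff (avg ?e H)" c l] F'_eq
    by (auto simp: cocyc_def cobound_def F'_def diff_eq_eq algebra_simps)
qed

text \<open>Generation of H by y and x_1 in the form of an induction rule. Identities between
  classes can then be checked on generators without choosing a polynomial representing a
  class.\<close>

lemma cocyc_induct:
  assumes F: "F \<in> cocyc (M11_ideal p)"
    and const: "\<And>c :: 'k. P (const_cochain c)"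
    and add: "\<And>F G. F \<in> cocyc (M11_ideal p) \<Longrightarrow> G \<in> cocyc (M11_ideal p) \<Longrightarrow> P F \<Longrightarrow> P G \<Longrightarrow> P (\<lambda>as. F as + G as)"
    and y: "\<And>G. G \<in> cocyc (M11_ideal p) \<Longrightarrow> P G \<Longrightarrow> P (ccup y_red G)"
    and x: "\<And>G. G \<in> cocyc (M11_ideal p) \<Longrightarrow> P G \<Longrightarrow> P (ccup (x_red p) G)"
    and cobound: "\<And>H. H \<in> cobound (M11_ideal p) \<Longrightarrow> P H"
  shows "P F"
proof -
  have p_pos: "p > 0" using p2 by simp
  have xp: "P (x_pow p c l)" for c l
    by (induction l) (use x x_pow_cocyc[OF p_pos] const in auto)
  have hom: "P F" if "F \<in> cocyc (M11_ideal p)" "\<And>as. F as \<noteq> 0 \<Longrightarrow> length as = n" for n F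
    using that
  proof (induction n arbitrary: F rule: less_induct)
    case (less n)
    obtain c l G H where d: "G \<in> cocyc (M11_ideal p)" "\<And>as. G as \<noteq> 0 \<Longrightarrow> Suc (length as) = n"
      "H \<in> cobound (M11_ideal p)" "\<And>as. F as = x_pow p c l as + ccup y_red G as + H as"
      using homogeneous_decompose[OF less.prems] by metis
    have Hz: "H \<in> cocyc (M11_ideal p)" using cobound_subset[OF aug_ideal_M11[OF p_pos]] d(3) by blast
    have "P G"
    proof (cases n)
      case 0
      then have "G = (\<lambda>_. 0)" using d(2) by auto
      then show ?thesis using cobound[OF cobound_zero] by simp
    next
      case (Suc m)
      then show ?thesis using less.IH[of m G] d by auto
    qed
    have zs: "x_pow p c l \<in> cocyc (M11_ideal p)" "ccup y_red G \<in> cocyc (M11_ideal p)"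
      by (intro x_pow_cocyc p_pos cocyc_ccup y_red_cochain d)+
    have "P (\<lambda>as. (\<lambda>as. x_pow p c l as + ccup y_red G as) as + H as)"
      by (rule add[OF cocyc_add[OF zs] Hz add[OF zs xp y[OF d(1) \<open>P G\<close>]] cobound[OF d(3)]])
    moreover have "F = (\<lambda>as. x_pow p c l as + ccup y_red G as + H as)" using d(4) by auto
    ultimately show ?case by simp
  qed
  obtain N where N: "\<And>as. length as > N \<Longrightarrow> F as = 0"
    using F by (auto simp: cocyc_def cochains_def bounded_deg_def)
  have part: "P (\<lambda>as. if length as < n then F as else 0) \<and> (\<lambda>as. if length as < n then F as else 0) \<in> cocyc (M11_ideal p)" for n
  proof (induction n)
    case 0
    show ?case using cobound[OF cobound_zero] by simp
  next
    case (Suc n)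
    have z: "low_part (Suc n) F \<in> cocyc (M11_ideal p)" by (rule low_part_cocyc[OF F])
    have "P (low_part (Suc n) F)" by (rule hom[OF z, of n]) (auto simp: low_part_def split: if_splits)
    moreover have e: "(\<lambda>as. if length as < Suc n then F as else 0) =
        (\<lambda>as. (\<lambda>as. if length as < n then F as else 0) as + low_part (Suc n) F as)"
      by (auto simp: low_part_def)
    ultimately show ?case unfolding e using Suc z by (auto intro!: add cocyc_add)
  qed
  have "F = (\<lambda>as. if length as < Suc N then F as else 0)" using N by (auto simp: not_less_eq)
  then show ?thesis using part[of "Suc N"] by simp
qed

end

section \<open>Points of the spectrum\<close>

lemma cobound_cong: "F \<in> cobound I \<Longrightarrow> (\<And>as. G as = F as) \<Longrightarrow> G \<in> cobound I"
  by (simp add: ext[of G F])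

lemma additive_id: "additive (\<lambda>x :: 'k::field. x)"
  by unfold_locales simp

abbreviation ev_at :: "nat \<Rightarrow> 'k::field \<Rightarrow> 'k \<Rightarrow> bool \<Rightarrow> nat \<Rightarrow> ('k st list \<Rightarrow> 'k) \<Rightarrow> 'k" where
  "ev_at p \<alpha> \<mu> b n F \<equiv> ev p (\<lambda>x. x) \<alpha> \<mu> b n F"

text \<open>The generating polynomial of the values by degree. Keeping its variable turns dilation
  along the affine line into a substitution. Flag \<open>False\<close> suffices, since the other
  values of a cocycle vanish by parity.\<close>

definition ev_series :: "nat \<Rightarrow> 'k::field \<Rightarrow> 'k \<Rightarrow> ('k st list \<Rightarrow> 'k) \<Rightarrow> 'k poly" where
  "ev_series p \<alpha> \<mu> F = Abs_poly (\<lambda>n. ev_at p \<alpha> \<mu> False n F)"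

definition chi :: "nat \<Rightarrow> 'k::field \<Rightarrow> 'k \<Rightarrow> ('k st list \<Rightarrow> 'k) \<Rightarrow> 'k" where
  "chi p \<alpha> \<mu> F = poly (ev_series p \<alpha> \<mu> F) 1"

lemma coeff_ev_series: assumes "bounded_deg F" shows "coeff (ev_series p \<alpha> \<mu> F) n = ev_at p \<alpha> \<mu> False n F"
proof -
  obtain N where N: "\<And>as. length as > N \<Longrightarrow> F as = 0" using assms by (auto simp: bounded_deg_def)
  have "ev_at p \<alpha> \<mu> False i F = 0" if "i > N" for i
    by (rule ev_eq_0[OF additive_id]) (use that N in auto)
  then show ?thesis unfolding ev_series_def by (subst coeff_Abs_poly[of N]) auto
qed

lemma cocyc_bounded: "F \<in> cocyc I \<Longrightarrow> bounded_deg F" and cocyc_multilin: "F \<in> cocyc I \<Longrightarrow> multilin I F"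
  and cocyc_parity: "F \<in> cocyc I \<Longrightarrow> has_parity 0 F"
  by (auto simp: cocyc_def cochains_def)

lemma ev_series_add:
  "bounded_deg F \<Longrightarrow> bounded_deg G \<Longrightarrow> ev_series p \<alpha> \<mu> (\<lambda>as. F as + G as) = ev_series p \<alpha> \<mu> F + ev_series p \<alpha> \<mu> G"
  by (simp add: poly_eq_iff coeff_ev_series bounded_deg_add ev_add[OF additive_id])

lemma ev_series_const: "ev_series p \<alpha> \<mu> (const_cochain c) = [:c:]"
proof (rule poly_eqI)
  fix n
  have "bounded_deg (const_cochain c)" by (rule bounded_degI[of 0]) (auto simp: const_cochain_def)
  moreover have "ev_at p \<alpha> \<mu> False (Suc m) (const_cochain c) = 0" for m
    by (rule ev_eq_0[OF additive_id]) (auto simp: const_cochain_def)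
  ultimately show "coeff (ev_series p \<alpha> \<mu> (const_cochain c)) n = coeff [:c:] n"
    by (cases n) (simp_all add: coeff_ev_series const_cochain_def del: ev.simps(3,4))
qed

lemma ev_series_cobound:
  assumes "p \<ge> 2" "H \<in> cobound (M11_ideal p)" shows "ev_series p \<alpha> \<mu> H = 0"
proof -
  obtain K where K: "K \<in> cochains (M11_ideal p) 1" "H = cdiff K" using assms(2) by (rule coboundE)
  then have "bounded_deg H" "multilin (M11_ideal p) K" by (auto simp: cochains_def intro: bounded_deg_cdiff)
  then show ?thesis
    by (intro poly_eqI) (simp add: coeff_ev_series K(2) ev_cdiff[OF additive_id _ assms(1)])
qed

text \<open>Cutting a shuffle in two gives shuffles again. If the tail has an odd number of powers
  of s, its value vanishes by the parity of G; hence the initial piece keeps the flag b and the tail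
  has flag \<open>False\<close>.\<close>

lemma ev_ccup:
  assumes "has_parity 0 G"
  shows "ev_at p \<alpha> \<mu> b n (ccup F G) = (\<Sum>i\<le>n. ev_at p \<alpha> \<mu> b i F * ev_at p \<alpha> \<mu> False (n - i) G)"
proof (induction n arbitrary: b F)
  case 0
  show ?case by (cases b) simp_all
next
  case (Suc n)
  have G0: "ev_at p \<alpha> \<mu> True m G = 0" for m using ev_parity[OF additive_id assms] by simp
  have sc: "ev_at p \<alpha> \<mu> b m (\<lambda>as. c * F as) = c * ev_at p \<alpha> \<mu> b m F" for c b m and F :: "'a st list \<Rightarrow> 'a"
  proof (induction m arbitrary: b F)
    case 0 then show ?case by (cases b) auto
  next
    case (Suc m) then show ?case by (cases b) (auto simp: algebra_simps)
  qed
  have step: "ev_at p \<alpha> \<mu> b n (\<lambda>as. ccup F G (x # as)) = F [] * ev_at p \<alpha> \<mu> b n (\<lambda>as. G (x # as)) +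
      (\<Sum>i\<le>n. ev_at p \<alpha> \<mu> b i (\<lambda>as. F (x # as)) * ev_at p \<alpha> \<mu> False (n - i) G)" for b x
    by (simp add: ccup.simps(2) ev_add[OF additive_id] sc Suc.IH)
  show ?case
  proof (cases b)
    case True
    have "ev_at p \<alpha> \<mu> True (Suc n) (ccup F G) = F [] * ev_at p \<alpha> \<mu> True (Suc n) G +
        (\<Sum>i\<le>n. ev_at p \<alpha> \<mu> True (Suc i) F * ev_at p \<alpha> \<mu> False (n - i) G)"
      by (simp add: step sum_distrib_left sum_subtractf algebra_simps)
    then show ?thesis using True by (simp add: G0 sum.atMost_Suc_shift del: sum.atMost_Suc ev.simps(3,4))
  next
    case False
    have "ev_at p \<alpha> \<mu> False (Suc n) (ccup F G) = F [] * ev_at p \<alpha> \<mu> False (Suc n) G +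
        (\<Sum>i\<le>n. ev_at p \<alpha> \<mu> False (Suc i) F * ev_at p \<alpha> \<mu> False (n - i) G)"
      by (simp add: step sum_distrib_left sum.distrib algebra_simps)
    then show ?thesis using False by (simp add: sum.atMost_Suc_shift del: sum.atMost_Suc ev.simps(3,4))
  qed
qed

lemma ev_series_ccup:
  assumes "bounded_deg F" "bounded_deg G" "has_parity 0 G"
  shows "ev_series p \<alpha> \<mu> (ccup F G) = ev_series p \<alpha> \<mu> F * ev_series p \<alpha> \<mu> G"
  by (rule poly_eqI) (simp add: coeff_mult coeff_ev_series bounded_deg_ccup assms ev_ccup)

lemma ev_series_y: "ev_series p \<alpha> \<mu> y_red = [:0, \<mu>:]"
proof (rule poly_eqI)
  fix n
  have b: "bounded_deg y_red" by (rule bounded_degI[of 1]) (auto simp: y_red_def split: list.splits)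
  consider "n = 0" | "n = Suc 0" | m where "n = Suc (Suc m)" by (metis not0_implies_Suc)
  then show "coeff (ev_series p \<alpha> \<mu> y_red) n = coeff [:0, \<mu>:] n"
  proof cases
    case (3 m)
    have "ev_at p \<alpha> \<mu> False (Suc (Suc m)) y_red = 0"
      by (rule ev_eq_0[OF additive_id]) (auto simp: y_red_def split: list.splits)
    then show ?thesis by (simp add: coeff_ev_series[OF b] 3 del: ev.simps(3,4))
  qed (simp_all add: coeff_ev_series[OF b])
qed

lemma ev_series_x: assumes "p \<ge> 2" shows "ev_series p \<alpha> \<mu> (x_red p) = [:0, 0, \<alpha>:]"
proof (rule poly_eqI)
  fix n
  have b: "bounded_deg (x_red p)" by (rule bounded_degI[of 2]) (auto simp: x_red_def split: list.splits)
  have t: "coeff t_gen 0 = 0" by (simp add: t_gen_def)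
  consider "n = 0" | "n = Suc 0" | "n = Suc (Suc 0)" | m where "n = Suc (Suc (Suc m))" by (metis not0_implies_Suc)
  then show "coeff (ev_series p \<alpha> \<mu> (x_red p)) n = coeff [:0, 0, \<alpha>:] n"
  proof cases
    case 3
    show ?thesis by (simp add: 3 coeff_ev_series[OF b] t carry_s_gen(1)[OF assms, unfolded One_nat_def])
  next
    case (4 m)
    have "ev_at p \<alpha> \<mu> False (Suc (Suc (Suc m))) (x_red p) = 0"
      by (rule ev_eq_0[OF additive_id]) (auto simp: x_red_def split: list.splits)
    then show ?thesis by (simp add: coeff_ev_series[OF b] 4 del: ev.simps(3,4))
  qed (simp_all add: coeff_ev_series[OF b])
qed

text \<open>A shuffle of i powers of s with j entries t has weight \<alpha>^(i div 2) \<mu>^j, which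
  scales by c^(i+j) for even i and by c^(i+j-1) for odd i. The extra factor c in the second part
  avoids a division by c.\<close>

lemma ev_rescale:
  "ev_at p (c\<^sup>2 * \<alpha>) (c * \<mu>) False n F = c ^ n * ev_at p \<alpha> \<mu> False n F \<and>
   c * ev_at p (c\<^sup>2 * \<alpha>) (c * \<mu>) True n F = c ^ n * ev_at p \<alpha> \<mu> True n F"
proof (induction n arbitrary: F)
  case 0 show ?case by simp
next
  case (Suc n)
  have 1: "ev_at p (c\<^sup>2 * \<alpha>) (c * \<mu>) False n F = c ^ n * ev_at p \<alpha> \<mu> False n F"
    and 2: "c * ev_at p (c\<^sup>2 * \<alpha>) (c * \<mu>) True n F = c ^ n * ev_at p \<alpha> \<mu> True n F" for F
    using Suc.IH by auto
  have 3: "c\<^sup>2 * \<alpha> * ev_at p (c\<^sup>2 * \<alpha>) (c * \<mu>) True n F = c * \<alpha> * (c ^ n * ev_at p \<alpha> \<mu> True n F)"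
    and 4: "c * (c * \<mu> * ev_at p (c\<^sup>2 * \<alpha>) (c * \<mu>) True n F) = c * \<mu> * (c ^ n * ev_at p \<alpha> \<mu> True n F)" for F
    unfolding 2[symmetric] by (simp_all add: power2_eq_square ac_simps)
  show ?case
    unfolding ev.simps 1 3 right_diff_distrib 4 by (simp add: algebra_simps)
qed

lemma chi_rescale: assumes "bounded_deg F" shows "chi p (c\<^sup>2 * \<alpha>) (c * \<mu>) F = poly (ev_series p \<alpha> \<mu> F) c"
proof -
  have "ev_series p (c\<^sup>2 * \<alpha>) (c * \<mu>) F = pcompose (ev_series p \<alpha> \<mu> F) [:0, c:]"
    by (intro poly_eqI) (simp add: coeff_ev_series assms coeff_pcompose_linear conjunct1[OF ev_rescale])
  then show ?thesis by (simp add: chi_def poly_pcompose)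
qed

lemma scalar_ring_ring: "ring (scalar_ring :: 'k::field ring)"
proof (rule ringI)
  show "abelian_group (scalar_ring :: 'k ring)"
  proof (rule abelian_groupI)
    fix x :: 'k
    show "\<exists>y\<in>carrier scalar_ring. y \<oplus>\<^bsub>scalar_ring\<^esub> x = \<zero>\<^bsub>scalar_ring\<^esub>"
      by (intro bexI[of _ "- x"]) (auto simp: scalar_ring_def)
  qed (auto simp: scalar_ring_def)
  show "Group.monoid (scalar_ring :: 'k ring)"
    by (rule monoidI) (auto simp: scalar_ring_def)
qed (auto simp: scalar_ring_def algebra_simps)

context
  fixes p :: nat and ty :: "'k::field itself"
  assumes p2: "p \<ge> 2" and char2: "(2 :: 'k) \<noteq> 0"
begin

abbreviation MI :: "'k st set" where "MI \<equiv> M11_ideal p"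

lemma p_pos: "p > 0" using p2 by simp
lemma aug_M11: "aug_ideal MI" by (rule aug_ideal_M11[OF p_pos])

lemmas y_cocyc = y_red_cochain[OF p_pos, where ?'k = 'k]
lemmas x_cocyc = x_red_M11[OF p_pos, where ?'a = 'k]

lemma chi_add: "F \<in> cocyc MI \<Longrightarrow> G \<in> cocyc MI \<Longrightarrow> chi p \<alpha> \<mu> (\<lambda>as. F as + G as) = chi p \<alpha> \<mu> F + chi p \<alpha> \<mu> G"
  by (simp add: chi_def ev_series_add cocyc_bounded)

lemma chi_ccup: "F \<in> cocyc MI \<Longrightarrow> G \<in> cocyc MI \<Longrightarrow> chi p \<alpha> \<mu> (ccup F G) = chi p \<alpha> \<mu> F * chi p \<alpha> \<mu> G"
  by (simp add: chi_def ev_series_ccup cocyc_bounded cocyc_parity)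

lemma chi_cobound: "H \<in> cobound MI \<Longrightarrow> chi p \<alpha> \<mu> H = 0"
  by (simp add: chi_def ev_series_cobound[OF p2])

lemma chi_simps [simp]: "chi p \<alpha> \<mu> (const_cochain c) = c" "chi p \<alpha> \<mu> y_red = \<mu>" "chi p \<alpha> \<mu> (x_red p) = \<alpha>"
  by (simp_all add: chi_def ev_series_const ev_series_y ev_series_x[OF p2])

lemma cobound_cocyc: "H \<in> cobound MI \<Longrightarrow> H \<in> cocyc MI"
  using cobound_subset[OF aug_M11] by blast

lemma chi_diff: assumes "F \<in> cocyc MI" "G \<in> cocyc MI"
  shows "chi p \<alpha> \<mu> (\<lambda>as. F as - G as) = chi p \<alpha> \<mu> F - chi p \<alpha> \<mu> G"
  using chi_add[OF cocyc_diff[OF assms] assms(2), of \<alpha> \<mu>] by (simp add: algebra_simps)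

lemma y_class_eq: "y_class p = cls MI y_red"
proof -
  have "y_cochain = full (y_red :: 'k st list \<Rightarrow> 'k)"
  proof (intro ext)
    fix as :: "'k st list" and v
    consider "as = []" | a where "as = [a]" | a b where "as = [a, b]" | a b c bs where "as = a # b # c # bs"
      by (metis list.exhaust)
    then show "y_cochain as v = full y_red as v"
      by cases (auto simp: y_cochain_def full_def tau_def)
  qed
  then show ?thesis by (simp add: y_class_def cls_def)
qed

text \<open>The negative of the coefficient of s^p has the carry as its coboundary, and the
  coefficient of t^2 has -y^2. Neither functional descends to P_1, but their sum K does, as both
  coefficients agree on multiples of s^p + t^2. This is the normalization of x_1.\<close>

lemma x_red_P1: "(\<lambda>as. x_red p as - ccup y_red y_red as) \<in> cobound (P1_ideal p :: 'k st set)"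
proof (rule coboundI)
  define K :: "'k st list \<Rightarrow> 'k" where
    "K as = (case as of [a] \<Rightarrow> coeff (coeff a 2) 0 - coeff (coeff a 0) p | _ \<Rightarrow> 0)" for as
  have K: "K [] = 0" "K [a] = coeff (coeff a 2) 0 - coeff (coeff a 0) p" "K (a # b # bs) = 0" for a b bs
    by (simp_all add: K_def)
  have "multilin (P1_ideal p) K"
  proof (rule multilin_consI)
    have "K [a] = 0" if a: "a \<in> P1_ideal p" for a
    proof -
      obtain f where "a = s_gen ^ p * f + t_gen * (t_gen * f)"
        using a by (auto simp: P1_ideal_def power2_eq_square algebra_simps)
      then show ?thesis using p_pos
        by (simp add: K coeff_s_gen_power_mult coeff_monom_mult numeral_2_eq_2)
    qed
    then show "lin_on (P1_ideal p) (\<lambda>a. K (a # bs))" for bs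
      by (cases bs) (auto intro!: lin_onI simp: K algebra_simps)
    show "multilin (P1_ideal p) (\<lambda>bs. K (a # bs))" for a
      by (rule multilin_consI) (simp_all add: K)
  qed
  moreover have "has_parity 1 K"
    unfolding has_parity_def
  proof (intro allI impI)
    fix as :: "'k st list" and "is" assume *: "list_all2 (\<lambda>a i. a \<in> st_part i) as is" "K as \<noteq> 0"
    then obtain a where a: "as = [a]" by (auto simp: K_def split: list.splits)
    then obtain i where i: "is = [i]" "a \<in> st_part i" using * by (auto simp: list_all2_Cons1)
    have "coeff a 2 \<noteq> 0 \<or> coeff a 0 \<noteq> 0" using *(2) by (auto simp: a K)
    then have "i = 0" using st_partD[OF i(2), of 2] st_partD[OF i(2), of 0] by auto
    then show "of_nat (length as) + 1 + sum_list is = 0" using a i by simp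
  qed
  moreover have "bounded_deg K"
    by (rule bounded_degI[of 1]) (auto simp: K_def split: list.splits)
  ultimately show "K \<in> cochains (P1_ideal p) 1" by (simp add: cochains_def)
  fix as :: "'k st list"
  have c2: "coeff (a * b) 2 = coeff a 0 * coeff b 2 + coeff a 1 * coeff b 1 + coeff a 2 * coeff b 0" for a b :: "'k st"
    by (simp add: coeff_mult numeral_2_eq_2)
  consider "as = []" | a where "as = [a]" | a b where "as = [a, b]" | a b c bs where "as = a # b # c # bs"
    by (metis list.exhaust)
  then show "x_red p as - ccup y_red y_red as = cdiff K as"
    by cases (auto simp: cdiff_def K carry_def tau_def counit_def c2 coeff_mult_0 algebra_simps)
qed

text \<open>A primitive H would satisfy H[t^2] = -1 and H[s^p] = 0, although s^p = -t^2 in P_1. This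
  fixes the scalar in the uniqueness of x_1.\<close>

lemma y_square_P1: "ccup y_red y_red \<notin> cobound (P1_ideal p :: 'k st set)"
proof
  assume "ccup y_red y_red \<in> cobound (P1_ideal p :: 'k st set)"
  then obtain H :: "'k st list \<Rightarrow> 'k" where H: "H \<in> cochains (P1_ideal p) 1" "ccup y_red y_red = cdiff H" by (rule coboundE)
  have "cdiff H [t_gen, t_gen] = 1" unfolding H(2)[symmetric] by simp
  then have "- H [t_gen * t_gen] = 1" by (simp add: cdiff_def)
  then have 1: "H [t_gen * t_gen] = - 1" by (metis minus_minus)
  have "cdiff H [s_gen, s_gen ^ (p - 1)] = 0" unfolding H(2)[symmetric] by simp
  moreover have [simp]: "(0::'k) ^ (p - Suc 0) = 0" using p2 by simp
  moreover have "s_gen * s_gen ^ (p - 1) = (s_gen ^ p :: 'k st)"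
    using p2 by (simp add: power_eq_if)
  ultimately have 2: "H [s_gen ^ p] = 0" by (simp add: cdiff_def)
  have "s_gen ^ p + t_gen * t_gen = (s_gen ^ p + t_gen ^ 2) * (1 :: 'k st)" by (simp add: power2_eq_square)
  then have "(s_gen ^ p + t_gen * t_gen :: 'k st) \<in> P1_ideal p" unfolding P1_ideal_def by blast
  moreover have "lin_on (P1_ideal p) (\<lambda>a. H [a])"
    using H(1) by (auto simp: cochains_def intro: multilin_head)
  ultimately have "H [s_gen ^ p + t_gen * t_gen] = 0" "H [s_gen ^ p + t_gen * t_gen] = H [s_gen ^ p] + H [t_gen * t_gen]"
    unfolding lin_on_def by blast+
  then show False using 1 2 by simp
qed

lemma x1_class_eq: "x1_class p = cls MI (x_red p)"
proof -
  let ?P = "P1_ideal p :: 'k st set" and ?G = "Ga1_ideal p :: 'k st set"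
  note aP = aug_ideal_P1[OF p_pos, where ?'a = 'k] and aG = aug_ideal_Ga1[OF p_pos, where ?'a = 'k]
  note PM = P1_ideal_subset_M11[of p, where ?'a = 'k] and MG = M11_ideal_subset_Ga1[of p, where ?'a = 'k]
  have yy: "inflate ?P (y_class p) \<otimes>\<^bsub>coh_ring ?P\<^esub> inflate ?P (y_class p) = cls ?P (ccup y_red y_red)"
    by (simp add: y_class_eq inflate_cls[OF aug_M11 aP PM] cls_mult[OF aP] cocyc_mono[OF PM y_cocyc])
  show ?thesis
    unfolding x1_class_def yy
  proof (rule the_equality)
    have "cls ?G (x_red p) \<in> coh_degree ?G 2"
    proof -
      have "full (x_red p) as = (0 :: 'k \<Rightarrow> 'k)" if "length as \<noteq> Suc 2" for as
      proof -
        consider "as = []" | a where "as = [a]" | a b where "as = [a, b]" | a b c where "as = [a, b, c]"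
          | a b c d bs where "as = a # b # c # d # bs" by (metis list.exhaust)
        then show ?thesis using that by cases (auto simp: full_def)
      qed
      then show ?thesis
        unfolding coh_degree_def cls_def cocycles_eq[OF aG] using x_red_Ga1[OF p_pos] by blast
    qed
    then show "cls MI (x_red p) \<in> inflate MI ` coh_degree ?G 2 \<and> inflate ?P (cls MI (x_red p)) = cls ?P (ccup y_red y_red)"
      using inflate_cls[OF aG aug_M11 MG, of "x_red p"] x_red_P1
      by (auto simp: inflate_cls[OF aug_M11 aP PM] cls_eq_iff[OF aP] intro!: image_eqI)
  next
    fix X assume X: "X \<in> inflate MI ` coh_degree ?G 2 \<and> inflate ?P X = cls ?P (ccup y_red y_red)"
    then obtain f where f: "X = inflate MI (coh_class ?G f)" "f \<in> cocycles ?G" "\<And>as. length as \<noteq> Suc 2 \<Longrightarrow> f as = 0"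
      by (auto simp: coh_degree_def)
    then obtain F where F: "F \<in> cocyc ?G" "f = full F" by (auto simp: cocycles_eq[OF aG])
    have XF: "X = cls MI F" using f F inflate_cls[OF aG aug_M11 MG, of F] by (simp add: cls_def)
    have Fz: "F \<in> cocyc MI" by (rule cocyc_mono[OF MG F(1)])
    have deg: "length as = 2" if "F as \<noteq> 0" for as
    proof (rule ccontr)
      assume "length as \<noteq> 2"
      then have "full F (1 # as) = 0" using f(3)[of "1 # as"] F(2) by simp
      then have "full F (1 # as) 1 = 0" by simp
      then show False using that by (simp add: full_def)
    qed
    have "t_gen = s_gen ^ p * 0 + t_gen * (1 :: 'k st)" by simp
    then have tG: "(t_gen :: 'k st) \<in> ?G" unfolding Ga1_ideal_def by blast
    have Ft: "F (t_gen # bs) = 0" "F (b # t_gen # bs) = 0" for b bs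
      using multilin_head[OF cocyc_multilin[OF F(1)], of bs] multilin_second[OF cocyc_multilin[OF F(1)], of b bs] tG
      by (auto simp: lin_on_def)
    define c where "c = F [s_gen ^ (p - 1), s_gen]"
    define F' where "F' = (\<lambda>as. F as - c * x_red p as)"
    have t: "coeff t_gen 0 = (0 :: 'k poly)" by (simp add: t_gen_def)
    have "F' \<in> cocyc MI" unfolding F'_def by (intro cocyc_diff Fz cocyc_scale x_cocyc)
    moreover have "length as = 2" if "F' as \<noteq> 0" for as
    proof -
      consider "F as \<noteq> 0" | "x_red p as \<noteq> 0" using \<open>F' as \<noteq> 0\<close> by (force simp: F'_def)
      then show ?thesis
      proof cases
        case 2
        then show ?thesis by (auto simp: x_red_def split: list.splits)
      qed (rule deg)
    qed
    \<comment> \<open>A cocycle inflated from k[s]/s^p vanishes as soon as an argument is t, so the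
      only shuffle left is [s^(p-1)|s], where F' is zero by the choice of c.\<close>
    moreover have "ev_poly p b 2 F' = 0" for b
      using carry_s_gen(1)[OF p2, where ?'k = 'k]
      by (cases b) (simp_all add: F'_def numeral_2_eq_2 Ft t c_def)
    ultimately have b: "F' \<in> cobound MI" by (rule homogeneous_cobound[OF p2 char2])
    have "(\<lambda>as. F as - ccup y_red y_red as) \<in> cobound ?P"
      using X by (simp add: XF inflate_cls[OF aug_M11 aP PM] cls_eq_iff[OF aP])
    then have "(\<lambda>as. (F as - ccup y_red y_red as - F' as) - c * (x_red p as - ccup y_red y_red as)) \<in> cobound ?P"
      by (rule cobound_diff[OF cobound_diff[OF _ cobound_mono[OF PM b]] cobound_scale[OF x_red_P1]])
    \<comment> \<open>On P_1 both X and x_1 become y^2, while X is c x_1; so (c - 1) y^2 is a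
      coboundary.\<close>
    then have *: "(\<lambda>as. (c - 1) * ccup y_red y_red as) \<in> cobound ?P"
      by (rule cobound_cong) (simp add: F'_def algebra_simps)
    have "c = 1"
    proof (rule ccontr)
      assume "c \<noteq> 1"
      then have "ccup y_red y_red \<in> cobound ?P"
        by (intro cobound_cong[OF cobound_scale[OF *, of "1 / (c - 1)"]]) simp
      then show False using y_square_P1 by contradiction
    qed
    then show "X = cls MI (x_red p)" using b by (simp add: XF cls_eq_iff[OF aug_M11] F'_def)
  qed
qed

section \<open>Commutativity up to coboundaries\<close>

lemmas cocyc_generated = cocyc_induct[OF p2 char2, consumes 1, case_names const add y x cobound]

lemma xy_commute: "(\<lambda>as. ccup (x_red p) y_red as - ccup y_red (x_red p) as) \<in> cobound MI"
proof (rule coboundI)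
  have "has_parity 1 (xy_red p :: 'k st list \<Rightarrow> 'k)"
    unfolding has_parity_def
  proof (intro allI impI)
    fix as :: "'k st list" and "is" assume *: "list_all2 (\<lambda>a i. a \<in> st_part i) as is" "xy_red p as \<noteq> 0"
    then obtain a b where a: "as = [a, b]"
      by (auto simp: xy_red_def split: list.splits)
    then obtain i j where i: "is = [i, j]" "a \<in> st_part i" "b \<in> st_part j" using * by (auto simp: list_all2_Cons1)
    have "(coeff a 0 \<noteq> 0 \<and> coeff b 1 \<noteq> 0) \<or> (coeff a 1 \<noteq> 0 \<and> coeff b 0 \<noteq> 0)"
      using *(2) unfolding a by (metis One_nat_def add.right_neutral carry_0 red_simps(11))
    then have "i + j = 1"
      using st_partD[OF i(2), of 0] st_partD[OF i(2), of 1] st_partD[OF i(3), of 0] st_partD[OF i(3), of 1] by auto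
    then show "of_nat (length as) + 1 + sum_list is = 0" using a i by simp
  qed
  moreover have "bounded_deg (xy_red p :: 'k st list \<Rightarrow> 'k)"
    by (rule bounded_degI[of 2]) (auto simp: xy_red_def split: list.splits)
  ultimately show "xy_red p \<in> cochains MI 1"
    using multilin_xy_red[OF p_pos, where ?'a = 'k] by (simp add: cochains_def)
qed (simp add: cdiff_xy_red)

text \<open>U(VG) - (VG)U = (UV - VU)G + V(UG - GU), and coboundaries are stable under
  multiplication by cocycles on either side.\<close>

lemma commute_step:
  assumes "U \<in> cocyc MI" "V \<in> cocyc MI" "G \<in> cocyc MI"
    "(\<lambda>as. ccup U V as - ccup V U as) \<in> cobound MI" "(\<lambda>as. ccup U G as - ccup G U as) \<in> cobound MI"
  shows "(\<lambda>as. ccup U (ccup V G) as - ccup (ccup V G) U as) \<in> cobound MI"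
    and "(\<lambda>as. ccup (ccup V G) U as - ccup U (ccup V G) as) \<in> cobound MI"
proof -
  have "(\<lambda>as. ccup (\<lambda>as. ccup U V as - ccup V U as) G as + ccup V (\<lambda>as. ccup U G as - ccup G U as) as) \<in> cobound MI"
    by (intro cobound_add cobound_ccup_left cobound_ccup_right assms)
  then show "(\<lambda>as. ccup U (ccup V G) as - ccup (ccup V G) U as) \<in> cobound MI"
    by (rule cobound_cong) (simp add: ccup_diff_left ccup_diff_right ccup_assoc)
  from cobound_neg[OF this] show "(\<lambda>as. ccup (ccup V G) U as - ccup U (ccup V G) as) \<in> cobound MI"
    by (rule cobound_cong) simp
qed

lemma commute_sum:
  assumes "(\<lambda>as. ccup U F as - ccup F U as) \<in> cobound MI" "(\<lambda>as. ccup U G as - ccup G U as) \<in> cobound MI"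
  shows "(\<lambda>as. ccup U (\<lambda>as. F as + G as) as - ccup (\<lambda>as. F as + G as) U as) \<in> cobound MI"
  by (rule cobound_cong[OF cobound_add[OF assms]]) (simp add: ccup_add_left ccup_add_right)

lemma commute_sym:
  assumes "(\<lambda>as. ccup U F as - ccup F U as) \<in> cobound MI"
  shows "(\<lambda>as. ccup F U as - ccup U F as) \<in> cobound MI"
  by (rule cobound_cong[OF cobound_neg[OF assms]]) simp

lemma commute_cobound: "U \<in> cocyc MI \<Longrightarrow> H \<in> cobound MI \<Longrightarrow> (\<lambda>as. ccup U H as - ccup H U as) \<in> cobound MI"
  by (intro cobound_diff cobound_ccup_left cobound_ccup_right)

lemma commute_self: "(\<lambda>as. ccup U U as - ccup U U as) \<in> cobound MI"
  by simp

lemma commute_with: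
  assumes U: "U \<in> cocyc MI" and Uy: "(\<lambda>as. ccup U y_red as - ccup y_red U as) \<in> cobound MI"
    and Ux: "(\<lambda>as. ccup U (x_red p) as - ccup (x_red p) U as) \<in> cobound MI"
    and G: "G \<in> cocyc MI"
  shows "(\<lambda>as. ccup U G as - ccup G U as) \<in> cobound MI"
  using G
proof (induction rule: cocyc_generated)
  case (add F G) then show ?case by (intro commute_sum)
next
  case (y G) then show ?case by (intro commute_step U y_cocyc Uy)
next
  case (x G) then show ?case by (intro commute_step U x_cocyc Ux)
next
  case (cobound H) then show ?case by (intro commute_cobound U)
qed simp

lemma commute: "F \<in> cocyc MI \<Longrightarrow> G \<in> cocyc MI \<Longrightarrow> (\<lambda>as. ccup F G as - ccup G F as) \<in> cobound MI"
proof -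
  have y: "(\<lambda>as. ccup y_red G as - ccup G y_red as) \<in> cobound MI" if "G \<in> cocyc MI" for G
    by (rule commute_with[OF y_cocyc commute_self commute_sym[OF xy_commute] that])
  have x: "(\<lambda>as. ccup (x_red p) G as - ccup G (x_red p) as) \<in> cobound MI" if "G \<in> cocyc MI" for G
    by (rule commute_with[OF x_cocyc xy_commute commute_self that])
  show "F \<in> cocyc MI \<Longrightarrow> G \<in> cocyc MI \<Longrightarrow> ?thesis"
    by (rule commute_with) (auto intro: commute_sym x y)
qed

lemma M11_cring: "cring (coh_ring MI)"
proof -
  interpret ring "coh_ring MI" by (rule coh_ring_ring[OF aug_M11])
  show ?thesis
  proof unfold_locales
    fix x y assume "x \<in> carrier (coh_ring MI)" "y \<in> carrier (coh_ring MI)"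
    then obtain F G where FG: "F \<in> cocyc MI" "G \<in> cocyc MI" "x = cls MI F" "y = cls MI G"
      by (auto simp: carrier_coh_ring[OF aug_M11])
    then show "x \<otimes>\<^bsub>coh_ring MI\<^esub> y = y \<otimes>\<^bsub>coh_ring MI\<^esub> x"
      using commute[OF FG(1,2)] by (simp add: cls_mult[OF aug_M11] cls_eq_iff[OF aug_M11])
  qed
qed

section \<open>Characters and their kernels\<close>

lemma M11_character_eq:
  assumes \<chi>: "\<chi> \<in> M11_characters p" "\<chi> (cls MI y_red) = \<mu>" "\<chi> (cls MI (x_red p)) = \<alpha>" and F: "F \<in> cocyc MI"
  shows "\<chi> (cls MI F) = chi p \<alpha> \<mu> F"
proof -
  have hom: "\<chi> \<in> ring_hom (coh_ring MI) scalar_ring" and c: "\<chi> (cls MI (const_cochain c)) = c" for c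
    using \<chi>(1) by (auto simp: M11_characters_def M11_coh_def cls_def full_const)
  have in_carrier: "cls MI G \<in> carrier (coh_ring MI)" if "G \<in> cocyc MI" for G
    using that by (auto simp: carrier_coh_ring[OF aug_M11])
  have hadd: "\<chi> (cls MI (\<lambda>as. G as + H as)) = \<chi> (cls MI G) + \<chi> (cls MI H)"
    and hmult: "\<chi> (cls MI (ccup G H)) = \<chi> (cls MI G) * \<chi> (cls MI H)" if "G \<in> cocyc MI" "H \<in> cocyc MI" for G H
    using ring_hom_add[OF hom in_carrier in_carrier] ring_hom_mult[OF hom in_carrier in_carrier] that
    by (auto simp: cls_add[OF aug_M11] cls_mult[OF aug_M11] scalar_ring_def)
  show ?thesis
    using F
  proof (induction rule: cocyc_generated)
    case (const c) then show ?case by (simp add: c chi_simps)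
  next
    case (add F G) then show ?case by (simp add: hadd chi_add)
  next
    case (y G) then show ?case by (simp add: hmult y_cocyc \<chi> chi_ccup chi_simps)
  next
    case (x G) then show ?case by (simp add: hmult x_cocyc \<chi> chi_ccup chi_simps)
  next
    case (cobound H)
    have "const_cochain 0 = (\<lambda>_ :: 'k st list. 0 :: 'k)" by (auto simp: const_cochain_def)
    then have "cls MI H = cls MI (const_cochain 0)" using cobound by (simp add: cls_eq_iff[OF aug_M11])
    then show ?case using c[of 0] chi_cobound[OF cobound.hyps] by simp
  qed
qed

lemma M11_character_exists:
  obtains \<chi> where "\<chi> \<in> M11_characters p" "\<And>F. F \<in> cocyc MI \<Longrightarrow> \<chi> (cls MI F) = chi p \<alpha> \<mu> F"
proof
  define \<chi> where "\<chi> X = (THE v. \<exists>F\<in>cocyc MI. X = cls MI F \<and> v = chi p \<alpha> \<mu> F)" for X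
  show *: "\<chi> (cls MI F) = chi p \<alpha> \<mu> F" if "F \<in> cocyc MI" for F
    unfolding \<chi>_def
  proof (rule the_equality)
    fix v assume "\<exists>G\<in>cocyc MI. cls MI F = cls MI G \<and> v = chi p \<alpha> \<mu> G"
    then obtain G where G: "G \<in> cocyc MI" "(\<lambda>as. F as - G as) \<in> cobound MI" "v = chi p \<alpha> \<mu> G"
      by (auto simp: cls_eq_iff[OF aug_M11])
    then show "v = chi p \<alpha> \<mu> F" using chi_cobound[OF G(2), of \<alpha> \<mu>] chi_diff[OF that G(1), of \<alpha> \<mu>] by simp
  qed (use that in auto)
  have "\<chi> \<in> ring_hom (M11_coh p) scalar_ring"
    unfolding M11_coh_def
    by (rule ring_hom_memI)
       (auto simp: carrier_coh_ring[OF aug_M11] cls_mult[OF aug_M11] cls_add[OF aug_M11] cls_one * scalar_ring_def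
          cocyc_ccup cocyc_add const_cochain_cocyc chi_add chi_ccup chi_simps)
  then show "\<chi> \<in> M11_characters p"
    using *[OF const_cochain_cocyc] by (simp add: M11_characters_def cls_def full_const chi_simps)
qed

text \<open>The definite description is resolved by the existence of a character with the given
  values at y and x_1 and by the fact that these values determine it.\<close>

lemma M11_point_eq: "M11_point p (\<mu>, \<alpha>) = {cls MI F | F. F \<in> cocyc MI \<and> chi p \<alpha> \<mu> F = 0}"
proof -
  note cl = y_class_eq x1_class_eq
  obtain \<chi> where \<chi>: "\<chi> \<in> M11_characters p" "\<And>F. F \<in> cocyc MI \<Longrightarrow> \<chi> (cls MI F) = chi p \<alpha> \<mu> F"
    using M11_character_exists[where \<alpha> = \<alpha> and \<mu> = \<mu>] by blast
  have ker: "a_kernel (M11_coh p) scalar_ring \<psi> = {cls MI F | F. F \<in> cocyc MI \<and> chi p \<alpha> \<mu> F = 0}"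
    if "\<psi> \<in> M11_characters p" "\<psi> (cls MI y_red) = \<mu>" "\<psi> (cls MI (x_red p)) = \<alpha>" for \<psi>
    using M11_character_eq[OF that]
    by (auto simp: a_kernel_def' M11_coh_def carrier_coh_ring[OF aug_M11] scalar_ring_def)
  show ?thesis
    unfolding M11_point_def prod.case cl
  proof (rule the_equality)
    show "\<exists>\<chi>\<in>M11_characters p. \<chi> (cls MI y_red) = \<mu> \<and> \<chi> (cls MI (x_red p)) = \<alpha> \<and>
        {cls MI F | F. F \<in> cocyc MI \<and> chi p \<alpha> \<mu> F = 0} = a_kernel (M11_coh p) scalar_ring \<chi>"
      using \<chi> ker[OF \<chi>(1)] y_cocyc x_cocyc by (intro bexI[of _ \<chi>]) (auto simp: chi_simps)
  qed (use ker in auto)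
qed

lemma M11_point_maximal: "maximalideal (M11_point p (\<mu>, \<alpha>)) (M11_coh p :: ('k st list \<Rightarrow> 'k \<Rightarrow> 'k) set ring)"
proof -
  interpret R: ring "coh_ring MI" by (rule coh_ring_ring[OF aug_M11])
  obtain \<chi> where \<chi>: "\<chi> \<in> M11_characters p" "\<And>F. F \<in> cocyc MI \<Longrightarrow> \<chi> (cls MI F) = chi p \<alpha> \<mu> F"
    using M11_character_exists[where \<alpha> = \<alpha> and \<mu> = \<mu>] by blast
  then have hom: "ring_hom_ring (coh_ring MI) scalar_ring \<chi>"
    by (intro ring_hom_ringI2 coh_ring_ring[OF aug_M11] scalar_ring_ring) (auto simp: M11_characters_def M11_coh_def)
  have eq: "M11_point p (\<mu>, \<alpha>) = a_kernel (coh_ring MI) scalar_ring \<chi>"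
    unfolding M11_point_eq using \<chi>(2)
    by (auto simp: a_kernel_def' carrier_coh_ring[OF aug_M11] scalar_ring_def)
  have one_not: "cls MI (const_cochain 1) \<notin> a_kernel (coh_ring MI) scalar_ring \<chi>"
    using \<chi>(2)[OF const_cochain_cocyc] by (simp add: a_kernel_def' scalar_ring_def chi_simps)
  show ?thesis
    unfolding eq M11_coh_def
  proof (rule maximalidealI)
    show "ideal (a_kernel (coh_ring MI) scalar_ring \<chi>) (coh_ring MI)"
      by (rule ring_hom_ring.kernel_is_ideal[OF hom])
    show "carrier (coh_ring MI) \<noteq> a_kernel (coh_ring MI) scalar_ring \<chi>"
      using one_not const_cochain_cocyc by (auto simp: carrier_coh_ring[OF aug_M11])
  next
    fix J assume J: "ideal J (coh_ring MI)" "a_kernel (coh_ring MI) scalar_ring \<chi> \<subseteq> J" "J \<subseteq> carrier (coh_ring MI)"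
    interpret J: ideal J "coh_ring MI" by (rule J(1))
    show "J = a_kernel (coh_ring MI) scalar_ring \<chi> \<or> J = carrier (coh_ring MI)"
    proof (cases "J \<subseteq> a_kernel (coh_ring MI) scalar_ring \<chi>")
      case False
      then obtain F where F: "F \<in> cocyc MI" "cls MI F \<in> J" "chi p \<alpha> \<mu> F \<noteq> 0"
      proof -
        obtain X where X: "X \<in> J" "X \<notin> a_kernel (coh_ring MI) scalar_ring \<chi>" using False by blast
        then have "X \<in> carrier (coh_ring MI)" using J(3) by blast
        then obtain F where "F \<in> cocyc MI" "X = cls MI F" by (auto simp: carrier_coh_ring[OF aug_M11])
        then show ?thesis using that[of F] X \<chi>(2)[of F] by (auto simp: a_kernel_def' carrier_coh_ring[OF aug_M11] scalar_ring_def)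
      qed
      \<comment> \<open>F differs from the nonzero scalar c by an element of the kernel, so 1 = F/c
        - (F - c)/c lies in J.\<close>
      define c where "c = chi p \<alpha> \<mu> F"
      have "cls MI (\<lambda>as. F as - const_cochain c as) \<in> a_kernel (coh_ring MI) scalar_ring \<chi>"
        using cocyc_diff[OF F(1) const_cochain_cocyc] \<chi>(2)
        by (simp add: a_kernel_def' carrier_coh_ring[OF aug_M11] scalar_ring_def chi_diff[OF F(1) const_cochain_cocyc]
            chi_simps c_def)
      then have 1: "cls MI (\<lambda>as. F as - const_cochain c as) \<in> J" using J(2) by blast
      have z: "(\<lambda>as. F as - const_cochain c as) \<in> cocyc MI" by (intro cocyc_diff F const_cochain_cocyc)
      have cc: "const_cochain e \<in> cocyc MI" for e by (rule const_cochain_cocyc)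
      have m1: "cls MI (const_cochain (1 / c)) \<otimes>\<^bsub>coh_ring MI\<^esub> cls MI F \<in> J"
        and m2: "cls MI (const_cochain (- 1 / c)) \<otimes>\<^bsub>coh_ring MI\<^esub> cls MI (\<lambda>as. F as - const_cochain c as) \<in> J"
        using J.I_l_closed F 1 cc by (auto simp: carrier_coh_ring[OF aug_M11])
      have "cls MI (\<lambda>as. ccup (const_cochain (1 / c)) F as + ccup (const_cochain (- 1 / c)) (\<lambda>as. F as - const_cochain c as) as) \<in> J"
        using J.a_closed[OF m1 m2]
        by (simp only: cls_mult[OF aug_M11 cc F(1)] cls_mult[OF aug_M11 cc z] cls_add[OF aug_M11 cocyc_ccup[OF cc F(1)] cocyc_ccup[OF cc z]])
      also have "(\<lambda>as. ccup (const_cochain (1 / c)) F as + ccup (const_cochain (- 1 / c)) (\<lambda>as. F as - const_cochain c as) as) = const_cochain 1"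
        using F(3) by (auto simp: fun_eq_iff const_cochain_def c_def field_simps)
      finally have "\<one>\<^bsub>coh_ring MI\<^esub> \<in> J" by (simp add: cls_one)
      then show ?thesis using J.one_imp_carrier by blast
    qed (use J(2) in blast)
  qed
qed

end

section \<open>Maximal ideals\<close>

text \<open>The value h(W), by Horner's rule. Powers of a single cochain are strictly associative
  and constants are central, so \<open>poly_cochain_mult\<close> is an equality of cochains and not
  merely one of classes.\<close>

definition poly_cochain :: "('k::field st list \<Rightarrow> 'k) \<Rightarrow> 'k poly \<Rightarrow> 'k st list \<Rightarrow> 'k" where
  "poly_cochain W h = fold_coeffs (\<lambda>c F as. const_cochain c as + ccup W F as) h (\<lambda>_. 0)"

lemma poly_cochain_0 [simp]: "poly_cochain W 0 = (\<lambda>_. 0)"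
  by (simp add: poly_cochain_def)

lemma const_cochain_0 [simp]: "const_cochain 0 = (\<lambda>_. 0)"
  by (auto simp: const_cochain_def)

lemma poly_cochain_pCons:
  "poly_cochain W (pCons c h) = (\<lambda>as. const_cochain c as + ccup W (poly_cochain W h) as)"
proof (cases "c = 0 \<and> h = 0")
  case False
  then have "fold_coeffs f (pCons c h) = f c \<circ> fold_coeffs f h" for f :: "'a \<Rightarrow> ('a st list \<Rightarrow> 'a) \<Rightarrow> 'a st list \<Rightarrow> 'a"
    by (auto simp: fold_coeffs_def cCons_def)
  then show ?thesis by (simp add: poly_cochain_def)
qed simp

lemma poly_cochain_add: "poly_cochain W (g + h) = (\<lambda>as. poly_cochain W g as + poly_cochain W h as)"
proof (induction g h rule: poly_induct2)
  case (pCons a g b h)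
  then show ?case
    by (simp add: poly_cochain_pCons ccup_add_right) (auto simp: fun_eq_iff const_cochain_def)
qed simp

lemma poly_cochain_smult: "poly_cochain W (smult c h) = (\<lambda>as. c * poly_cochain W h as)"
proof (induction h)
  case (pCons a h)
  then show ?case
    by (simp add: poly_cochain_pCons ccup_scale_right) (auto simp: fun_eq_iff const_cochain_def algebra_simps)
qed simp

lemma poly_cochain_mult: "poly_cochain W (g * h) = ccup (poly_cochain W g) (poly_cochain W h)"
proof (induction g)
  case (pCons a g)
  then show ?case
    by (simp add: poly_cochain_pCons poly_cochain_add poly_cochain_smult)
       (simp add: fun_eq_iff ccup_add_left ccup_assoc)
qed (simp add: fun_eq_iff)

lemma poly_cochain_cocyc: "W \<in> cocyc I \<Longrightarrow> poly_cochain W h \<in> cocyc I"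
  by (induction h) (auto simp: poly_cochain_pCons intro!: cocyc_add const_cochain_cocyc cocyc_ccup)

context
  fixes p :: nat and m :: "('k::alg_closed_field st list \<Rightarrow> 'k \<Rightarrow> 'k) set set"
  assumes p2: "p \<ge> 2" and char2: "(2 :: 'k) \<noteq> 0" and maximal: "maximalideal m (M11_coh p)"
begin

lemma m_max: "maximalideal m (coh_ring (M11_ideal p))"
  using maximal by (simp add: M11_coh_def)

lemma m_ideal: "ideal m (coh_ring (M11_ideal p))"
  by (rule maximalideal.axioms(1)[OF m_max])

definition in_max :: "('k st list \<Rightarrow> 'k) \<Rightarrow> bool" where
  "in_max F \<longleftrightarrow> F \<in> cocyc (M11_ideal p) \<and> cls (M11_ideal p) F \<in> m"

lemma in_max_add: "in_max F \<Longrightarrow> in_max G \<Longrightarrow> in_max (\<lambda>as. F as + G as)"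
  using additive_subgroup.a_closed[OF ideal.axioms(1)[OF m_ideal], of "cls (M11_ideal p) F" "cls (M11_ideal p) G"]
  by (simp add: in_max_def cocyc_add cls_add[OF aug_M11[OF p2 char2]])

lemma in_max_ccup:
  assumes "in_max F" "G \<in> cocyc (M11_ideal p)" shows "in_max (ccup F G)" "in_max (ccup G F)"
  using ideal.I_l_closed[OF m_ideal, of "cls (M11_ideal p) F" "cls (M11_ideal p) G"]
    ideal.I_r_closed[OF m_ideal, of "cls (M11_ideal p) F" "cls (M11_ideal p) G"] assms
  by (auto simp: in_max_def cocyc_ccup cls_mult[OF aug_M11[OF p2 char2]] carrier_coh_ring[OF aug_M11[OF p2 char2]])

lemma in_max_cong: "in_max F \<Longrightarrow> (\<And>as. G as = F as) \<Longrightarrow> in_max G"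
  by (simp add: ext[of G F])

lemma in_max_scale: "in_max F \<Longrightarrow> in_max (\<lambda>as. c * F as)"
  by (rule in_max_cong[OF in_max_ccup(2)[OF _ const_cochain_cocyc[of c]]]) auto

lemma in_max_diff: "in_max F \<Longrightarrow> in_max G \<Longrightarrow> in_max (\<lambda>as. F as - G as)"
  using in_max_add[OF _ in_max_scale[of G "-1"], of F] by simp

lemma in_max_cobound: assumes "H \<in> cobound (M11_ideal p)" shows "in_max H"
proof -
  have "cls (M11_ideal p) H = \<zero>\<^bsub>coh_ring (M11_ideal p)\<^esub>"
    using assms by (simp add: cls_zero[OF aug_M11[OF p2 char2]] cls_eq_iff[OF aug_M11[OF p2 char2]])
  then show ?thesis
    using additive_subgroup.zero_closed[OF ideal.axioms(1)[OF m_ideal]] cobound_cocyc[OF p2 char2 assms]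
    by (simp add: in_max_def)
qed

lemma not_in_max_one: "\<not> in_max (const_cochain 1)"
  using ideal.one_imp_carrier[OF m_ideal] maximalideal.I_notcarr[OF m_max]
  by (auto simp: in_max_def cls_one)

lemma in_max_const: "in_max (const_cochain c) \<Longrightarrow> c = 0"
proof (rule ccontr)
  assume "in_max (const_cochain c)" "c \<noteq> 0"
  then have "in_max (\<lambda>as. (1 / c) * const_cochain c as)" by (intro in_max_scale)
  then have "in_max (const_cochain 1)" by (rule in_max_cong) (use \<open>c \<noteq> 0\<close> in \<open>simp add: const_cochain_def\<close>)
  then show False using not_in_max_one by simp
qed

lemma in_max_prime:
  assumes "F \<in> cocyc (M11_ideal p)" "G \<in> cocyc (M11_ideal p)" "in_max (ccup F G)"
  shows "in_max F \<or> in_max G"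
proof -
  interpret cring "coh_ring (M11_ideal p) :: ('k st list \<Rightarrow> 'k \<Rightarrow> 'k) set ring" by (rule M11_cring[OF p2 char2])
  show ?thesis
    using primeideal.I_prime[OF maximalideal_prime[OF m_max], of "cls (M11_ideal p) F" "cls (M11_ideal p) G"] assms
    by (auto simp: in_max_def cls_mult[OF aug_M11[OF p2 char2]] carrier_coh_ring[OF aug_M11[OF p2 char2]])
qed

lemma in_max_inverse:
  assumes F: "F \<in> cocyc (M11_ideal p)" "\<not> in_max F"
  obtains G where "G \<in> cocyc (M11_ideal p)" "in_max (\<lambda>as. const_cochain 1 as - ccup F G as)"
proof -
  interpret R: cring "coh_ring (M11_ideal p) :: ('k st list \<Rightarrow> 'k \<Rightarrow> 'k) set ring" by (rule M11_cring[OF p2 char2])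
  interpret I: maximalideal m "coh_ring (M11_ideal p)" by (rule m_max)
  let ?R = "coh_ring (M11_ideal p) :: ('k st list \<Rightarrow> 'k \<Rightarrow> 'k) set ring"
    and ?c = "cls (M11_ideal p) :: ('k st list \<Rightarrow> 'k) \<Rightarrow> _"
  have car: "?c H \<in> carrier ?R" if "H \<in> cocyc (M11_ideal p)" for H
    using that by (auto simp: carrier_coh_ring[OF aug_M11[OF p2 char2]])
  have P: "ideal (PIdl\<^bsub>?R\<^esub> (?c F)) ?R" by (rule R.cgenideal_ideal[OF car[OF F(1)]])
  let ?J = "m <+>\<^bsub>?R\<^esub> PIdl\<^bsub>?R\<^esub> (?c F)"
  have J: "ideal ?J ?R" by (rule R.add_ideals[OF m_ideal P])
  have zeroP: "\<zero>\<^bsub>?R\<^esub> \<in> PIdl\<^bsub>?R\<^esub> (?c F)" "\<zero>\<^bsub>?R\<^esub> \<in> m"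
    using additive_subgroup.zero_closed[OF ideal.axioms(1)] P m_ideal by blast+
  have "m \<subseteq> ?J"
  proof
    fix x assume x: "x \<in> m"
    then have "x \<oplus>\<^bsub>?R\<^esub> \<zero>\<^bsub>?R\<^esub> \<in> ?J" using zeroP(1) unfolding set_add_def' by blast
    then show "x \<in> ?J" using I.Icarr[OF x] by simp
  qed
  moreover have "?J \<subseteq> carrier ?R" using ideal.Icarr[OF J] by blast
  ultimately have "?J = m \<or> ?J = carrier ?R" by (intro I.I_maximal J)
  moreover have "?J \<noteq> m"
  proof
    assume "?J = m"
    have "?c F \<in> PIdl\<^bsub>?R\<^esub> (?c F)" by (rule R.cgenideal_self[OF car[OF F(1)]])
    then have "\<zero>\<^bsub>?R\<^esub> \<oplus>\<^bsub>?R\<^esub> ?c F \<in> ?J" using zeroP unfolding set_add_def' by blast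
    then have "?c F \<in> m" using car[OF F(1)] \<open>?J = m\<close> by simp
    then show False using F by (simp add: in_max_def)
  qed
  ultimately have "\<one>\<^bsub>?R\<^esub> \<in> ?J" by simp
  then obtain i r where ir: "i \<in> m" "r \<in> carrier ?R" "\<one>\<^bsub>?R\<^esub> = i \<oplus>\<^bsub>?R\<^esub> (r \<otimes>\<^bsub>?R\<^esub> ?c F)"
    by (auto simp: set_add_def' cgenideal_def)
  obtain K where K: "K \<in> cocyc (M11_ideal p)" "i = ?c K"
    using I.Icarr[OF ir(1)] by (auto simp: carrier_coh_ring[OF aug_M11[OF p2 char2]])
  obtain G where G: "G \<in> cocyc (M11_ideal p)" "r = ?c G"
    using ir(2) by (auto simp: carrier_coh_ring[OF aug_M11[OF p2 char2]])
  have "?c (const_cochain 1) = ?c (\<lambda>as. K as + ccup G F as)"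
    using ir(3) K G F(1) by (simp add: cls_one cls_mult[OF aug_M11[OF p2 char2]] cls_add[OF aug_M11[OF p2 char2]] cocyc_ccup)
  then have b: "(\<lambda>as. const_cochain 1 as - (K as + ccup G F as)) \<in> cobound (M11_ideal p)"
    by (simp add: cls_eq_iff[OF aug_M11[OF p2 char2]])
  have "in_max K" using K ir(1) by (simp add: in_max_def)
  \<comment> \<open>The principal ideal yields the product G F; \<open>commute\<close> replaces it
    by F G modulo a coboundary.\<close>
  then have "in_max (\<lambda>as. ((const_cochain 1 as - (K as + ccup G F as)) + K as) - (ccup F G as - ccup G F as))"
    by (rule in_max_diff[OF in_max_add[OF in_max_cobound[OF b]] in_max_cobound[OF commute[OF p2 char2 F(1) G(1)]]])
  then have "in_max (\<lambda>as. const_cochain 1 as - ccup F G as)"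
    by (rule in_max_cong) simp
  then show ?thesis using that G(1) by blast
qed

text \<open>H/m is a domain and P splits into linear factors over k, so one of the factors W - c
  must already be in m.\<close>

lemma in_max_poly_root:
  assumes W: "W \<in> cocyc (M11_ideal p)"
  shows "P \<noteq> 0 \<Longrightarrow> in_max (poly_cochain W P) \<Longrightarrow> \<exists>c. in_max (\<lambda>as. W as - const_cochain c as)"
proof (induction "degree P" arbitrary: P rule: less_induct)
  case less
  show ?case
  proof (cases "degree P = 0")
    case True
    then obtain c where "P = [:c:]" by (rule degree_eq_zeroE)
    then show ?thesis using less.prems in_max_const[of c] by (simp add: poly_cochain_pCons)
  next
    case False
    then obtain z where "poly P z = 0" using alg_closed_imp_poly_has_root by blast
    then obtain Q where Q: "P = [:- z, 1:] * Q" using poly_eq_0_iff_dvd[of P z] by (auto simp: dvd_def)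
    then have "Q \<noteq> 0" using less.prems by auto
    then have "degree Q < degree P" unfolding Q by (subst degree_mult_eq) auto
    have "in_max (poly_cochain W [:- z, 1:]) \<or> in_max (poly_cochain W Q)"
      using less.prems(2) unfolding Q poly_cochain_mult by (intro in_max_prime poly_cochain_cocyc W)
    then show ?thesis
    proof
      assume "in_max (poly_cochain W [:- z, 1:])"
      then have "in_max (\<lambda>as. W as - const_cochain z as)"
        by (rule in_max_cong) (simp add: poly_cochain_pCons, simp add: const_cochain_def)
      then show ?thesis by blast
    next
      assume "in_max (poly_cochain W Q)"
      then show ?thesis using less.hyps \<open>Q \<noteq> 0\<close> \<open>degree Q < degree P\<close> by blast
    qed
  qed
qed

text \<open>The Nullstellensatz for one generator. Modulo m everything is a polynomial in W,
  including an inverse h(W) of W if W is not in m. Then 1 - W h(W) lies in m, and the polynomial 1 -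
  X h(X) is nonzero since its constant term is 1.\<close>

lemma in_max_generated_root:
  assumes W: "W \<in> cocyc (M11_ideal p)"
    and Y: "in_max (\<lambda>as. y_red as - poly_cochain W hy as)"
    and X: "in_max (\<lambda>as. x_red p as - poly_cochain W hx as)"
  shows "\<exists>c. in_max (\<lambda>as. W as - const_cochain c as)"
proof -
  have gen: "\<exists>h. in_max (\<lambda>as. F as - poly_cochain W h as)" if "F \<in> cocyc (M11_ideal p)" for F
  proof -
    have mult: "\<exists>h. in_max (\<lambda>as. ccup V G as - poly_cochain W h as)"
      if V: "in_max (\<lambda>as. V as - poly_cochain W hv as)" "G \<in> cocyc (M11_ideal p)"
        "\<exists>h. in_max (\<lambda>as. G as - poly_cochain W h as)" for V G hv
    proof -
      obtain h where h: "in_max (\<lambda>as. G as - poly_cochain W h as)" using V(3) by blast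
      have "in_max (\<lambda>as. ccup (\<lambda>as. V as - poly_cochain W hv as) G as +
          ccup (poly_cochain W hv) (\<lambda>as. G as - poly_cochain W h as) as)"
        by (intro in_max_add in_max_ccup V(1,2) h poly_cochain_cocyc W)
      then have "in_max (\<lambda>as. ccup V G as - poly_cochain W (hv * h) as)"
        by (rule in_max_cong) (simp add: poly_cochain_mult ccup_diff_left ccup_diff_right)
      then show ?thesis by blast
    qed
    show ?thesis
      using that
    proof (induction rule: cocyc_generated[OF p2 char2, consumes 1, case_names const add y x cobound])
      case (const c)
      have "in_max (\<lambda>as. const_cochain c as - poly_cochain W [:c:] as)"
        using in_max_cobound[OF cobound_zero] by (simp add: poly_cochain_pCons)
      then show ?case by blast
    next
      case (add F G)
      then obtain h g where "in_max (\<lambda>as. F as - poly_cochain W h as)" "in_max (\<lambda>as. G as - poly_cochain W g as)" by blast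
      from in_max_add[OF this] have "in_max (\<lambda>as. (F as + G as) - poly_cochain W (h + g) as)"
        by (rule in_max_cong) (simp add: poly_cochain_add)
      then show ?case by blast
    next
      case (y G) then show ?case using mult[OF Y] by blast
    next
      case (x G) then show ?case using mult[OF X] by blast
    next
      case (cobound H)
      then have "in_max (\<lambda>as. H as - poly_cochain W 0 as)" by (simp add: in_max_cobound)
      then show ?case by blast
    qed
  qed
  show ?thesis
  proof (cases "in_max W")
    case True
    then have "in_max (\<lambda>as. W as - const_cochain 0 as)" by simp
    then show ?thesis by blast
  next
    case False
    then obtain G where G: "G \<in> cocyc (M11_ideal p)" "in_max (\<lambda>as. const_cochain 1 as - ccup W G as)"
      using in_max_inverse[OF W] by blast
    obtain h where h: "in_max (\<lambda>as. G as - poly_cochain W h as)" using gen[OF G(1)] by blast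
    have "in_max (\<lambda>as. (const_cochain 1 as - ccup W G as) + ccup W (\<lambda>as. G as - poly_cochain W h as) as)"
      by (intro in_max_add G in_max_ccup h W)
    then have "in_max (poly_cochain W (pCons 1 (- h)))"
      by (rule in_max_cong)
         (use poly_cochain_smult[of W "-1" h] in \<open>simp add: poly_cochain_pCons ccup_diff_right ccup_neg_right\<close>)
    then show ?thesis by (intro in_max_poly_root[OF W]) auto
  qed
qed

lemma maximal_eq_point:
  assumes Y: "in_max (\<lambda>as. y_red as - const_cochain \<mu> as)"
    and X: "in_max (\<lambda>as. x_red p as - const_cochain \<alpha> as)"
  shows "m = M11_point p (\<mu>, \<alpha>)"
proof -
  have gen: "in_max (\<lambda>as. F as - const_cochain (chi p \<alpha> \<mu> F) as)" if "F \<in> cocyc (M11_ideal p)" for F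
  proof -
    have mult: "in_max (\<lambda>as. ccup V G as - const_cochain (chi p \<alpha> \<mu> (ccup V G)) as)"
      if "in_max (\<lambda>as. V as - const_cochain (chi p \<alpha> \<mu> V) as)" "V \<in> cocyc (M11_ideal p)" "G \<in> cocyc (M11_ideal p)"
        "in_max (\<lambda>as. G as - const_cochain (chi p \<alpha> \<mu> G) as)" for V G
    proof -
      have "in_max (\<lambda>as. ccup (\<lambda>as. V as - const_cochain (chi p \<alpha> \<mu> V) as) G as +
          chi p \<alpha> \<mu> V * (G as - const_cochain (chi p \<alpha> \<mu> G) as))"
        by (intro in_max_add in_max_ccup in_max_scale that)
      then show ?thesis
        by (rule in_max_cong)
           (simp add: chi_ccup[OF p2 char2 that(2,3)] ccup_diff_left algebra_simps, simp add: const_cochain_def)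
    qed
    show ?thesis
      using that
    proof (induction rule: cocyc_generated[OF p2 char2, consumes 1, case_names const add y x cobound])
      case (const c)
      show ?case using in_max_cobound[OF cobound_zero] by (simp add: chi_simps[OF p2 char2])
    next
      case (add F G)
      from in_max_add[OF add.IH] show ?case
        by (rule in_max_cong) (simp add: chi_add[OF p2 char2 add.hyps(1,2)], simp add: const_cochain_def)
    next
      case (y G) then show ?case using Y y_cocyc[OF p2 char2] by (intro mult) (simp_all add: chi_simps[OF p2 char2])
    next
      case (x G) then show ?case using X x_cocyc[OF p2 char2] by (intro mult) (simp_all add: chi_simps[OF p2 char2])
    next
      case (cobound H)
      then show ?case by (simp add: in_max_cobound chi_cobound[OF p2 char2])
    qed
  qed
  have iff: "in_max F \<longleftrightarrow> chi p \<alpha> \<mu> F = 0" if "F \<in> cocyc (M11_ideal p)" for F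
  proof
    assume "in_max F"
    from in_max_diff[OF this gen[OF that]] have "in_max (const_cochain (chi p \<alpha> \<mu> F))"
      by (rule in_max_cong) simp
    then show "chi p \<alpha> \<mu> F = 0" by (rule in_max_const)
  next
    assume "chi p \<alpha> \<mu> F = 0"
    then show "in_max F" using gen[OF that] by simp
  qed
  have "m \<subseteq> cls (M11_ideal p) ` cocyc (M11_ideal p)"
    using ideal.Icarr[OF m_ideal] by (auto simp: carrier_coh_ring[OF aug_M11[OF p2 char2]])
  then show ?thesis
    unfolding M11_point_eq[OF p2 char2] using iff by (auto simp: in_max_def)
qed

text \<open>For \<mu> \<noteq> 0 the relation makes x_1 a multiple of y^2 modulo m, so y generates.
  For \<mu> = 0 it puts y^2, hence y, into m, and x_1 generates.\<close>

lemma maximal_on_line: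
  assumes "\<not> (\<mu> = 0 \<and> \<alpha> = 0)"
    and q: "in_max (\<lambda>as. \<alpha> * ccup y_red y_red as - \<mu>\<^sup>2 * x_red p as)"
  shows "m \<in> affine_line p (\<mu>, \<alpha>)"
proof -
  have line: "\<exists>c. m = M11_point p (c * \<mu>, c\<^sup>2 * \<alpha>) \<Longrightarrow> ?thesis" by (auto simp: affine_line_def)
  have V: "in_max (\<lambda>as. V as - poly_cochain V [:0, 1:] as)" for V
    using in_max_cobound[OF cobound_zero] by (simp add: poly_cochain_pCons)
  show ?thesis
  proof (cases "\<mu> = 0")
    case False
    have "in_max (\<lambda>as. (- 1 / \<mu>\<^sup>2) * (\<alpha> * ccup y_red y_red as - \<mu>\<^sup>2 * x_red p as))"
      by (rule in_max_scale[OF q])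
    then have X: "in_max (\<lambda>as. x_red p as - (\<alpha> / \<mu>\<^sup>2) * ccup y_red y_red as)"
      by (rule in_max_cong) (use False in \<open>simp add: field_simps\<close>)
    have "in_max (\<lambda>as. x_red p as - poly_cochain y_red [:0, 0, \<alpha> / \<mu>\<^sup>2:] as)"
      by (rule in_max_cong[OF X]) (simp add: poly_cochain_pCons ccup_scale_right del: times_divide_eq_left)
    then obtain l where l: "in_max (\<lambda>as. y_red as - const_cochain l as)"
      using in_max_generated_root[OF y_cocyc[OF p2 char2] V] by blast
    define c where "c = l / \<mu>"
    have l_eq: "l = c * \<mu>" using False by (simp add: c_def)
    have "in_max (\<lambda>as. ccup (\<lambda>as. y_red as - const_cochain l as) y_red as + l * (y_red as - const_cochain l as))"
      by (intro in_max_add in_max_ccup in_max_scale l y_cocyc[OF p2 char2])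
    then have "in_max (\<lambda>as. (x_red p as - (\<alpha> / \<mu>\<^sup>2) * ccup y_red y_red as) + (\<alpha> / \<mu>\<^sup>2) *
         (ccup (\<lambda>as. y_red as - const_cochain l as) y_red as + l * (y_red as - const_cochain l as)))"
      by (rule in_max_add[OF X in_max_scale])
    then have "in_max (\<lambda>as. x_red p as - const_cochain (c\<^sup>2 * \<alpha>) as)"
      by (rule in_max_cong)
         (use False in \<open>simp add: ccup_diff_left, simp add: const_cochain_def l_eq field_simps power2_eq_square\<close>)
    then have "m = M11_point p (c * \<mu>, c\<^sup>2 * \<alpha>)" using l by (intro maximal_eq_point) (simp_all add: l_eq)
    then show ?thesis by (intro line) blast
  next
    case True
    then have a: "\<alpha> \<noteq> 0" using assms by simp
    have "in_max (\<lambda>as. (1 / \<alpha>) * (\<alpha> * ccup y_red y_red as - \<mu>\<^sup>2 * x_red p as))"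
      by (rule in_max_scale[OF q])
    then have "in_max (ccup y_red y_red)" by (rule in_max_cong) (use True a in simp)
    then have Y: "in_max y_red" using in_max_prime[OF y_cocyc[OF p2 char2] y_cocyc[OF p2 char2]] by blast
    then obtain l where l: "in_max (\<lambda>as. x_red p as - const_cochain l as)"
      using in_max_generated_root[OF x_cocyc[OF p2 char2] _ V, of 0] by auto
    \<comment> \<open>On this line y is identically 0, so only c^2 enters the coordinates and either
      square root of l/\<alpha> will do.\<close>
    obtain c where c: "c ^ 2 = l / \<alpha>" using nth_root_exists[of 2 "l / \<alpha>"] by auto
    have "m = M11_point p (c * \<mu>, c\<^sup>2 * \<alpha>)"
      using l Y by (intro maximal_eq_point) (simp_all add: c a True)
    then show ?thesis by (intro line) blast
  qed
qed

end

section \<open>The supermodule \<open>L\<close>\<close>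

lemma L_smod_sel [simp]:
  "scl (L_smod p (\<mu>, \<alpha>)) = lscale" "s_act (L_smod p (\<mu>, \<alpha>)) = L_s p \<mu>" "t_act (L_smod p (\<mu>, \<alpha>)) = L_t p \<alpha>"
  by (simp_all add: L_smod_def)

lemma L_part: "part (L_smod p (\<mu>, \<alpha>)) i = {v. \<forall>j n. v j n \<noteq> 0 \<longrightarrow> j = i \<and> n < p}"
  by (simp add: L_smod_def)

lemma L_carrier: "smod_carrier (L_smod p (\<mu>, \<alpha>)) = {v. \<forall>j n. v j n \<noteq> 0 \<longrightarrow> n < p}"
proof (intro subset_antisym subsetI)
  fix v assume "v \<in> smod_carrier (L_smod p (\<mu>, \<alpha>))"
  then obtain x y where v: "v = x + y" "x \<in> part (L_smod p (\<mu>, \<alpha>)) 0" "y \<in> part (L_smod p (\<mu>, \<alpha>)) 1"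
    by (auto simp: smod_carrier_def)
  have "n < p" if "v j n \<noteq> 0" for j n
    using that v by (cases "x j n = 0") (auto simp: L_part)
  then show "v \<in> {v. \<forall>j n. v j n \<noteq> 0 \<longrightarrow> n < p}" by simp
next
  fix v :: "'a lvec" assume v: "v \<in> {v. \<forall>j n. v j n \<noteq> 0 \<longrightarrow> n < p}"
  define x y where "x = (\<lambda>j n. if j = 0 then v j n else 0)" and "y = (\<lambda>j n. if j = 0 then 0 else v j n)"
  have "v = x + y" by (auto simp: fun_eq_iff x_def y_def)
  moreover have "x \<in> part (L_smod p (\<mu>, \<alpha>)) 0" "y \<in> part (L_smod p (\<mu>, \<alpha>)) 1"
    using v by (auto simp: L_part x_def y_def split: if_splits)
  ultimately show "v \<in> smod_carrier (L_smod p (\<mu>, \<alpha>))" unfolding smod_carrier_def by blast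
qed

lemma L_part_carrier: "v \<in> part (L_smod p (\<mu>, \<alpha>)) i \<Longrightarrow> v \<in> smod_carrier (L_smod p (\<mu>, \<alpha>))"
  by (auto simp: L_part L_carrier)

lemma lscale_apply [simp]: "lscale c v i n = c * v i n"
  by (simp add: lscale_def)

text \<open>If \<open>1 \<union> F\<close> is the coboundary of \<open>g\<close>, then the coordinate of \<open>g\<close> at \<open>x\<^sub>0\<close> is a cochain with values in the
  dual of \<open>L\<close>. Evaluating its coboundary at \<open>x\<^sub>0\<close> and at \<open>y\<^bsub>p-2\<^esub>\<close> gives two equations whose combination
  is \<open>F(c) = 0\<close>.\<close>

lemma L_support_ev:
  fixes F :: "'k::field st list \<Rightarrow> 'k"
  assumes p: "p \<ge> 3" "odd p" and F: "F \<in> cocyc (M11_ideal p)"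
    and g: "bar_cochain (M11_ideal p) (L_smod p (\<mu>, \<alpha>)) (L_smod p (\<mu>, \<alpha>)) 1 g"
    and dg: "\<And>j m as. m \<in> part (L_smod p (\<mu>, \<alpha>)) j \<Longrightarrow>
        bar_diff (L_smod p (\<mu>, \<alpha>)) g as m = koszul (of_nat (length as - 1) * j) (scl (L_smod p (\<mu>, \<alpha>)) (full F as 1) m)"
  shows "ev_at p \<alpha> \<mu> False n F = 0"
proof -
  let ?M = "L_smod p (\<mu>, \<alpha>)" and ?C = "smod_carrier (L_smod p (\<mu>, \<alpha>))"
  have p2: "p \<ge> 2" using p by simp
  note g' = g[unfolded bar_cochain_def L_smod_sel]
  have g0: "g [] = 0" using g' by (elim conjE)
  have gs: "\<forall>as c. \<forall>v\<in>?C. g as (lscale c v) = lscale c (g as v)" using g' by - (elim conjE, assumption)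
  have ga: "\<forall>as bs a b. g (as @ (a + b) # bs) = g (as @ a # bs) + g (as @ b # bs)" using g' by - (elim conjE, assumption)
  have gc: "\<forall>as bs a c. \<forall>v\<in>?C. g (as @ [:[:c:]:] * a # bs) v = lscale c (g (as @ a # bs) v)"
    using g' by - (elim conjE, assumption)
  have gI: "\<forall>as bs. \<forall>a\<in>M11_ideal p. g (as @ a # bs) = 0" using g' by - (elim conjE, assumption)
  have gS: "\<forall>a as. \<forall>v\<in>?C. g (a # as) (L_s p \<mu> v) + g (s_gen * a # as) v = L_s p \<mu> (g (a # as) v)"
    using g' by - (elim conjE, assumption)
  have gT: "\<forall>a as j. \<forall>v\<in>part ?M j. g (a # as) (L_t p \<alpha> v) + koszul j (g (t_gen * a # as) v) =
        koszul (of_nat (length as) + 1) (L_t p \<alpha> (g (a # as) v))"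
    using g' by - (elim conjE, assumption)
  define G where "G v as = g as v 0 0" for v as
  have G0: "G v [] = 0" for v by (simp add: G_def g0)
  have ml: "multilin (M11_ideal p) (G v)" if v: "v \<in> ?C" for v
    unfolding multilin_def
  proof (intro allI lin_onI)
    fix as bs a b c
    show "G v (as @ (a + b) # bs) = G v (as @ a # bs) + G v (as @ b # bs)" by (simp add: G_def ga)
    show "G v (as @ smult [:c:] a # bs) = c * G v (as @ a # bs)"
      using gc[rule_format, OF v, of as c a bs] by (simp add: G_def)
    show "a \<in> M11_ideal p \<Longrightarrow> G v (as @ a # bs) = 0" by (simp add: G_def gI)
  qed
  have sC: "L_s p \<mu> v \<in> ?C" for v using p2 by (auto simp: L_carrier L_s_eq split: if_splits)
  \<comment> \<open>Images of s and t have zero x_0-coordinate. Hence the right-hand sides of the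
    linearity conditions drop out, and s and t can be moved from the bar entry onto the vector at
    the cost of a sign.\<close>
  have Gs: "G v (s_gen * a # as) = - G (L_s p \<mu> v) (a # as)" if "v \<in> ?C" for v a as
  proof -
    have "g (a # as) (L_s p \<mu> v) 0 0 + g (s_gen * a # as) v 0 0 = L_s p \<mu> (g (a # as) v) 0 0"
      using gS[rule_format, OF that, of a as] by (metis plus_fun_apply)
    then show ?thesis using p2 by (simp add: G_def L_s_eq eq_neg_iff_add_eq_0 add.commute)
  qed
  have Gsn: "G v (s_gen ^ k # as) = (- 1) ^ k * G ((L_s p \<mu> ^^ k) v) (1 # as)" if "v \<in> ?C" for v k as
    using that
  proof (induction k arbitrary: v)
    case (Suc k)
    have "G v (s_gen ^ Suc k # as) = - G (L_s p \<mu> v) (s_gen ^ k # as)" using Gs[OF Suc.prems] by simp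
    also have "\<dots> = - ((- 1) ^ k * G ((L_s p \<mu> ^^ k) (L_s p \<mu> v)) (1 # as))" by (simp only: Suc.IH[OF sC])
    finally show ?case by (simp add: funpow_swap1)
  qed simp
  have Gt: "G v (t_gen # as) = - koszul j (G (L_t p \<alpha> v) (1 # as))" if "v \<in> part ?M j" for v j as
  proof -
    have "g (1 # as) (L_t p \<alpha> v) + koszul j (g (t_gen # as) v) = koszul (of_nat (length as) + 1) (L_t p \<alpha> (g (1 # as) v))"
      using gT[rule_format, OF that, of 1 as] by simp
    then have "(g (1 # as) (L_t p \<alpha> v) + koszul j (g (t_gen # as) v)) 0 0 = koszul (of_nat (length as) + 1) (L_t p \<alpha> (g (1 # as) v)) 0 0"
      by simp
    then show ?thesis using p2 by (auto simp: G_def koszul_def L_t_eq add_eq_0_iff split: if_splits)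
  qed
  have Gscale: "G (lscale c v) as = c * G v as" if "v \<in> ?C" for c v as
    using gs that by (simp add: G_def)
  \<comment> \<open>At leading entry 1 the coboundary of g consists of G v and a
    \<open>tdiff\<close> term, and \<open>ev_tdiff\<close> kills the latter. For odd v the scalar
    term has no x_0-coordinate.\<close>
  have key: "ev_at p \<alpha> \<mu> b n (G v) = (if j = 0 then v 0 0 * ev_at p \<alpha> \<mu> b n F else 0)"
    if v: "v \<in> part ?M j" for v j b
  proof -
    have vC: "v \<in> ?C" using L_part_carrier[OF v] .
    have "G v as + tdiff (\<lambda>bs. G v (1 # bs)) as = (if j = 0 then v 0 0 * F as else 0)" for as
    proof -
      have "bar_diff ?M g (1 # as) v 0 0 = - tdiff (G v) (1 # as)"
        unfolding G_def by (rule tdiff_bar_diff[where \<pi> = "\<lambda>v. v 0 0"]) (simp_all add: g0)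
      moreover have "bar_diff ?M g (1 # as) v 0 0 = (if j = 0 then v 0 0 * F as else 0)"
      proof (cases "j = 0")
        case True
        then show ?thesis by (simp add: dg[OF v] full_def)
      next
        case False
        then have "v 0 0 = 0" using v by (auto simp: L_part)
        then show ?thesis using False by (simp add: dg[OF v] koszul_def)
      qed
      moreover have "absorb 1 (G v) as = G v as" by (cases as) (auto simp: G0)
      ultimately show ?thesis by (simp add: G_def)
    qed
    then have "ev_at p \<alpha> \<mu> b n (\<lambda>as. G v as + tdiff (\<lambda>bs. G v (1 # bs)) as) = ev_at p \<alpha> \<mu> b n (\<lambda>as. if j = 0 then v 0 0 * F as else 0)"
      by simp
    moreover have "ev_at p \<alpha> \<mu> b n (\<lambda>as. c * H as) = c * ev_at p \<alpha> \<mu> b n H" for c and H :: "'k st list \<Rightarrow> 'k"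
    proof (induction n arbitrary: b H)
      case 0 then show ?case by (cases b) auto
    next
      case (Suc n) then show ?case by (cases b) (auto simp: algebra_simps)
    qed
    ultimately show ?thesis
      using ev_tdiff[OF additive_id multilin_prepend[OF ml[OF vC]] p2]
      by (cases "j = 0") (simp_all add: ev_add[OF additive_id] ev_zero[OF additive_id])
  qed
  show ?thesis
  proof (cases n)
    case 0
    have "xvec p 0 \<in> part ?M 0" using p by (auto simp: L_part xvec_def)
    then show ?thesis using key[of "xvec p 0" 0, where b = False] 0 p by (simp add: G0 xvec_def)
  next
    case (Suc l)
    have xp: "xvec p i \<in> part ?M 0" and yp: "yvec p i \<in> part ?M 1" for i
      by (auto simp: L_part xvec_def yvec_def split: if_splits)
    note xC = L_part_carrier[OF xp] and yC = L_part_carrier[OF yp]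
    have sx: "(L_s p \<mu> ^^ (p - 1)) (xvec p 0) = lscale (- (\<mu>\<^sup>2)) (xvec p (p - 1))"
      using p by (auto simp: fun_eq_iff L_s_pow xvec_def)
    have tx: "L_t p \<alpha> (xvec p 0) = lscale \<alpha> (yvec p (p - 1))"
      using p by (auto simp: fun_eq_iff L_t_eq xvec_def yvec_def)
    have sy: "L_s p \<mu> (yvec p (p - 2)) = yvec p (p - 1)"
      using p by (auto simp: fun_eq_iff L_s_eq yvec_def)
    have ty: "L_t p \<alpha> (yvec p (p - 2)) = xvec p (p - 1)"
      using p by (auto simp: fun_eq_iff L_t_eq yvec_def xvec_def)
    \<comment> \<open>The first bar entry carries x_0 and y_(p-2) to multiples of x_(p-1) and
      y_(p-1), so A and B are the only unknowns. The vector x_0 makes the value of F equal to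
      -\<alpha>\<mu>(\<mu>A + B), and y_(p-2) gives 0 = -(B + \<mu>A).\<close>
    define A where "A = ev_at p \<alpha> \<mu> True l (\<lambda>as. G (xvec p (p - 1)) (1 # as))"
    define B where "B = ev_at p \<alpha> \<mu> False l (\<lambda>as. G (yvec p (p - 1)) (1 # as))"
    have sc: "ev_at p \<alpha> \<mu> b l (\<lambda>as. c * H as) = c * ev_at p \<alpha> \<mu> b l H" for c b and H :: "'k st list \<Rightarrow> 'k"
    proof (induction l arbitrary: b H)
      case 0 then show ?case by (cases b) auto
    next
      case (Suc n) then show ?case by (cases b) (auto simp: algebra_simps)
    qed
    \<comment> \<open>Moving s^(p-1) onto the vector costs (-1)^(p-1), which is 1 as p is odd;
      otherwise the two equations would not match.\<close>
    have ev: "even (p - 1)" using p by simp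
    have "G (xvec p 0) (s_gen ^ (p - 1) # as) = - (\<mu>\<^sup>2) * G (xvec p (p - 1)) (1 # as)"
      "G (xvec p 0) (t_gen # as) = (- \<alpha>) * G (yvec p (p - 1)) (1 # as)" for as
      unfolding Gsn[OF xC] Gt[OF xp] sx tx Gscale[OF xC] Gscale[OF yC] using ev by simp_all
    then have 1: "ev_at p \<alpha> \<mu> False n (G (xvec p 0)) = \<alpha> * (- (\<mu>\<^sup>2) * A) + \<mu> * (- \<alpha> * B)"
      unfolding Suc ev.simps A_def B_def sc[symmetric] by simp
    have "G (yvec p (p - 2)) (s_gen # as) = (- 1) * G (yvec p (p - 1)) (1 # as)"
      "G (yvec p (p - 2)) (t_gen # as) = G (xvec p (p - 1)) (1 # as)" for as
      using Gs[OF yC[of "p - 2"], of 1 as] unfolding Gt[OF yp] sy ty by (simp_all add: koszul_def)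
    then have 2: "ev_at p \<alpha> \<mu> True n (G (yvec p (p - 2))) = (- 1) * B - \<mu> * A"
      unfolding Suc ev.simps A_def B_def sc[symmetric] by simp
    have "ev_at p \<alpha> \<mu> False n F = \<alpha> * (- (\<mu>\<^sup>2) * A) + \<mu> * (- \<alpha> * B)"
      using key[OF xp[of 0], where b = False] 1 p by (simp add: xvec_def)
    moreover have "- B = \<mu> * A" using key[OF yp[of "p - 2"], where b = True] 2 by simp
    then have "B = - (\<mu> * A)" by (metis minus_minus)
    ultimately show ?thesis by (simp add: power2_eq_square)
  qed
qed

text \<open>A cochain on \<open>L\<close> with values in \<open>L\<close> is a cochain with values in the module of endomorphisms of \<open>L\<close>,
  on which \<open>s\<close> and \<open>t\<close> act by \<open>ad_s\<close> and \<open>ad_t\<close>. The sign in \<open>ad_t\<close> depends only on the parity of the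
  argument since the vector stands to the left of the bar resolution. The operators \<open>Y_op\<close> and \<open>X_op\<close>
  are the values at \<open>s\<close> and \<open>t\<close> of the cochain \<open>rel_op\<close> whose coboundary is \<open>\<alpha>y\<^sup>2 - \<mu>\<^sup>2x\<^sub>1\<close>; they solve
  \<open>s\<^bsup>p-1\<^esup>Y = -\<mu>\<^sup>2\<close>, \<open>tX = \<alpha>\<close> and \<open>sX = tY\<close>.\<close>

definition sgn_op :: "'k::field lvec \<Rightarrow> 'k lvec" where
  "sgn_op v = (\<lambda>i n. if i = 0 then v i n else - v i n)"

text \<open>The identity of L, extended by zero to coordinates n \<ge> p of the ambient type. With
  it the operator identities hold for all vectors, without restriction to the carrier.\<close>

definition proj_op :: "nat \<Rightarrow> 'k::field lvec \<Rightarrow> 'k lvec" where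
  "proj_op p v = (\<lambda>i n. if n < p then v i n else 0)"

definition ad_s :: "nat \<Rightarrow> 'k::field \<Rightarrow> ('k lvec \<Rightarrow> 'k lvec) \<Rightarrow> 'k lvec \<Rightarrow> 'k lvec" where
  "ad_s p \<mu> \<Phi> v = L_s p \<mu> (\<Phi> v) - \<Phi> (L_s p \<mu> v)"

definition ad_t :: "nat \<Rightarrow> 'k::field \<Rightarrow> ('k lvec \<Rightarrow> 'k lvec) \<Rightarrow> 'k lvec \<Rightarrow> 'k lvec" where
  "ad_t p \<alpha> \<Phi> v = L_t p \<alpha> (\<Phi> (sgn_op v)) - \<Phi> (L_t p \<alpha> (sgn_op v))"

text \<open>On the basis: x_(p-1) goes to x_0 and y_(p-1) to -\<mu>^2 y_0, the rest to 0. The weight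
  on the odd part imitates the factor that s picks up at x_0, so that both parities yield the same
  scalar in \<open>ad_s_Y_top\<close>.\<close>

definition Y_op :: "nat \<Rightarrow> 'k::field \<Rightarrow> 'k lvec \<Rightarrow> 'k lvec" where
  "Y_op p \<mu> v = (\<lambda>i n. if n = 0 then (if i = 0 then v 0 (p - 1) else - (\<mu>\<^sup>2) * v 1 (p - 1)) else 0)"

text \<open>On the basis: x_(n+1) goes to \<alpha> y_n and y_(p-1) to -x_0, the rest to 0.\<close>

definition X_op :: "nat \<Rightarrow> 'k::field \<Rightarrow> 'k lvec \<Rightarrow> 'k lvec" where
  "X_op p \<alpha> v = (\<lambda>i n. if i = 0 then (if n = 0 then - v 1 (p - 1) else 0)
     else (if Suc n < p then \<alpha> * v 0 (Suc n) else 0))"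

definition lin_op :: "('k::field lvec \<Rightarrow> 'k lvec) \<Rightarrow> bool" where
  "lin_op \<Phi> \<longleftrightarrow> (\<forall>v w. \<Phi> (v + w) = \<Phi> v + \<Phi> w) \<and> (\<forall>c v. \<Phi> (lscale c v) = lscale c (\<Phi> v))"

lemma lin_op_0: "lin_op \<Phi> \<Longrightarrow> \<Phi> 0 = 0"
  unfolding lin_op_def by (metis add_cancel_right_right add_0)

lemma lin_op_comp: "lin_op \<Phi> \<Longrightarrow> lin_op \<Psi> \<Longrightarrow> lin_op (\<lambda>v. \<Phi> (\<Psi> v))"
  by (simp add: lin_op_def)

lemma lin_op_subtract: "lin_op \<Phi> \<Longrightarrow> lin_op \<Psi> \<Longrightarrow> lin_op (\<lambda>v. \<Phi> v - \<Psi> v)"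
  unfolding lin_op_def by (simp add: fun_eq_iff algebra_simps)

lemma lin_op_sum:
  assumes "lin_op \<Phi>"
  shows "\<Phi> (\<Sum>i<n. lscale (c i) (w i)) = (\<Sum>i<(n::nat). lscale (c i) (\<Phi> (w i)))"
proof (induction n)
  case 0
  show ?case by (simp only: lessThan_0 sum.empty lin_op_0[OF assms])
next
  case (Suc n)
  have "\<Phi> (v + w) = \<Phi> v + \<Phi> w" "\<Phi> (lscale c v) = lscale c (\<Phi> v)" for v w c
    using assms unfolding lin_op_def by blast+
  then show ?case by (simp only: sum.lessThan_Suc Suc.IH)
qed

lemma lin_op_diff: assumes "lin_op \<Phi>" shows "\<Phi> (v - w) = \<Phi> v - \<Phi> w"
  using assms unfolding lin_op_def by (metis add_diff_cancel diff_add_cancel)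

lemma lin_op_minus: assumes "lin_op \<Phi>" shows "\<Phi> (- w) = - \<Phi> w"
  using lin_op_diff[OF assms, of 0 w] lin_op_diff[OF assms, of 0 0] by simp

context
  fixes p :: nat
  assumes p2: "p \<ge> 2"
begin

lemma lin_L_s: "lin_op (L_s p \<mu>)" and lin_L_t: "lin_op (L_t p \<alpha>)"
  using p2 by (auto simp: lin_op_def fun_eq_iff L_s_eq L_t_eq algebra_simps)

lemma lin_proj: "lin_op (proj_op p)" and lin_Y: "lin_op (Y_op p \<mu>)" and lin_X: "lin_op (X_op p \<alpha>)"
  by (auto simp: lin_op_def fun_eq_iff sgn_op_def proj_op_def Y_op_def X_op_def algebra_simps)

lemma lin_ad_s: "lin_op \<Phi> \<Longrightarrow> lin_op (ad_s p \<mu> \<Phi>)"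
  unfolding ad_s_def[abs_def] by (intro lin_op_subtract) (rule lin_op_comp[OF lin_L_s] lin_op_comp[OF _ lin_L_s], assumption)+

lemma lin_ad_s_pow: "lin_op \<Phi> \<Longrightarrow> lin_op ((ad_s p \<mu> ^^ n) \<Phi>)"
  by (induction n) (auto intro: lin_ad_s)

lemma ad_commute: "lin_op \<Phi> \<Longrightarrow> ad_t p \<alpha> (ad_s p \<mu> \<Phi>) = ad_s p \<mu> (ad_t p \<alpha> \<Phi>)"
proof (rule ext)
  fix v assume l: "lin_op \<Phi>"
  have st: "L_t p \<alpha> (L_s p \<mu> v) = L_s p \<mu> (L_t p \<alpha> v)" for v
    using p2 by (auto simp: fun_eq_iff L_s_eq L_t_eq)
  have sk: "sgn_op (L_s p \<mu> v) = L_s p \<mu> (sgn_op v)"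
    using p2 by (auto simp: fun_eq_iff L_s_eq sgn_op_def)
  show "ad_t p \<alpha> (ad_s p \<mu> \<Phi>) v = ad_s p \<mu> (ad_t p \<alpha> \<Phi>) v"
    by (simp add: ad_t_def ad_s_def sk st lin_op_diff[OF lin_L_s] lin_op_diff[OF lin_L_t] lin_op_diff[OF l])
qed

lemma ad_t_ad_t: assumes "lin_op \<Phi>" shows "ad_t p \<alpha> (ad_t p \<alpha> \<Phi>) v = 0"
proof -
  have tt: "L_t p \<alpha> (L_t p \<alpha> v) = 0" for v
    using p2 by (auto simp: fun_eq_iff L_t_eq)
  have tk: "sgn_op (L_t p \<alpha> (sgn_op v)) = - L_t p \<alpha> v" and kk: "sgn_op (sgn_op v) = v" for v
    using p2 by (auto simp: fun_eq_iff L_t_eq sgn_op_def)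
  show ?thesis
    by (simp add: ad_t_def tk kk tt lin_op_diff[OF lin_L_t] lin_op_minus[OF lin_L_t] lin_op_diff[OF assms] lin_op_minus[OF assms] lin_op_0[OF assms] lin_op_0[OF lin_L_t])
qed

lemma ad_X: "ad_s p \<mu> (X_op p \<alpha>) = ad_t p \<alpha> (Y_op p \<mu>)"
proof -
  obtain q where "p = Suc (Suc q)" using p2 by (metis add_2_eq_Suc le_Suc_ex)
  then show ?thesis
    by (intro ext) (auto simp: ad_s_def ad_t_def L_s_eq L_t_eq X_op_def Y_op_def sgn_op_def)
qed

lemma ad_t_X: "ad_t p \<alpha> (X_op p \<alpha>) v = lscale \<alpha> (proj_op p v)"
proof -
  obtain q where "p = Suc (Suc q)" using p2 by (metis add_2_eq_Suc le_Suc_ex)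
  then show ?thesis
    by (auto simp: fun_eq_iff ad_t_def L_t_eq X_op_def sgn_op_def proj_op_def less_Suc_eq)
qed

lemma ad_proj: "ad_s p \<mu> (proj_op p) v = 0" "ad_t p \<alpha> (proj_op p) v = 0"
  using p2 by (auto simp: fun_eq_iff ad_s_def ad_t_def L_s_eq L_t_eq sgn_op_def proj_op_def)

text \<open>The binomial theorem for the difference of the commuting operations of composing with s
  on the left and on the right.\<close>

lemma ad_s_pow:
  assumes l: "lin_op \<Phi>"
  shows "(ad_s p \<mu> ^^ n) \<Phi> v i m =
    (\<Sum>k<Suc n. ((- 1) ^ k * of_nat (n choose k)) * (L_s p \<mu> ^^ (n - k)) (\<Phi> ((L_s p \<mu> ^^ k) v)) i m)"
proof -
  define c where "c n k = (- 1) ^ k * (of_nat (n choose k) :: 'a)" for n k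
  have "(ad_s p \<mu> ^^ n) \<Phi> v = (\<Sum>k<Suc n. lscale (c n k) ((L_s p \<mu> ^^ (n - k)) (\<Phi> ((L_s p \<mu> ^^ k) v))))" for v
  proof (induction n arbitrary: v)
    case 0
    show ?case by (auto simp: fun_eq_iff c_def)
  next
    case (Suc n)
    define U where "U k = (L_s p \<mu> ^^ (Suc n - k)) (\<Phi> ((L_s p \<mu> ^^ k) v))" for k
    have "L_s p \<mu> ((ad_s p \<mu> ^^ n) \<Phi> v) =
        (\<Sum>k<Suc n. lscale (c n k) (L_s p \<mu> ((L_s p \<mu> ^^ (n - k)) (\<Phi> ((L_s p \<mu> ^^ k) v)))))"
      unfolding Suc.IH by (rule lin_op_sum[OF lin_L_s])
    also have "\<dots> = (\<Sum>k<Suc n. lscale (c n k) (U k))"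
      by (intro sum.cong) (auto simp: U_def Suc_diff_le)
    finally have 1: "L_s p \<mu> ((ad_s p \<mu> ^^ n) \<Phi> v) = (\<Sum>k<Suc n. lscale (c n k) (U k))" .
    have 2: "(ad_s p \<mu> ^^ n) \<Phi> (L_s p \<mu> v) = (\<Sum>k<Suc n. lscale (c n k) (U (Suc k)))"
      unfolding Suc.IH by (intro sum.cong) (auto simp: U_def funpow_swap1)
    have c: "c (Suc n) (Suc k) = c n (Suc k) - c n k" "c (Suc n) 0 = c n 0" for k by (simp_all add: c_def algebra_simps)
    have c0: "c n (Suc n) = 0" by (simp add: c_def binomial_eq_0)
    have "(\<Sum>k<Suc n. lscale (c n k) (U k)) = (\<Sum>k<Suc (Suc n). lscale (c n k) (U k))"
      by (subst (2) sum.lessThan_Suc) (simp only: c0, auto simp: fun_eq_iff)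
    also have "\<dots> = lscale (c n 0) (U 0) + (\<Sum>k<Suc n. lscale (c n (Suc k)) (U (Suc k)))"
      by (rule sum.lessThan_Suc_shift)
    finally have 3: "(\<Sum>k<Suc n. lscale (c n k) (U k)) - (\<Sum>k<Suc n. lscale (c n k) (U (Suc k))) =
        lscale (c (Suc n) 0) (U 0) + (\<Sum>k<Suc n. lscale (c (Suc n) (Suc k)) (U (Suc k)))"
      by (simp add: c sum_subtractf[symmetric] add_diff_eq[symmetric] del: sum.lessThan_Suc)
         (intro sum.cong, auto simp: fun_eq_iff algebra_simps)
    show ?case
      unfolding funpow.simps comp_def ad_s_def[of p \<mu> "(ad_s p \<mu> ^^ n) \<Phi>"] 1 2 3
      by (subst (2) sum.lessThan_Suc_shift) (simp add: U_def)
  qed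
  then show ?thesis by (simp only: sum_lvec lscale_apply c_def)
qed

text \<open>In characteristic p the signed binomials of p - 1 are all 1, so the power is the sum of
  the s^(p-1-k) Y s^k. On a basis vector of index m only k = p - 1 - m survives, and along its path
  the factor -\<mu>^2 occurs exactly once: from s leaving x_0, or from Y on the odd part.\<close>

lemma ad_s_Y_top:
  assumes ch: "CHAR('k::field) = p"
  shows "(ad_s p \<mu> ^^ (p - 1)) (Y_op p \<mu>) v = lscale (- (\<mu>\<^sup>2)) (proj_op p (v :: 'k lvec))"
proof (intro ext)
  fix i m
  have prime: "prime p" using prime_CHAR_semidom[where ?'a = 'k] ch p2 by simp
  have c1: "(- 1) ^ k * of_nat ((p - 1) choose k) = (1 :: 'k)" if "k \<le> p - 1" for k
    using that
  proof (induction k)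
    case (Suc k)
    then have k: "Suc k < p" by simp
    have "p dvd p choose Suc k" using prime k by (intro dvd_choose_prime) auto
    then have "(of_nat (p choose Suc k) :: 'k) = 0" by (simp add: of_nat_eq_0_iff_char_dvd ch)
    moreover have "p choose Suc k = ((p - 1) choose k) + ((p - 1) choose Suc k)"
      using p2 binomial_Suc_Suc[of "p - 1" k] by simp
    ultimately have "of_nat ((p - 1) choose Suc k) = - (of_nat ((p - 1) choose k) :: 'k)"
      by (simp add: eq_neg_iff_add_eq_0 add.commute)
    then show ?case using Suc by simp
  qed simp
  define T where "T k = (L_s p \<mu> ^^ (p - 1 - k)) (Y_op p \<mu> ((L_s p \<mu> ^^ k) v)) i m" for k
  have T: "T k = (if m = p - 1 - k then (if i = 0 \<and> m \<noteq> 0 then - (\<mu>\<^sup>2) else 1) *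
      (if i = 0 then (L_s p \<mu> ^^ k) v 0 (p - 1) else - (\<mu>\<^sup>2) * (L_s p \<mu> ^^ k) v 1 (p - 1)) else 0)" if "k < p" for k
  proof (cases "p - 1 - k = 0")
    case True
    then show ?thesis by (simp add: T_def) (auto simp: Y_op_def)
  next
    case False
    then show ?thesis using p2 that by (cases i) (auto simp: T_def L_s_pow Y_op_def)
  qed
  have "(ad_s p \<mu> ^^ (p - 1)) (Y_op p \<mu>) v i m = (\<Sum>k<p. T k)"
    unfolding ad_s_pow[OF lin_Y] using p2 c1 by (intro sum.cong) (auto simp: T_def)
  also have "\<dots> = (\<Sum>k<p. if k = p - 1 - m \<and> m < p then T k else 0)"
    by (intro sum.cong) (auto simp: T)
  also have "\<dots> = (if m < p then T (p - 1 - m) else 0)"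
    using p2 by (cases "m < p") auto
  also have "\<dots> = lscale (- (\<mu>\<^sup>2)) (proj_op p v) i m"
  proof (cases "m < p")
    case True
    show ?thesis
    proof (cases "m = p - 1")
      case m: True
      then show ?thesis using p2 True by (cases i) (auto simp: T proj_op_def)
    next
      case False
      then have "0 < p - 1 - m" "p - 1 - m < p" using True by auto
      then show ?thesis using True False p2 by (cases i) (auto simp: T L_s_pow proj_op_def)
    qed
  qed (simp add: proj_op_def)
  finally show "(ad_s p \<mu> ^^ (p - 1)) (Y_op p \<mu>) v i m = lscale (- (\<mu>\<^sup>2)) (proj_op p v) i m" .
qed

end

section \<open>A relation in the support ideal\<close>

definition rel_red :: "nat \<Rightarrow> 'k::field \<Rightarrow> 'k \<Rightarrow> 'k st list \<Rightarrow> 'k" where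
  "rel_red p \<mu> \<alpha> as = \<alpha> * ccup y_red y_red as - \<mu>\<^sup>2 * x_red p as"

text \<open>The cochain D with D(1) = 0, D(s^(i+1)) = s^i Y and D(s^i t) = s^i X, the extension of s
  \<mapsto> Y, t \<mapsto> X like a derivation over the augmentation. Its defect a D(b) - D(ab) +
  \<open>counit b\<close> D(a) is \<open>rel_red\<close> times the identity.\<close>

definition rel_op :: "nat \<Rightarrow> 'k::field \<Rightarrow> 'k \<Rightarrow> 'k st \<Rightarrow> 'k lvec \<Rightarrow> 'k lvec" where
  "rel_op p \<mu> \<alpha> b v =
     (\<Sum>i<p - 1. lscale (coeff (coeff b 0) (Suc i)) ((ad_s p \<mu> ^^ i) (Y_op p \<mu>) v)) +
     (\<Sum>i<p. lscale (coeff (coeff b 1) i) ((ad_s p \<mu> ^^ i) (X_op p \<alpha>) v))"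

text \<open>This is \<open>a \<cdot> rel_op b\<close>, written without the action of \<open>a\<close> by means of the equation for the coboundary of
  \<open>rel_op\<close>.\<close>

definition rel_bar :: "nat \<Rightarrow> 'k::field \<Rightarrow> 'k \<Rightarrow> 'k st \<Rightarrow> 'k st \<Rightarrow> 'k lvec \<Rightarrow> 'k lvec" where
  "rel_bar p \<mu> \<alpha> a b v = rel_op p \<mu> \<alpha> (a * b) v - lscale (counit b) (rel_op p \<mu> \<alpha> a v) +
     lscale (rel_red p \<mu> \<alpha> [a, b]) (proj_op p v)"

definition rel_cochain :: "nat \<Rightarrow> 'k::field \<Rightarrow> 'k \<Rightarrow> 'k st list \<Rightarrow> 'k lvec \<Rightarrow> 'k lvec" where
  "rel_cochain p \<mu> \<alpha> as v =
     (if length as = 2 \<and> v \<in> smod_carrier (L_smod p (\<mu>, \<alpha>)) then rel_bar p \<mu> \<alpha> (as ! 0) (as ! 1) v else 0)"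

lemma rel_red_pair: "rel_red p \<mu> \<alpha> [a, b] = \<alpha> * (tau a * tau b) - \<mu>\<^sup>2 * carry p (coeff a 0) (coeff b 0)"
  by (simp add: rel_red_def)

lemma rel_red_cocyc: assumes "p > 0" shows "rel_red p \<mu> \<alpha> \<in> cocyc (M11_ideal p)"
  unfolding rel_red_def[abs_def]
  by (intro cocyc_diff cocyc_scale cocyc_ccup y_red_cochain x_red_M11 assms)

lemma rel_red_cocycle:
  "counit a * rel_red p \<mu> \<alpha> [b, c] - rel_red p \<mu> \<alpha> [a * b, c] + rel_red p \<mu> \<alpha> [a, b * c] - counit c * rel_red p \<mu> \<alpha> [a, b] = 0"
proof -
  have *: "carry p (coeff (a * b) 0) (coeff c 0) =
      counit a * carry p (coeff b 0) (coeff c 0) + carry p (coeff a 0) (coeff (b * c) 0) - counit c * carry p (coeff a 0) (coeff b 0)"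
    by (simp add: carry_def coeff_mult_0 counit_def algebra_simps)
  show ?thesis by (simp only: rel_red_pair tau_mult *) (simp add: algebra_simps)
qed

lemma rel_op_add: "rel_op p \<mu> \<alpha> (a + b) v = rel_op p \<mu> \<alpha> a v + rel_op p \<mu> \<alpha> b v"
  by (simp add: rel_op_def fun_eq_iff sum_lvec sum.distrib algebra_simps)

lemma rel_op_smult: "rel_op p \<mu> \<alpha> (smult [:c:] a) v = lscale c (rel_op p \<mu> \<alpha> a v)"
  by (simp add: rel_op_def fun_eq_iff sum_lvec sum_distrib_left algebra_simps)

lemma rel_op_ideal: assumes "a \<in> M11_ideal p" shows "rel_op p \<mu> \<alpha> a v = 0"
proof -
  have "coeff (coeff a 0) (Suc i) = 0" if "i < p - 1" for i using assms that by (simp add: M11_ideal_iff)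
  moreover have "coeff (coeff a 1) i = 0" if "i < p" for i using assms that by (simp add: M11_ideal_iff)
  ultimately show ?thesis by (simp add: rel_op_def fun_eq_iff sum_lvec)
qed

lemma rel_red_ideal:
  assumes "p > 0" "a \<in> M11_ideal p" shows "rel_red p \<mu> \<alpha> [a, b] = 0" "rel_red p \<mu> \<alpha> [b, a] = 0"
  using multilin_head[OF cocyc_multilin[OF rel_red_cocyc[OF assms(1), of \<mu> \<alpha>]], of "[b]"]
    multilin_second[OF cocyc_multilin[OF rel_red_cocyc[OF assms(1), of \<mu> \<alpha>]], of b "[]"] assms(2)
  by (auto simp: lin_on_def)

lemma rel_red_linear:
  "rel_red p \<mu> \<alpha> [a + a', b] = rel_red p \<mu> \<alpha> [a, b] + rel_red p \<mu> \<alpha> [a', b]"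
  "rel_red p \<mu> \<alpha> [b, a + a'] = rel_red p \<mu> \<alpha> [b, a] + rel_red p \<mu> \<alpha> [b, a']"
  "rel_red p \<mu> \<alpha> [smult [:c:] a, b] = c * rel_red p \<mu> \<alpha> [a, b]"
  "rel_red p \<mu> \<alpha> [b, smult [:c:] a] = c * rel_red p \<mu> \<alpha> [b, a]"
  by (simp_all add: rel_red_pair algebra_simps)

lemma rel_bar_linear:
  "rel_bar p \<mu> \<alpha> (a + a') b v = rel_bar p \<mu> \<alpha> a b v + rel_bar p \<mu> \<alpha> a' b v"
  "rel_bar p \<mu> \<alpha> b (a + a') v = rel_bar p \<mu> \<alpha> b a v + rel_bar p \<mu> \<alpha> b a' v"
  "rel_bar p \<mu> \<alpha> (smult [:c:] a) b v = lscale c (rel_bar p \<mu> \<alpha> a b v)"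
  "rel_bar p \<mu> \<alpha> b (smult [:c:] a) v = lscale c (rel_bar p \<mu> \<alpha> b a v)"
  by (simp_all add: rel_bar_def rel_op_add rel_op_smult rel_red_linear distrib_left distrib_right)
     (simp_all add: fun_eq_iff algebra_simps)

lemma rel_bar_ideal:
  assumes "p > 0" "a \<in> M11_ideal p" shows "rel_bar p \<mu> \<alpha> a b v = 0" "rel_bar p \<mu> \<alpha> b a v = 0"
proof -
  have "aug_ideal (M11_ideal p :: 'a st set)" by (rule aug_ideal_M11[OF assms(1)])
  then have "a * b \<in> M11_ideal p" "b * a \<in> M11_ideal p" "counit a = 0"
    using assms(2) by (auto simp: aug_ideal_def mult.commute)
  then show "rel_bar p \<mu> \<alpha> a b v = 0" "rel_bar p \<mu> \<alpha> b a v = 0"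
    using assms by (simp_all add: rel_bar_def rel_op_ideal rel_red_ideal) (simp_all add: fun_eq_iff)
qed

lemma ad_sum:
  "ad_s p \<mu> (\<lambda>v. \<Sum>i<n. lscale (c i) (\<Phi> i v)) v = (\<Sum>i<(n::nat). lscale (c i) (ad_s p \<mu> (\<Phi> i) v))"
  "ad_t p \<alpha> (\<lambda>v. \<Sum>i<n. lscale (c i) (\<Phi> i v)) v = (\<Sum>i<n. lscale (c i) (ad_t p \<alpha> (\<Phi> i) v))"
  if "p \<ge> 2"
  by (simp_all add: ad_s_def ad_t_def lin_op_sum[OF lin_L_s[OF that]] lin_op_sum[OF lin_L_t[OF that]]
      flip: sum_subtractf)
     (simp_all add: fun_eq_iff sum_lvec algebra_simps)

lemma ad_plus:
  "ad_s p \<mu> (\<lambda>v. \<Phi> v + \<Psi> v) v = ad_s p \<mu> \<Phi> v + ad_s p \<mu> \<Psi> v"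
  "ad_t p \<alpha> (\<lambda>v. \<Phi> v + \<Psi> v) v = ad_t p \<alpha> \<Phi> v + ad_t p \<alpha> \<Psi> v"
  if "p \<ge> 2"
  using lin_L_s[OF that, of \<mu>] lin_L_t[OF that, of \<alpha>] by (simp_all add: ad_s_def ad_t_def lin_op_def)

lemma ad_scale:
  "ad_s p \<mu> (\<lambda>v. lscale c (\<Phi> v)) v = lscale c (ad_s p \<mu> \<Phi> v)"
  "ad_t p \<alpha> (\<lambda>v. lscale c (\<Phi> v)) v = lscale c (ad_t p \<alpha> \<Phi> v)"
  if "p \<ge> 2"
proof -
  have 1: "L_s p \<mu> (lscale c v) = lscale c (L_s p \<mu> v)" "L_t p \<alpha> (lscale c v) = lscale c (L_t p \<alpha> v)" for v
    using lin_L_s[OF that, of \<mu>] lin_L_t[OF that, of \<alpha>] unfolding lin_op_def by blast+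
  have 2: "lscale c v - lscale c w = lscale c (v - w)" for v w by (simp add: fun_eq_iff algebra_simps)
  show "ad_s p \<mu> (\<lambda>v. lscale c (\<Phi> v)) v = lscale c (ad_s p \<mu> \<Phi> v)"
    "ad_t p \<alpha> (\<lambda>v. lscale c (\<Phi> v)) v = lscale c (ad_t p \<alpha> \<Phi> v)"
    by (simp_all only: ad_s_def ad_t_def 1 2)
qed

context
  fixes p :: nat and ty :: "'k::field itself"
  assumes p3: "p \<ge> 3" and ch: "CHAR('k) = p"
begin

lemma p_ge_2: "p \<ge> 2" using p3 by simp

lemma ad_pow_commute: "lin_op \<Phi> \<Longrightarrow> ad_t p \<alpha> ((ad_s p \<mu> ^^ n) \<Phi>) = (ad_s p \<mu> ^^ n) (ad_t p (\<alpha> :: 'k) \<Phi>)"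
  by (induction n) (simp_all add: ad_commute[OF p_ge_2] lin_ad_s_pow[OF p_ge_2])

lemma Y_top: "(ad_s p \<mu> ^^ (p - 1)) (Y_op p \<mu>) = (\<lambda>v. lscale (- (\<mu>\<^sup>2)) (proj_op p (v :: 'k lvec)))"
  by (rule ext) (rule ad_s_Y_top[OF p_ge_2 ch])

lemma ad_t_Y: "ad_t p \<alpha> ((ad_s p \<mu> ^^ i) (Y_op p \<mu>)) = (ad_s p \<mu> ^^ Suc i) (X_op p (\<alpha> :: 'k))"
  unfolding ad_pow_commute[OF lin_Y[OF p_ge_2]] ad_X[OF p_ge_2, symmetric] by (simp add: funpow_swap1)

lemma X_top: "(ad_s p \<mu> ^^ p) (X_op p \<alpha>) v = (0 :: 'k lvec)"
proof -
  have 1: "(ad_s p \<mu> ^^ p) (X_op p \<alpha>) = ad_t p \<alpha> ((ad_s p \<mu> ^^ (p - 1)) (Y_op p \<mu>))"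
    unfolding ad_t_Y using p3 by simp
  show ?thesis
    unfolding 1 Y_top ad_scale[OF p_ge_2] ad_proj[OF p_ge_2] by (simp add: fun_eq_iff)
qed

lemma ad_t_X_Suc: "ad_t p \<alpha> ((ad_s p \<mu> ^^ Suc i) (X_op p \<alpha>)) v = (0 :: 'k lvec)"
  unfolding ad_t_Y[symmetric] by (rule ad_t_ad_t[OF p_ge_2 lin_ad_s_pow[OF p_ge_2 lin_Y[OF p_ge_2]]])

text \<open>Multiplication by s shifts both sums by one. The only defect is at b = s^(p-1), where
  s^p = 0 in the algebra but s^(p-1) Y = -\<mu>^2; the X-sum closes up because s^p X = 0.\<close>

lemma ad_s_rel_op:
  "ad_s p \<mu> (rel_op p \<mu> \<alpha> b) v =
    rel_op p \<mu> \<alpha> (s_gen * b) v - lscale (counit b) (Y_op p \<mu> v) + lscale (rel_red p \<mu> \<alpha> [s_gen, b]) (proj_op p (v :: 'k lvec))"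
proof -
  obtain P where P: "p = Suc P" "P > 0" using p3 by (metis Suc_le_D Suc_le_mono numeral_3_eq_3 zero_less_Suc less_eq_Suc_le)
  define c where "c i = coeff (coeff b 0) i" for i
  define d where "d i = coeff (coeff b 1) i" for i
  define Y where "Y i = (ad_s p \<mu> ^^ i) (Y_op p \<mu>) v" for i
  define X where "X i = (ad_s p \<mu> ^^ i) (X_op p \<alpha>) v" for i
  have "carry p (coeff s_gen 0) (coeff b 0) = c P"
    using P by (cases P) (simp_all add: carry_def s_gen_def c_def coeff_pCons)
  then have q: "rel_red p \<mu> \<alpha> [s_gen, b] = - (\<mu>\<^sup>2) * c P" by (simp add: rel_red_pair)
  have YP: "Y P = lscale (- (\<mu>\<^sup>2)) (proj_op p v)" using Y_top[of \<mu>] P by (simp add: Y_def)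
  have XP: "X (Suc P) = 0" using X_top[of \<mu> \<alpha> v] P by (simp add: X_def)
  have "ad_s p \<mu> (rel_op p \<mu> \<alpha> b) v = (\<Sum>i<P. lscale (c (Suc i)) (Y (Suc i))) + (\<Sum>i<p. lscale (d i) (X (Suc i)))"
    unfolding rel_op_def[abs_def] ad_plus[OF p_ge_2] ad_sum[OF p_ge_2]
    by (simp add: c_def d_def Y_def X_def P(1))
  moreover have "rel_op p \<mu> \<alpha> (s_gen * b) v = (\<Sum>i<P. lscale (c i) (Y i)) + (\<Sum>i<P. lscale (d i) (X (Suc i)))"
  proof -
    have "(\<Sum>i<p. lscale (coeff (coeff (s_gen * b) 1) i) (X i)) = lscale 0 (X 0) + (\<Sum>i<P. lscale (d i) (X (Suc i)))"
      unfolding P(1) sum.lessThan_Suc_shift by (simp add: d_def)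
    moreover have "lscale 0 (X 0) = 0" by (simp add: fun_eq_iff)
    ultimately show ?thesis by (simp add: rel_op_def P(1) c_def Y_def X_def)
  qed
  moreover have "lscale (c 0) (Y 0) + (\<Sum>i<P. lscale (c (Suc i)) (Y (Suc i))) = (\<Sum>i<P. lscale (c i) (Y i)) + lscale (c P) (Y P)"
    by (rule trans[OF sum.lessThan_Suc_shift[symmetric] sum.lessThan_Suc])
  moreover have "(\<Sum>i<p. lscale (d i) (X (Suc i))) = (\<Sum>i<P. lscale (d i) (X (Suc i)))"
    unfolding P(1) sum.lessThan_Suc XP by (simp add: fun_eq_iff)
  moreover have "Y 0 = Y_op p \<mu> v" "c 0 = counit b" by (simp_all add: Y_def c_def counit_def)
  moreover have "lscale (rel_red p \<mu> \<alpha> [s_gen, b]) (proj_op p v) = lscale (c P) (Y P)"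
    unfolding q YP by (simp add: fun_eq_iff algebra_simps)
  ultimately show ?thesis by (simp add: algebra_simps)
qed

text \<open>t turns s^i Y into s^(i+1) X and kills s^i X for i > 0, whereas t X = \<alpha>. Hence
  only the coefficient of t in b produces a defect.\<close>

lemma ad_t_rel_op:
  "ad_t p \<alpha> (rel_op p \<mu> \<alpha> b) v =
    rel_op p \<mu> \<alpha> (t_gen * b) v - lscale (counit b) (X_op p \<alpha> v) + lscale (rel_red p \<mu> \<alpha> [t_gen, b]) (proj_op p (v :: 'k lvec))"
proof -
  obtain P where P: "p = Suc P" "P > 0" using p3 by (metis Suc_le_D Suc_le_mono numeral_3_eq_3 zero_less_Suc less_eq_Suc_le)
  define c where "c i = coeff (coeff b 0) i" for i
  define d where "d i = coeff (coeff b 1) i" for i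
  define X where "X i = (ad_s p \<mu> ^^ i) (X_op p \<alpha>) v" for i
  have q: "rel_red p \<mu> \<alpha> [t_gen, b] = \<alpha> * d 0"
    by (simp add: rel_red_pair d_def tau_def[of b]) (simp add: t_gen_def)
  have at: "ad_t p \<alpha> ((ad_s p \<mu> ^^ i) (X_op p \<alpha>)) v = (if i = 0 then lscale \<alpha> (proj_op p v) else 0)" for i
    using ad_t_X_Suc[where i = "i - 1" and v = v and \<alpha> = \<alpha> and \<mu> = \<mu>] ad_t_X[OF p_ge_2, of \<alpha> v]
    by (cases i) auto
  have "(\<Sum>i<p. lscale (d i) (if i = 0 then w else 0)) = lscale (d 0) w" for w :: "'k lvec"
    unfolding P(1) sum.lessThan_Suc_shift by (simp add: fun_eq_iff sum_lvec)
  then have "(\<Sum>i<p. lscale (d i) (ad_t p \<alpha> ((ad_s p \<mu> ^^ i) (X_op p \<alpha>)) v)) = lscale (d 0) (lscale \<alpha> (proj_op p v))"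
    unfolding at .
  then have "ad_t p \<alpha> (rel_op p \<mu> \<alpha> b) v =
      (\<Sum>i<P. lscale (c (Suc i)) (X (Suc i))) + lscale (d 0) (lscale \<alpha> (proj_op p v))"
    unfolding rel_op_def[abs_def] ad_plus[OF p_ge_2] ad_sum[OF p_ge_2] ad_t_Y
    by (simp add: c_def d_def X_def P(1))
  moreover have "rel_op p \<mu> \<alpha> (t_gen * b) v = (\<Sum>i<p. lscale (c i) (X i))"
    by (simp add: rel_op_def c_def X_def) (simp add: fun_eq_iff sum_lvec)
  moreover have "(\<Sum>i<p. lscale (c i) (X i)) = lscale (c 0) (X 0) + (\<Sum>i<P. lscale (c (Suc i)) (X (Suc i)))"
    unfolding P(1) by (rule sum.lessThan_Suc_shift)
  moreover have "X 0 = X_op p \<alpha> v" "c 0 = counit b" by (simp_all add: X_def c_def counit_def)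
  moreover have "lscale (rel_red p \<mu> \<alpha> [t_gen, b]) (proj_op p v) = lscale (d 0) (lscale \<alpha> (proj_op p v))"
    unfolding q by (simp add: fun_eq_iff algebra_simps)
  ultimately show ?thesis by (simp add: algebra_simps)
qed

text \<open>The common argument for x = s and x = t: the terms with w cancel, and the rest is the
  cocycle identity of \<open>rel_red\<close> at (x, a, b).\<close>

lemma ad_rel_bar_aux:
  assumes "\<And>b. D (rel_op p \<mu> \<alpha> b) v =
      rel_op p \<mu> \<alpha> (x * b) v - lscale (counit b) w + lscale (rel_red p \<mu> \<alpha> [x, b]) (proj_op p (v :: 'k lvec))"
    and "\<And>\<Phi> \<Psi>. D (\<lambda>v. \<Phi> v + \<Psi> v) v = D \<Phi> v + D \<Psi> v" "\<And>c \<Phi>. D (\<lambda>v. lscale c (\<Phi> v)) v = lscale c (D \<Phi> v)"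
    and "D (proj_op p) v = 0" and "counit x = 0"
  shows "D (rel_bar p \<mu> \<alpha> a b) v = rel_bar p \<mu> \<alpha> (x * a) b v"
proof -
  have e: "rel_bar p \<mu> \<alpha> a b = (\<lambda>v. (rel_op p \<mu> \<alpha> (a * b) v + lscale (- counit b) (rel_op p \<mu> \<alpha> a v)) +
     lscale (rel_red p \<mu> \<alpha> [a, b]) (proj_op p v))"
    by (simp add: fun_eq_iff rel_bar_def)
  have q: "rel_red p \<mu> \<alpha> [x, a * b] = rel_red p \<mu> \<alpha> [x * a, b] + counit b * rel_red p \<mu> \<alpha> [x, a]"
    using rel_red_cocycle[of x p \<mu> \<alpha> a b] assms(5) by (simp add: algebra_simps)
  show ?thesis
    unfolding e assms(1-4) unfolding rel_bar_def q
    by (simp add: fun_eq_iff algebra_simps)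
qed

lemma ad_s_rel_bar: "ad_s p \<mu> (rel_bar p \<mu> \<alpha> a b) v = rel_bar p \<mu> \<alpha> (s_gen * a) b (v :: 'k lvec)"
  by (rule ad_rel_bar_aux[OF ad_s_rel_op ad_plus(1)[OF p_ge_2] ad_scale(1)[OF p_ge_2] ad_proj(1)[OF p_ge_2] counit_s_gen])

lemma ad_t_rel_bar: "ad_t p \<alpha> (rel_bar p \<mu> \<alpha> a b) v = rel_bar p \<mu> \<alpha> (t_gen * a) b (v :: 'k lvec)"
  by (rule ad_rel_bar_aux[OF ad_t_rel_op ad_plus(2)[OF p_ge_2] ad_scale(2)[OF p_ge_2] ad_proj(2)[OF p_ge_2] counit_t_gen])

lemma lin_rel_bar: "lin_op (rel_bar p \<mu> \<alpha> a (b :: 'k st))"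
proof -
  have l: "lin_op ((ad_s p \<mu> ^^ i) (Y_op p \<mu>))" "lin_op ((ad_s p \<mu> ^^ i) (X_op p \<alpha>))" for i
    by (intro lin_ad_s_pow[OF p_ge_2] lin_Y[OF p_ge_2] lin_X[OF p_ge_2])+
  have "lin_op (rel_op p \<mu> \<alpha> a)" for a :: "'k st"
    using l unfolding lin_op_def rel_op_def
    by (simp add: fun_eq_iff sum_lvec sum.distrib sum_distrib_left algebra_simps)
  then have r: "rel_op p \<mu> \<alpha> a (v + w) = rel_op p \<mu> \<alpha> a v + rel_op p \<mu> \<alpha> a w"
    "rel_op p \<mu> \<alpha> a (lscale c v) = lscale c (rel_op p \<mu> \<alpha> a v)" for a :: "'k st" and v w c
    unfolding lin_op_def by blast+
  have "proj_op p (v + w) = proj_op p v + proj_op p w" "proj_op p (lscale c v) = lscale c (proj_op p v)" for v w :: "'k lvec" and c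
    using lin_proj[OF p_ge_2] unfolding lin_op_def by blast+
  then show ?thesis
    unfolding lin_op_def rel_bar_def r by (simp only:) (simp add: fun_eq_iff algebra_simps)
qed

text \<open>The grading of L does not depend on its parameters, so (0, 0) serves as a placeholder;
  \<open>part_eq\<close> transfers the result.\<close>

definition par_op :: "bit \<Rightarrow> ('k lvec \<Rightarrow> 'k lvec) \<Rightarrow> bool" where
  "par_op r \<Phi> \<longleftrightarrow> (\<forall>j. \<forall>v\<in>part (L_smod p (0, 0 :: 'k)) j. \<Phi> v \<in> part (L_smod p (0, 0)) (r + j))"

lemma part_eq: "part (L_smod p (\<mu>, \<alpha>)) = part (L_smod p (0, 0 :: 'k))"
  by (simp add: L_smod_def)

lemma part_add: "v \<in> part (L_smod p (0, 0 :: 'k)) j \<Longrightarrow> w \<in> part (L_smod p (0, 0)) j \<Longrightarrow> v + w \<in> part (L_smod p (0, 0)) j"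
  unfolding L_part by (auto) (metis add.right_neutral)+

lemma part_scale: "(c \<noteq> 0 \<Longrightarrow> v \<in> part (L_smod p (0, 0 :: 'k)) j) \<Longrightarrow> lscale c v \<in> part (L_smod p (0, 0)) j"
  by (auto simp: L_part)

lemma part_diff: "v \<in> part (L_smod p (0, 0 :: 'k)) j \<Longrightarrow> w \<in> part (L_smod p (0, 0)) j \<Longrightarrow> v - w \<in> part (L_smod p (0, 0)) j"
  unfolding L_part by (auto) (metis diff_zero)+

lemma part_sum: "(\<And>i. i < n \<Longrightarrow> w i \<in> part (L_smod p (0, 0 :: 'k)) j) \<Longrightarrow> (\<Sum>i<(n::nat). w i) \<in> part (L_smod p (0, 0)) j"
proof (induction n)
  case 0 show ?case by (simp add: L_part)
next
  case (Suc n)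
  then show ?case unfolding sum.lessThan_Suc by (intro part_add) auto
qed

lemma par_ad_s_pow: assumes "par_op r \<Phi>" shows "par_op r ((ad_s p \<mu> ^^ n) \<Phi>)"
proof (induction n)
  case 0 then show ?case using assms by simp
next
  case (Suc n)
  have s: "L_s p \<mu> v \<in> part (L_smod p (0, 0)) j" if "v \<in> part (L_smod p (0, 0 :: 'k)) j" for v j
    using that p_ge_2 by (auto simp: L_part L_s_eq split: if_splits)
  show ?case
    using Suc s unfolding par_op_def by (auto simp: ad_s_def intro!: part_diff)
qed

lemma par_X: "par_op 1 (X_op p \<alpha>)" and par_Y: "par_op 0 (Y_op p \<mu>)" and par_proj: "par_op 0 (proj_op p)"
  using p3 by (auto simp: par_op_def L_part X_op_def Y_op_def proj_op_def split: if_splits)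

lemma par_rel_op: assumes "b \<in> st_part i" "v \<in> part (L_smod p (0, 0 :: 'k)) j"
  shows "rel_op p \<mu> \<alpha> b v \<in> part (L_smod p (0, 0)) (i + j)"
proof -
  have c: "coeff (coeff b 0) l \<noteq> 0 \<Longrightarrow> i = 0" "coeff (coeff b 1) l \<noteq> 0 \<Longrightarrow> i = 1" for l
    using st_partD[OF assms(1), of 0] st_partD[OF assms(1), of 1] by fastforce+
  show ?thesis
    unfolding rel_op_def
  proof (intro part_add part_sum part_scale)
    fix l assume "coeff (coeff b 0) (Suc l) \<noteq> 0"
    then have "i = 0" by (rule c)
    then show "(ad_s p \<mu> ^^ l) (Y_op p \<mu>) v \<in> part (L_smod p (0, 0)) (i + j)"
      using par_ad_s_pow[OF par_Y] assms(2) by (simp add: par_op_def)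
  next
    fix l assume "coeff (coeff b 1) l \<noteq> 0"
    then have "i = 1" by (rule c)
    then show "(ad_s p \<mu> ^^ l) (X_op p \<alpha>) v \<in> part (L_smod p (0, 0)) (i + j)"
      using par_ad_s_pow[OF par_X] assms(2) by (simp add: par_op_def)
  qed
qed

lemma par_rel_bar:
  assumes "a \<in> st_part i" "b \<in> st_part i'" "v \<in> part (L_smod p (0, 0 :: 'k)) j"
  shows "rel_bar p \<mu> \<alpha> a b v \<in> part (L_smod p (0, 0)) (i + i' + j)"
  unfolding rel_bar_def
proof (intro part_add part_diff part_scale)
  show "rel_op p \<mu> \<alpha> (a * b) v \<in> part (L_smod p (0, 0)) (i + i' + j)"
    by (rule par_rel_op[OF st_part_mult[OF assms(1,2)] assms(3)])
  assume "counit b \<noteq> 0"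
  then have "i' = 0" by (rule counit_st_part[OF assms(2)])
  then show "rel_op p \<mu> \<alpha> a v \<in> part (L_smod p (0, 0)) (i + i' + j)" using par_rel_op[OF assms(1,3)] by simp
next
  assume "rel_red p \<mu> \<alpha> [a, b] \<noteq> 0"
  moreover have "has_parity 0 (rel_red p \<mu> \<alpha>)" by (rule cocyc_parity[OF rel_red_cocyc]) (use p3 in simp)
  ultimately have "of_nat (length [a, b]) + 0 + sum_list [i, i'] = 0"
    using assms by (intro has_parityD) auto
  then have "i + i' = 0" by simp
  then show "proj_op p v \<in> part (L_smod p (0, 0)) (i + i' + j)"
    using par_proj assms(3) by (auto simp: par_op_def)
qed

lemma rel_cochain_bar_cochain:
  "bar_cochain (M11_ideal p) (L_smod p (\<mu>, \<alpha>)) (L_smod p (\<mu>, \<alpha> :: 'k)) 1 (rel_cochain p \<mu> \<alpha>)"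
proof -
  let ?C = "smod_carrier (L_smod p (\<mu>, \<alpha>))"
  have two: "\<exists>a b. as = [a, b]" if "length as = 2" for as :: "'k st list"
    using that by (auto simp: numeral_2_eq_2 length_Suc_conv)
  have C: "v + w \<in> ?C" "lscale c v \<in> ?C" "L_s p \<mu> v \<in> ?C" "L_t p \<alpha> v \<in> ?C" if "v \<in> ?C" "w \<in> ?C" for v w c
    using that p_ge_2 by (auto simp: L_carrier L_s_eq L_t_eq split: if_splits) (metis add.right_neutral)
  have nz: "rel_cochain p \<mu> \<alpha> as v = 0" if "length as \<noteq> 2 \<or> v \<notin> ?C" for as v
    using that by (auto simp: rel_cochain_def)
  have val: "rel_cochain p \<mu> \<alpha> [a, b] v = rel_bar p \<mu> \<alpha> a b v" if "v \<in> ?C" for a b v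
    using that by (simp add: rel_cochain_def)
  have lin: "rel_bar p \<mu> \<alpha> a b (v + w) = rel_bar p \<mu> \<alpha> a b v + rel_bar p \<mu> \<alpha> a b w"
    "rel_bar p \<mu> \<alpha> a b (lscale c v) = lscale c (rel_bar p \<mu> \<alpha> a b v)" for a b v w c
    using lin_rel_bar unfolding lin_op_def by blast+
  have sl: "lscale c 0 = (0 :: 'k lvec)" for c by (simp add: fun_eq_iff)
  have slot: "(\<exists>c. as = [] \<and> bs = [c]) \<or> (\<exists>c. as = [c] \<and> bs = [])" if "length (as @ x # bs) = 2" for as bs and x :: "'k st"
    using that by (cases as; cases bs) auto
  show ?thesis
    unfolding bar_cochain_def L_smod_sel
  proof (intro conjI allI ballI impI)
    show "rel_cochain p \<mu> \<alpha> [] = 0" by (rule ext) (simp add: nz)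
    show "\<exists>N. \<forall>as. N < length as \<longrightarrow> rel_cochain p \<mu> \<alpha> as = 0"
      by (intro exI[of _ 2]) (auto simp: fun_eq_iff nz)
  next
    fix as :: "'k st list" and v assume "v \<notin> ?C" then show "rel_cochain p \<mu> \<alpha> as v = 0" by (simp add: nz)
  next
    fix as :: "'k st list" and v w :: "'k lvec" and c :: 'k assume v: "v \<in> ?C"
    show "rel_cochain p \<mu> \<alpha> as (lscale c v) = lscale c (rel_cochain p \<mu> \<alpha> as v)"
      using v C(2)[OF v v] by (simp add: rel_cochain_def lin sl)
    assume w: "w \<in> ?C"
    show "rel_cochain p \<mu> \<alpha> as (v + w) = rel_cochain p \<mu> \<alpha> as v + rel_cochain p \<mu> \<alpha> as w"
      using v w C(1)[OF v w] by (simp add: rel_cochain_def lin)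
  next
    fix as bs :: "'k st list" and a b :: "'k st"
    show "rel_cochain p \<mu> \<alpha> (as @ (a + b) # bs) = rel_cochain p \<mu> \<alpha> (as @ a # bs) + rel_cochain p \<mu> \<alpha> (as @ b # bs)"
    proof
      fix v
      show "rel_cochain p \<mu> \<alpha> (as @ (a + b) # bs) v =
          (rel_cochain p \<mu> \<alpha> (as @ a # bs) + rel_cochain p \<mu> \<alpha> (as @ b # bs)) v"
      proof (cases "length (as @ a # bs) = 2 \<and> v \<in> ?C")
        case True
        then show ?thesis using slot[of as a bs] by (auto simp: val rel_bar_linear)
      qed (auto simp: nz)
    qed
  next
    fix as bs :: "'k st list" and a :: "'k st" and c :: 'k and v :: "'k lvec" assume v: "v \<in> ?C"
    show "rel_cochain p \<mu> \<alpha> (as @ [:[:c:]:] * a # bs) v = lscale c (rel_cochain p \<mu> \<alpha> (as @ a # bs) v)"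
    proof (cases "length (as @ a # bs) = 2")
      case True
      then show ?thesis using slot[of as a bs] v by (auto simp: val rel_bar_linear)
    qed (auto simp: nz sl)
  next
    fix as bs :: "'k st list" and a :: "'k st" assume a: "a \<in> M11_ideal p"
    show "rel_cochain p \<mu> \<alpha> (as @ a # bs) = 0"
    proof
      fix v
      show "rel_cochain p \<mu> \<alpha> (as @ a # bs) v = 0 v"
      proof (cases "length (as @ a # bs) = 2 \<and> v \<in> ?C")
        case True
        then show ?thesis using slot[of as a bs] rel_bar_ideal[of p a \<mu> \<alpha>] a p3 by (auto simp: val)
      qed (auto simp: nz)
    qed
  next
    fix as :: "'k st list" and "is" j and v :: "'k lvec"
    assume *: "v \<in> part (L_smod p (\<mu>, \<alpha>)) j" "as \<noteq> []" "list_all2 (\<lambda>a i. a \<in> st_part i) as is"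
    show "rel_cochain p \<mu> \<alpha> as v \<in> part (L_smod p (\<mu>, \<alpha>)) (of_nat (length as - 1) + 1 + sum_list is + j)"
    proof (cases "length as = 2")
      case True
      then obtain a b where ab: "as = [a, b]" using two by blast
      then obtain i i' where i: "is = [i, i']" "a \<in> st_part i" "b \<in> st_part i'" using *(3) by (auto simp: list_all2_Cons1)
      show ?thesis
        using par_rel_bar[OF i(2,3)] *(1) L_part_carrier[OF *(1)] unfolding part_eq[of \<mu> \<alpha>] by (simp add: ab i val)
    next
      case False
      then show ?thesis by (simp add: nz L_part)
    qed
  next
    fix a :: "'k st" and as and v :: "'k lvec" assume v: "v \<in> ?C"
    show "rel_cochain p \<mu> \<alpha> (a # as) (L_s p \<mu> v) + rel_cochain p \<mu> \<alpha> (s_gen * a # as) v = L_s p \<mu> (rel_cochain p \<mu> \<alpha> (a # as) v)"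
    proof (cases "length (a # as) = 2")
      case True
      then obtain b where as: "as = [b]" using two[OF True] by auto
      show ?thesis
        using v C(3)[OF v v] ad_s_rel_bar[of \<mu> \<alpha> a b v] by (simp add: as val ad_s_def algebra_simps)
    qed (simp add: nz lin_op_0[OF lin_L_s[OF p_ge_2]])
  next
    fix a :: "'k st" and as j and v :: "'k lvec" assume v: "v \<in> part (L_smod p (\<mu>, \<alpha>)) j"
    have vC: "v \<in> ?C" by (rule L_part_carrier[OF v])
    show "rel_cochain p \<mu> \<alpha> (a # as) (L_t p \<alpha> v) + koszul j (rel_cochain p \<mu> \<alpha> (t_gen * a # as) v) =
       koszul (of_nat (length as) + 1) (L_t p \<alpha> (rel_cochain p \<mu> \<alpha> (a # as) v))"
    proof (cases "length (a # as) = 2")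
      case True
      then obtain b where as: "as = [b]" using two[OF True] by auto
      \<comment> \<open>Degree 1 and type 1 make the cochain even, so the sign on the right is
        trivial. The only sign left comes from t passing v, and \<open>sgn_op\<close> encodes
        it.\<close>
      have "sgn_op v = koszul j v"
        using v by (cases j) (auto simp: L_part sgn_op_def koszul_def fun_eq_iff)
      then show ?thesis
        using vC C(4)[OF vC vC] ad_t_rel_bar[of \<alpha> \<mu> a b v]
        by (simp add: as val ad_t_def koszul_def lin_op_minus[OF lin_L_t[OF p_ge_2]] lin_op_minus[OF lin_rel_bar] split: if_splits)
           (simp_all add: algebra_simps)
    qed (simp add: nz lin_op_0[OF lin_L_t[OF p_ge_2]])
  qed
qed

text \<open>On [a, b, c] the terms with \<open>rel_op\<close> telescope, and the three values of
  \<open>rel_red\<close> combine by its cocycle identity to \<open>counit a\<close> times the value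
  at [b, c]. The Koszul sign is trivial since the degree is 2.\<close>

lemma bar_diff_rel_cochain:
  assumes "v \<in> part (L_smod p (\<mu>, \<alpha> :: 'k)) j"
  shows "bar_diff (L_smod p (\<mu>, \<alpha>)) (rel_cochain p \<mu> \<alpha>) as v =
    koszul (of_nat (length as - 1) * j) (scl (L_smod p (\<mu>, \<alpha>)) (full (rel_red p \<mu> \<alpha>) as 1) v)"
proof -
  have vC: "v \<in> smod_carrier (L_smod p (\<mu>, \<alpha>))" by (rule L_part_carrier[OF assms])
  have sl: "lscale c 0 = (0 :: 'k lvec)" "lscale 0 w = (0 :: 'k lvec)" for c w by (simp_all add: fun_eq_iff)
  have pv: "proj_op p v = v" using vC by (auto simp: L_carrier proj_op_def fun_eq_iff)
  show ?thesis
  proof (cases "length as = 3")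
    case True
    then obtain a b c where as: "as = [a, b, c]" by (auto simp: numeral_3_eq_3 length_Suc_conv)
    have "bar_diff (L_smod p (\<mu>, \<alpha>)) (rel_cochain p \<mu> \<alpha>) as v =
        rel_bar p \<mu> \<alpha> (a * b) c v - rel_bar p \<mu> \<alpha> a (b * c) v + lscale (counit c) (rel_bar p \<mu> \<alpha> a b v)"
      using vC by (simp add: bar_diff_def as numeral_2_eq_2 lessThan_Suc merge_at_def rel_cochain_def koszul_def)
    also have "\<dots> = lscale (rel_red p \<mu> \<alpha> [a * b, c] - rel_red p \<mu> \<alpha> [a, b * c] + counit c * rel_red p \<mu> \<alpha> [a, b]) v"
      unfolding rel_bar_def pv by (simp add: fun_eq_iff mult.assoc algebra_simps)
    also have "rel_red p \<mu> \<alpha> [a * b, c] - rel_red p \<mu> \<alpha> [a, b * c] + counit c * rel_red p \<mu> \<alpha> [a, b] = counit a * rel_red p \<mu> \<alpha> [b, c]"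
      using rel_red_cocycle[of a p \<mu> \<alpha> b c] by (simp add: algebra_simps)
    finally have e: "bar_diff (L_smod p (\<mu>, \<alpha>)) (rel_cochain p \<mu> \<alpha>) as v = lscale (counit a * rel_red p \<mu> \<alpha> [b, c]) v" .
    have "koszul (of_nat (length as - 1) * j) (scl (L_smod p (\<mu>, \<alpha>)) (full (rel_red p \<mu> \<alpha>) as 1) v) =
        lscale (counit a * rel_red p \<mu> \<alpha> [b, c]) v"
      by (simp add: as full_def)
    then show ?thesis using e by (rule trans[OF _ sym, rotated])
  next
    case False
    have "length (merge_at i as) \<noteq> 2" if "i < length as - 1" for i
      using that False by (auto simp: merge_at_def)
    then have "bar_diff (L_smod p (\<mu>, \<alpha>)) (rel_cochain p \<mu> \<alpha>) as v = 0"
      using False by (auto simp: bar_diff_def rel_cochain_def sl intro!: sum.neutral)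
    moreover have "full (rel_red p \<mu> \<alpha>) as 1 = 0"
    proof -
      consider "as = []" | a where "as = [a]" | a b where "as = [a, b]" | a b c d bs where "as = a # b # c # d # bs"
        | a b c where "as = [a, b, c]" by (metis list.exhaust)
      then show ?thesis using False by cases (auto simp: full_def rel_red_def)
    qed
    ultimately show ?thesis by (simp add: sl)
  qed
qed

lemma rel_red_support: "cls (M11_ideal p) (rel_red p \<mu> \<alpha>) \<in> support_ideal p (L_smod p (\<mu>, \<alpha> :: 'k))"
proof -
  have "p > 0" using p3 by simp
  then have "full (rel_red p \<mu> \<alpha>) \<in> cocycles (M11_ideal p)"
    using rel_red_cocyc cocycles_eq[OF aug_ideal_M11] by blast
  then show ?thesis
    unfolding support_ideal_def cls_def using rel_cochain_bar_cochain bar_diff_rel_cochain by blast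
qed

end

theorem proposition6p2p1:
  fixes p :: nat and \<mu> a :: "'k::alg_closed_field"
  assumes "CHAR('k) = p" and "p \<ge> 3"
    and "\<not> (\<mu> = 0 \<and> a = 0)"
  shows "support_variety p (L_smod p (\<mu>, a ^ p)) = affine_line p (\<mu>, a ^ p)"
proof -
  have p2: "p \<ge> 2" and p_pos: "p > 0" using assms(2) by simp_all
  have prime: "prime p" using prime_CHAR_semidom[where ?'a = 'k] assms(1) p_pos by simp
  then have odd: "odd p" using assms(2) prime_odd_nat by simp
  have "\<not> p dvd 2" using assms(2) by (auto dest: dvd_imp_le)
  then have "(of_nat 2 :: 'k) \<noteq> 0" unfolding of_nat_eq_0_iff_char_dvd assms(1) .
  then have char2: "(2 :: 'k) \<noteq> 0" by simp
  have aug_M11: "aug_ideal (M11_ideal p :: 'k st set)" by (rule aug_ideal_M11[OF p_pos])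
  let ?L = "L_smod p (\<mu>, a ^ p)"
  show ?thesis
  proof (intro subset_antisym subsetI)
    fix m assume "m \<in> support_variety p ?L"
    then have max: "maximalideal m (M11_coh p)" and sub: "support_ideal p ?L \<subseteq> m"
      by (auto simp: support_variety_def M11_spectrum_def)
    have "in_max p m (rel_red p \<mu> (a ^ p))"
      unfolding in_max_def[OF p2 char2 max]
      using rel_red_support[OF assms(2,1)] sub rel_red_cocyc[OF p_pos] by blast
    then have "in_max p m (\<lambda>as. a ^ p * ccup y_red y_red as - \<mu>\<^sup>2 * x_red p as)"
      by (simp add: rel_red_def[abs_def])
    moreover have "\<not> (\<mu> = 0 \<and> a ^ p = 0)" using assms(3) p_pos by simp
    ultimately show "m \<in> affine_line p (\<mu>, a ^ p)"
      by (intro maximal_on_line[OF p2 char2 max])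
  next
    fix m assume "m \<in> affine_line p (\<mu>, a ^ p)"
    then obtain c where m: "m = M11_point p (c * \<mu>, c\<^sup>2 * a ^ p)" by (auto simp: affine_line_def)
    have "X \<in> m" if "X \<in> support_ideal p ?L" for X
    proof -
      obtain f g where f: "X = coh_class (M11_ideal p) f" "f \<in> cocycles (M11_ideal p)"
        "bar_cochain (M11_ideal p) ?L ?L 1 g"
        "\<And>j v as. v \<in> part ?L j \<Longrightarrow> bar_diff ?L g as v = koszul (of_nat (length as - 1) * j) (scl ?L (f as 1) v)"
        using \<open>X \<in> support_ideal p ?L\<close> by (auto simp: support_ideal_def)
      obtain F where F: "F \<in> cocyc (M11_ideal p)" "f = full F" using f(2) by (auto simp: cocycles_eq[OF aug_M11])
      \<comment> \<open>All coefficients vanish, so the polynomial is zero and therefore vanishes at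
        every c: this passes from the point (\<mu>, a^p) to its whole line.\<close>
      have "ev_series p (a ^ p) \<mu> F = 0"
        using L_support_ev[OF assms(2) odd F(1) f(3)] f(4) F(2)
        by (intro poly_eqI) (simp add: coeff_ev_series[OF cocyc_bounded[OF F(1)]])
      then have "chi p (c\<^sup>2 * a ^ p) (c * \<mu>) F = 0"
        by (simp add: chi_rescale[OF cocyc_bounded[OF F(1)]])
      then show ?thesis
        unfolding m M11_point_eq[OF p2 char2] using F f(1) by (auto simp: cls_def)
    qed
    then show "m \<in> support_variety p ?L"
      using M11_point_maximal[OF p2 char2] by (auto simp: support_variety_def M11_spectrum_def m)
  qed
qed

end
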